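(* There exist absolute constants $c_1,c_2>0$ such that for every integer $n\ge2$, every isotropic convex body $K\subset\mathbb{R}^n$ and every hyperplane $H\subset\mathbb{R}^n$ (linear subspace of dimension $n-1$), $$c_1L_K\le L_{P_HK}\le c_2L_K.$$
   Context: $P_H$ denotes the orthogonal projection onto $H$. A convex body $K$ (compact convex set with non-empty interior) in a $d$-dimensional Euclidean space is isotropic if $\mathrm{Vol}_d(K)=1$, its barycenter is at the origin, and there is $L_K>0$ with $\int_K\langle x,\theta\rangle^2\,dx=L_K^2$ for every unit vector $\theta$. Every convex body $K$ has an isotropic image $K_1$ under an invertible affine map, and its isotropy constant is $L_K:=L_{K_1}$ (well defined). $L_{P_HK}$ is taken regarding $P_HK$ as a convex body in the $(n-1)$-dimensional Euclidean space $H$. *)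

theory Defs
  imports "HOL-Analysis.Analysis"
begin

text \<open>
  The constants of the theorem must not depend on the dimension, so the dimension has to be a
  number rather than a type.  All Euclidean spaces are therefore finite-dimensional subspaces
  of one inner product space: the finitely supported real sequences with the standard inner
  product.  Everything below the construction of this space is stated for a finite-dimensional
  subspace \<open>E\<close> of an arbitrary real inner product space, and so applies to
  \<open>\<real>\<^sup>n\<close> and to its hyperplanes alike.
\<close>

subsection \<open>The ambient space\<close>

typedef fin_seq = "{x :: nat \<Rightarrow> real. finite {i. x i \<noteq> 0}}"
  morphisms coord Fin_Seq
  by (rule exI[of _ "\<lambda>_. 0"]) simp

lemma finite_coord: "finite {i. coord x i \<noteq> 0}"
  using coord[of x] by simp

lemma coord_Fin_Seq: "finite {i. f i \<noteq> 0} \<Longrightarrow> coord (Fin_Seq f) = f"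
  by (simp add: Fin_Seq_inverse)

lemma fin_seq_eqI: "(\<And>i. coord x i = coord y i) \<Longrightarrow> x = y"
  by (metis coord_inject ext)

instantiation fin_seq :: real_vector
begin

definition zero_fin_seq :: fin_seq where "0 = Fin_Seq (\<lambda>_. 0)"
definition plus_fin_seq :: "fin_seq \<Rightarrow> fin_seq \<Rightarrow> fin_seq"
  where "x + y = Fin_Seq (\<lambda>i. coord x i + coord y i)"
definition uminus_fin_seq :: "fin_seq \<Rightarrow> fin_seq"
  where "- x = Fin_Seq (\<lambda>i. - coord x i)"
definition minus_fin_seq :: "fin_seq \<Rightarrow> fin_seq \<Rightarrow> fin_seq"
  where "x - y = Fin_Seq (\<lambda>i. coord x i - coord y i)"
definition scaleR_fin_seq :: "real \<Rightarrow> fin_seq \<Rightarrow> fin_seq"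
  where "r *\<^sub>R x = Fin_Seq (\<lambda>i. r * coord x i)"

lemma coord_simps [simp]:
  "coord 0 i = 0"
  "coord (x + y) i = coord x i + coord y i"
  "coord (- x) i = - coord x i"
  "coord (x - y) i = coord x i - coord y i"
  "coord (r *\<^sub>R x) i = r * coord x i"
proof -
  have *: "finite {i. coord x i \<noteq> 0 \<or> coord y i \<noteq> 0}"
    using finite_coord[of x] finite_coord[of y] unfolding Collect_disj_eq by (rule finite_UnI)
  show "coord 0 i = 0"
    by (simp add: zero_fin_seq_def coord_Fin_Seq)
  show "coord (x + y) i = coord x i + coord y i"
    unfolding plus_fin_seq_def by (subst coord_Fin_Seq) (auto intro: finite_subset[OF _ *])
  show "coord (- x) i = - coord x i"
    unfolding uminus_fin_seq_def by (subst coord_Fin_Seq) (auto intro: finite_subset[OF _ *])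
  show "coord (x - y) i = coord x i - coord y i"
    unfolding minus_fin_seq_def by (subst coord_Fin_Seq) (auto intro: finite_subset[OF _ *])
  show "coord (r *\<^sub>R x) i = r * coord x i"
    unfolding scaleR_fin_seq_def by (subst coord_Fin_Seq) (auto intro: finite_subset[OF _ *])
qed

instance
  by standard (auto intro!: fin_seq_eqI simp: algebra_simps)

end

instantiation fin_seq :: real_inner
begin

definition inner_fin_seq :: "fin_seq \<Rightarrow> fin_seq \<Rightarrow> real"
  where "inner_fin_seq x y = (\<Sum>i | coord x i \<noteq> 0. coord x i * coord y i)"
definition norm_fin_seq :: "fin_seq \<Rightarrow> real"
  where "norm_fin_seq x = sqrt (inner x x)"
definition dist_fin_seq :: "fin_seq \<Rightarrow> fin_seq \<Rightarrow> real"
  where "dist_fin_seq x y = norm (x - y)"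
definition sgn_fin_seq :: "fin_seq \<Rightarrow> fin_seq"
  where "sgn_fin_seq x = inverse (norm x) *\<^sub>R x"
definition uniformity_fin_seq :: "(fin_seq \<times> fin_seq) filter"
  where "uniformity_fin_seq = (INF e\<in>{0<..}. principal {(x, y). dist x y < e})"
definition open_fin_seq :: "fin_seq set \<Rightarrow> bool"
  where "open_fin_seq U \<longleftrightarrow> (\<forall>x\<in>U. \<forall>\<^sub>F (x', y) in uniformity. x' = x \<longrightarrow> y \<in> U)"

lemma inner_fin_seq_superset:
  assumes "finite A" "{i. coord x i \<noteq> 0} \<subseteq> A"
  shows "inner x y = (\<Sum>i\<in>A. coord x i * coord y i)"
  unfolding inner_fin_seq_def by (rule sum.mono_neutral_left) (use assms in auto)

instance
proof
  fix x y z :: fin_seq and r :: real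
  let ?A = "{i. coord x i \<noteq> 0} \<union> {i. coord y i \<noteq> 0} \<union> {i. coord z i \<noteq> 0}"
  have fin: "finite ?A"
    by (simp add: finite_coord)
  have sup: "inner u v = (\<Sum>i\<in>?A. coord u i * coord v i)"
    if "{i. coord u i \<noteq> 0} \<subseteq> ?A" for u v
    by (rule inner_fin_seq_superset[OF fin that])
  have subs: "{i. coord x i \<noteq> 0} \<subseteq> ?A" "{i. coord y i \<noteq> 0} \<subseteq> ?A"
    "{i. coord (x + y) i \<noteq> 0} \<subseteq> ?A" "{i. coord (r *\<^sub>R x) i \<noteq> 0} \<subseteq> ?A"
    by auto
  show "inner x y = inner y x"
    by (simp add: sup[OF subs(1)] sup[OF subs(2)] mult.commute)
  show "inner (x + y) z = inner x z + inner y z"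
    by (simp only: sup[OF subs(1)] sup[OF subs(2)] sup[OF subs(3)] coord_simps
        distrib_right sum.distrib)
  show "inner (r *\<^sub>R x) y = r * inner x y"
    by (simp only: sup[OF subs(1)] sup[OF subs(4)] coord_simps sum_distrib_left mult.assoc)
  show "0 \<le> inner x x"
    unfolding inner_fin_seq_def by (rule sum_nonneg) simp
  show "inner x x = 0 \<longleftrightarrow> x = 0"
  proof
    assume "inner x x = 0"
    then have "\<forall>i\<in>{i. coord x i \<noteq> 0}. coord x i * coord x i = 0"
      unfolding inner_fin_seq_def
      by (subst (asm) sum_nonneg_eq_0_iff) (auto simp: finite_coord)
    then show "x = 0"
      by (intro fin_seq_eqI) auto
  qed (simp add: inner_fin_seq_def)
qed (rule norm_fin_seq_def dist_fin_seq_def sgn_fin_seq_def uniformity_fin_seq_def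
      open_fin_seq_def)+

end

definition Rn :: "nat \<Rightarrow> fin_seq set" where
  "Rn n = {x. \<forall>i\<ge>n. coord x i = 0}"

lemma inner_Rn:
  assumes "x \<in> Rn n"
  shows "x \<bullet> y = (\<Sum>i<n. coord x i * coord y i)"
  by (rule inner_fin_seq_superset) (use assms in \<open>auto simp: Rn_def not_le[symmetric]\<close>)

lemma subspace_Rn: "subspace (Rn n)"
  by (auto simp: subspace_def Rn_def)

subsection \<open>Lebesgue measure on a finite-dimensional subspace\<close>

definition is_onb :: "'a::real_inner set \<Rightarrow> 'a set \<Rightarrow> bool" where
  "is_onb E B \<longleftrightarrow> finite B \<and> pairwise orthogonal B \<and> (\<forall>b\<in>B. norm b = 1) \<and> span B = E"

definition onb :: "'a::real_inner set \<Rightarrow> 'a set" where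
  "onb E = (SOME B. is_onb E B)"

lemma is_onb_onb:
  fixes S :: "'a::real_inner set"
  assumes "finite S" "span S = E"
  shows "is_onb E (onb E)"
proof -
  from basis_orthogonal[OF assms(1)] obtain C where
    C: "finite C" "span C = E" "pairwise orthogonal C"
    using assms(2) by metis
  let ?B = "sgn ` (C - {0})"
  have "span ?B = span (C - {0})"
  proof (rule antisym)
    have "sgn c \<in> span (C - {0})" if "c \<in> C - {0}" for c
      unfolding sgn_div_norm using that by (intro span_scale span_base)
    then show "span ?B \<subseteq> span (C - {0})"
      by (intro span_minimal) auto
    have "c \<in> span ?B" if "c \<in> C - {0}" for c
    proof -
      have "norm c *\<^sub>R sgn c \<in> span ?B"
        using that by (intro span_scale span_base) auto
      moreover have "norm c *\<^sub>R sgn c = c"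
        using that by (simp add: sgn_div_norm)
      ultimately show ?thesis
        by simp
    qed
    then show "span (C - {0}) \<subseteq> span ?B"
      by (intro span_minimal) auto
  qed
  moreover have "pairwise orthogonal ?B"
    using C(3) by (auto simp: pairwise_def orthogonal_def sgn_div_norm)
  ultimately have "is_onb E ?B"
    using C by (auto simp: is_onb_def norm_sgn)
  then show ?thesis
    unfolding onb_def by (rule someI)
qed

text \<open>
  The same construction as \<^const>\<open>lborel\<close>, with \<^const>\<open>onb\<close> in place of
  \<^const>\<open>Basis\<close>.  The result does not depend on the choice of the orthonormal basis, since
  Lebesgue measure is invariant under orthogonal maps.
\<close>

definition vol :: "'a::real_inner set \<Rightarrow> 'a measure" where
  "vol E = distr (\<Pi>\<^sub>M b\<in>onb E. lborel) borel (\<lambda>f. \<Sum>b\<in>onb E. f b *\<^sub>R b)"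

text \<open>
  \<^const>\<open>distr\<close> is only meaningful for a measurable map.  As the ambient space need not be
  second countable, this is not covered by the library rules for measurability of sums.
\<close>

lemma measurable_vol:
  fixes B :: "'a::real_inner set"
  assumes "finite B"
  shows "(\<lambda>f. \<Sum>b\<in>B. f b *\<^sub>R b) \<in> (\<Pi>\<^sub>M b\<in>B. lborel) \<rightarrow>\<^sub>M borel"
proof -
  obtain h where h: "bij_betw h {..<card B} B"
    using ex_bij_betw_nat_finite[OF assms] by (auto simp: lessThan_atLeast0)
  define g where "g = (\<lambda>(f :: 'a \<Rightarrow> real) (i::nat). if i < card B then f (h i) else 0)"
  define s where "s = (\<lambda>x :: nat \<Rightarrow> real. \<Sum>i<card B. x i *\<^sub>R h i)"
  have hB: "h i \<in> B" if "i < card B" for i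
    using h that by (auto simp: bij_betw_def)
  have "g \<in> (\<Pi>\<^sub>M b\<in>B. lborel) \<rightarrow>\<^sub>M (\<Pi>\<^sub>M i\<in>UNIV. (borel :: real measure))"
  proof (rule measurable_PiM_single')
    fix i :: nat
    have "(\<lambda>f. f (h i)) \<in> (\<Pi>\<^sub>M b\<in>B. (lborel :: real measure)) \<rightarrow>\<^sub>M borel" if "i < card B"
      using measurable_component_singleton[OF hB[OF that], of "\<lambda>_. lborel :: real measure"]
      by simp
    then show "(\<lambda>f. g f i) \<in> (\<Pi>\<^sub>M b\<in>B. lborel) \<rightarrow>\<^sub>M borel"
      by (cases "i < card B") (auto simp: g_def)
  qed auto
  then have "g \<in> (\<Pi>\<^sub>M b\<in>B. lborel) \<rightarrow>\<^sub>M (borel :: (nat \<Rightarrow> real) measure)"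
    using measurable_cong_sets[OF refl sets_PiM_equal_borel] by blast
  moreover have "continuous_on UNIV s"
    unfolding s_def by (intro continuous_intros continuous_on_product_coordinates)
  then have "s \<in> borel \<rightarrow>\<^sub>M borel"
    by (rule borel_measurable_continuous_onI)
  ultimately have "(\<lambda>f. s (g f)) \<in> (\<Pi>\<^sub>M b\<in>B. lborel) \<rightarrow>\<^sub>M borel"
    by (rule measurable_compose)
  moreover have "s (g f) = (\<Sum>b\<in>B. f b *\<^sub>R b)" for f
    using sum.reindex_bij_betw[OF h, of "\<lambda>b. f b *\<^sub>R b"] by (simp add: s_def g_def)
  ultimately show ?thesis
    by simp
qed

subsection \<open>Convex bodies and the isotropy constant\<close>

definition convex_body :: "'a::real_inner set \<Rightarrow> 'a set \<Rightarrow> bool" where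
  "convex_body E K \<longleftrightarrow>
     K \<subseteq> E \<and> convex K \<and> compact K \<and> (top_of_set E) interior_of K \<noteq> {}"

text \<open>
  The vector-valued integral is written in coordinates: the Bochner integral of the library
  needs a complete codomain, which the ambient space need not be.
\<close>

definition barycenter :: "'a::real_inner set \<Rightarrow> 'a set \<Rightarrow> 'a" where
  "barycenter E K =
     (\<Sum>b\<in>onb E. ((LINT x:K|vol E. x \<bullet> b) / measure (vol E) K) *\<^sub>R b)"

definition isotropic_with :: "'a::real_inner set \<Rightarrow> 'a set \<Rightarrow> real \<Rightarrow> bool" where
  "isotropic_with E K L \<longleftrightarrow>
     convex_body E K \<and> measure (vol E) K = 1 \<and> barycenter E K = 0 \<and> L > 0 \<and>
     (\<forall>\<theta>\<in>E. norm \<theta> = 1 \<longrightarrow> (LINT x:K|vol E. (x \<bullet> \<theta>)\<^sup>2) = L\<^sup>2)"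

definition isotropic :: "'a::real_inner set \<Rightarrow> 'a set \<Rightarrow> bool" where
  "isotropic E K \<longleftrightarrow> (\<exists>L. isotropic_with E K L)"

text \<open>
  Only the restriction of \<open>A\<close> to \<open>E\<close> matters; every linear map on \<open>E\<close> extends to the
  ambient space.
\<close>

definition affine_iso :: "'a::real_inner set \<Rightarrow> ('a \<Rightarrow> 'a) \<Rightarrow> bool" where
  "affine_iso E T \<longleftrightarrow>
     (\<exists>A v. linear A \<and> bij_betw A E E \<and> v \<in> E \<and> T = (\<lambda>x. A x + v))"

definition isotropy_const :: "'a::real_inner set \<Rightarrow> 'a set \<Rightarrow> real" where
  "isotropy_const E K = (THE L. \<exists>T. affine_iso E T \<and> isotropic_with E (T ` K) L)"

definition orth_proj :: "'a::real_inner set \<Rightarrow> 'a \<Rightarrow> 'a" where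
  "orth_proj H x = (THE y. y \<in> H \<and> (\<forall>z\<in>H. orthogonal (x - y) z))"

end

theory Submission
  imports Defs "HOL-Probability.Distributions"
begin

text \<open>
  Let \<open>\<theta>\<close> be a unit normal of \<open>H\<close>, \<open>Q\<close> the projection of \<open>K\<close>, \<open>d = n - 1\<close> its dimension, \<open>V\<close> its
  volume, and \<open>f y\<close> the length of the chord of \<open>K\<close> over \<open>y \<in> Q\<close> in direction \<open>\<theta>\<close>. The function \<open>f\<close> is
  concave on \<open>Q\<close> with integral 1, and \<open>K\<close> has covariance \<open>L\<^sub>K\<^sup>2 I\<close>, so the density \<open>f\<close> on \<open>Q\<close> has
  covariance \<open>L\<^sub>K\<^sup>2 I\<close> as well. By log-concavity of volume, tails of concave functions on a convex
  body decay exponentially; hence \<open>f\<close> has comparable first and fourth moments, and so do linear functionals,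
  which moreover do not concentrate around any value. This makes the covariance of the uniform
  distribution on \<open>Q\<close> comparable to \<open>L\<^sub>K\<^sup>2 I\<close>. As \<open>L\<^sub>Q\<close> is the \<open>2d\<close>-th root of the determinant of
  this covariance divided by \<open>V\<^sup>2\<close>, it remains to see that \<open>V\<close> lies between two exponentials in \<open>d\<close>.
  This follows from \<open>1 \<le> 32 L\<^sub>K\<^sup>2 V\<^sup>2\<close>, from \<open>\<rho> V \<le> 2 ^ d\<close> where \<open>K\<close> contains a ball of radius
  \<open>\<rho> \<sim> L\<^sub>K\<close>, and from crude bounds for \<open>L\<^sub>K\<close>.
\<close>

text \<open>Only the \<open>dim H\<close>-th root of \<open>V\<close> enters
  \<open>isotropy_const\<close>, so factors \<open>C ^ dim H\<close>, and with them all factors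
  polynomial in the dimension, are harmless; this is why bounds for L_K as weak as multiples of
  n^(1/2) and n^(-1/2) suffice. What must hold up to absolute constants is the comparison of
  variances in every single direction. The obstacle there is that \<open>f\<close> is neither
  bounded above by an absolute multiple of its mean 1/V nor bounded below on \<open>Q\<close>.
  Moment inequalities replace pointwise bounds: fourth against first moments for \<open>f\<close>,
  which also yield Paley-Zygmund, and fourth moments of functionals against the mass of a slab. Both
  come from one tail estimate that looks only at the levels 0, w, 2w, ..., so log-concavity at
  midpoints is enough and Prekopa-Leindler is proved in that form. No determinant is computed: the
  volume factor of a linear map is bounded by comparing Gaussian integrals, and Gram-Schmidt for the
  covariance form stands in for the inverse square root of the covariance matrix.\<close>

subsection \<open>Second countability of the ambient space\<close>

lemma fin_seq_norm_le_sum: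
  assumes "x \<in> Rn n"
  shows "norm x \<le> (\<Sum>i<n. \<bar>coord x i\<bar>)"
proof -
  have "(norm x)\<^sup>2 = (\<Sum>i<n. \<bar>coord x i\<bar> * \<bar>coord x i\<bar>)"
    using inner_Rn[OF assms, of x] by (simp add: power2_norm_eq_inner)
  also have "\<dots> \<le> (\<Sum>i<n. \<bar>coord x i\<bar> * (\<Sum>j<n. \<bar>coord x j\<bar>))"
    by (intro sum_mono mult_left_mono member_le_sum) auto
  also have "\<dots> = (\<Sum>i<n. \<bar>coord x i\<bar>)\<^sup>2"
    by (simp add: power2_eq_square sum_distrib_right)
  finally show ?thesis
    by (rule power2_le_imp_le) (auto intro: sum_nonneg)
qed

lemma fin_seq_separable:
  "\<exists>D::fin_seq set. countable D \<and> (\<forall>x. \<forall>e>0. \<exists>d\<in>D. dist d x < e)"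
proof (intro exI conjI allI impI)
  define F where "F = (\<lambda>l::rat list. Fin_Seq (\<lambda>i. if i < length l then of_rat (l ! i) else 0))"
  have F: "coord (F l) i = (if i < length l then of_rat (l ! i) else 0)" for l i
    unfolding F_def by (subst coord_Fin_Seq) (auto intro: finite_subset[of _ "{..<length l}"])
  show "countable (range F)" by simp
  fix x :: fin_seq and e :: real assume e: "e > 0"
  \<comment> \<open>\<open>insert 0\<close> keeps \<open>Max\<close> defined for the zero sequence,
    and \<open>Suc\<close> makes \<open>n\<close> positive, so that \<open>e / n\<close> is a usable
    tolerance per coordinate.\<close>
  define n where "n = Suc (Max (insert 0 {i. coord x i \<noteq> 0}))"
  have x: "x \<in> Rn n"
  proof -
    have "i < n" if "coord x i \<noteq> 0" for i
      unfolding n_def less_Suc_eq_le using that by (intro Max_ge) (auto simp: finite_coord)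
    then show ?thesis by (force simp: Rn_def)
  qed
  have "\<exists>q::rat. \<bar>of_rat q - coord x i\<bar> < e / n" for i
  proof -
    have "coord x i - e / n < coord x i + e / n"
      using e by (simp add: n_def)
    from of_rat_dense[OF this] show ?thesis by (metis abs_diff_less_iff)
  qed
  then obtain q :: "nat \<Rightarrow> rat" where q: "\<And>i. \<bar>of_rat (q i) - coord x i\<bar> < e / n"
    by metis
  let ?d = "F (map q [0..<n])"
  have "?d - x \<in> Rn n"
    using x by (auto simp: Rn_def F)
  then have "dist ?d x \<le> (\<Sum>i<n. \<bar>coord (?d - x) i\<bar>)"
    unfolding dist_norm by (rule fin_seq_norm_le_sum)
  also have "\<dots> < (\<Sum>i<n. e / n)"
    using q by (intro sum_strict_mono) (auto simp: F n_def simp del: upt_Suc)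
  also have "\<dots> = e" by (simp add: n_def)
  finally show "\<exists>d\<in>range F. dist d x < e" by blast
qed

instance fin_seq :: second_countable_topology
proof
  obtain D :: "fin_seq set" where D: "countable D" "\<And>x e. e > 0 \<Longrightarrow> \<exists>d\<in>D. dist d x < e"
    using fin_seq_separable by metis
  define \<B> where "\<B> = (\<lambda>(d, m). ball d (inverse (real (Suc m)))) ` (D \<times> UNIV)"
  have "open S \<longleftrightarrow> generate_topology \<B> S" for S
  proof
    assume S: "open S"
    have "\<exists>b\<in>\<B>. x \<in> b \<and> b \<subseteq> S" if x: "x \<in> S" for x
    proof -
      obtain e where e: "e > 0" "ball x e \<subseteq> S"
        using S x by (metis openE)
      obtain m where m: "inverse (real (Suc m)) < e / 2"
        using reals_Archimedean[of "e / 2"] e by auto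
      obtain d where d: "d \<in> D" "dist d x < inverse (real (Suc m))"
        using D(2)[of "inverse (real (Suc m))" x] by auto
      have "ball d (inverse (real (Suc m))) \<subseteq> S"
      proof
        fix y assume "y \<in> ball d (inverse (real (Suc m)))"
        then have "dist x y < e"
          using dist_triangle[of x y d] d m by (simp add: dist_commute)
        then show "y \<in> S" using e by auto
      qed
      with d show ?thesis unfolding \<B>_def by force
    qed
    then have "S = \<Union>{b \<in> \<B>. b \<subseteq> S}" by auto
    moreover have "generate_topology \<B> (\<Union>{b \<in> \<B>. b \<subseteq> S})"
      by (rule generate_topology.UN) (auto intro: generate_topology.Basis)
    ultimately show "generate_topology \<B> S" by simp
  next
    assume "generate_topology \<B> S"
    then show "open S" by induction (auto simp: \<B>_def)
  qed
  moreover have "countable \<B>" using D(1) by (auto simp: \<B>_def)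
  ultimately show "\<exists>B::fin_seq set set. countable B \<and> open = generate_topology B"
    by (intro exI[of _ \<B>]) (simp add: fun_eq_iff)
qed

text \<open>Joint measurability of maps such as (x, t) to x + t b needs the Borel sets of a product
  to be generated by rectangles, which second countability provides.\<close>

class separable_inner = real_inner + second_countable_topology

instance fin_seq :: separable_inner ..

subsection \<open>Brunn--Minkowski and Prekopa--Leindler at the midpoint\<close>

text \<open>Inner regularity of finite Borel measures is applied to the restriction of
  \<open>lborel\<close> to [-n, n]; then n tends to infinity.\<close>

lemma lborel_inner_regular:
  fixes A :: "real set"
  assumes [measurable]: "A \<in> sets borel"
  shows "emeasure lborel A = (SUP K \<in> {K. K \<subseteq> A \<and> compact K}. emeasure lborel K)" (is "_ = ?S")
proof (rule antisym)
  let ?A = "\<lambda>n::nat. A \<inter> {- real n..real n}"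
  have *: "emeasure lborel (?A n) \<le> ?S" for n
  proof -
    let ?M = "density lborel (indicator {- real n..real n})"
    have M: "emeasure ?M B = emeasure lborel (B \<inter> {- real n..real n})" if "B \<in> sets borel" for B
    proof -
      have "emeasure ?M B = (\<integral>\<^sup>+x. indicator (B \<inter> {- real n..real n}) x \<partial>lborel)"
        using that by (auto simp: emeasure_density indicator_def intro!: nn_integral_cong)
      then show ?thesis using that by simp
    qed
    have "emeasure lborel (?A n) = emeasure ?M A"
      by (simp add: M)
    also have "\<dots> = (SUP K \<in> {K. K \<subseteq> A \<and> compact K}. emeasure ?M K)"
      by (rule inner_regular) (simp_all add: M)
    also have "\<dots> \<le> ?S"
    proof (rule SUP_mono)
      fix K assume K: "K \<in> {K. K \<subseteq> A \<and> compact K}"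
      then have [measurable]: "K \<in> sets borel" by (auto simp: compact_imp_closed)
      have "emeasure ?M K \<le> emeasure lborel K"
        by (subst M) (auto intro!: emeasure_mono)
      with K show "\<exists>L\<in>{K. K \<subseteq> A \<and> compact K}. emeasure ?M K \<le> emeasure lborel L" by blast
    qed
    finally show ?thesis .
  qed
  moreover have "(SUP n. emeasure lborel (?A n)) = emeasure lborel (\<Union>n. ?A n)"
    by (intro SUP_emeasure_incseq) (auto simp: incseq_def)
  moreover have "(\<Union>n. ?A n) = A"
  proof -
    have "\<exists>n. - real n \<le> x \<and> x \<le> real n" for x
      using real_arch_simple[of "\<bar>x\<bar>"] by (metis abs_le_D1 abs_le_D2 minus_le_iff)
    then show ?thesis by auto
  qed
  ultimately have "emeasure lborel A = (SUP n. emeasure lborel (?A n))"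
    by simp
  also have "\<dots> \<le> ?S"
    using * by (rule SUP_least)
  finally show "emeasure lborel A \<le> ?S" .
next
  show "?S \<le> emeasure lborel A"
    by (rule SUP_least) (auto intro: emeasure_mono)
qed

lemma emeasure_lborel_affine_vimage:
  fixes A :: "real set"
  assumes [measurable]: "A \<in> sets borel" and c: "c \<noteq> 0"
  shows "emeasure lborel A = ennreal \<bar>c\<bar> * emeasure lborel {x. t + c * x \<in> A}"
proof -
  have "emeasure lborel A = \<bar>c\<bar> * (\<integral>\<^sup>+x. indicator A (t + c * x) \<partial>lborel)"
    using nn_integral_real_affine[of "indicator A" c t] c by simp
  also have "(\<integral>\<^sup>+x. indicator A (t + c * x) \<partial>lborel) = (\<integral>\<^sup>+x. indicator {x. t + c * x \<in> A} x \<partial>lborel)"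
    by (rule nn_integral_cong) (auto simp: indicator_def)
  also have "\<dots> = emeasure lborel {x. t + c * x \<in> A}"
    by (rule nn_integral_indicator) simp
  finally show ?thesis .
qed

text \<open>With a the maximum of \<open>A\<close> and b the minimum of \<open>B\<close>, the sets
  (A + b)/2 and (a + B)/2 both lie in \<open>C\<close>, meet at most in (a + b)/2, and have half the
  lengths of \<open>A\<close> and \<open>B\<close>.\<close>

lemma brunn_minkowski_midpoint_compact:
  fixes A B C :: "real set"
  assumes AB: "compact A" "compact B" and ne: "A \<noteq> {}" "B \<noteq> {}"
    and C [measurable]: "C \<in> sets borel"
    and mid: "\<And>a b. a \<in> A \<Longrightarrow> b \<in> B \<Longrightarrow> (a + b) / 2 \<in> C"
  shows "emeasure lborel A + emeasure lborel B \<le> 2 * emeasure lborel C"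
proof -
  have [measurable]: "A \<in> sets borel" "B \<in> sets borel"
    using AB by (auto simp: compact_imp_closed)
  obtain a where a: "a \<in> A" "\<And>x. x \<in> A \<Longrightarrow> x \<le> a"
    using compact_attains_sup[OF AB(1) ne(1)] by auto
  obtain b where b: "b \<in> B" "\<And>x. x \<in> B \<Longrightarrow> b \<le> x"
    using compact_attains_inf[OF AB(2) ne(2)] by auto
  let ?A = "{x. - b + 2 * x \<in> A}" and ?B = "{x. - a + 2 * x \<in> B}" and ?z = "(a + b) / 2"
  have "?A \<inter> ?B \<subseteq> {?z}"
    using a(2) b(2) by fastforce
  then have "emeasure lborel (?A \<inter> ?B) = 0"
    by (meson countable_empty countable_insert countable_subset emeasure_lborel_countable)
  then have "AE x in lborel. \<not> (x \<in> ?A \<and> x \<in> ?B)"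
    by (intro AE_I[of _ _ "?A \<inter> ?B"]) auto
  then have "emeasure lborel ?A + emeasure lborel ?B = emeasure lborel (?A \<union> ?B)"
    by (intro emeasure_add_AE[symmetric]) auto
  also have "\<dots> \<le> emeasure lborel C"
  proof (rule emeasure_mono)
    show "?A \<union> ?B \<subseteq> C"
    proof
      fix x assume "x \<in> ?A \<union> ?B"
      then show "x \<in> C"
        using mid[OF _ b(1), of "- b + 2 * x"] mid[OF a(1), of "- a + 2 * x"] by auto
    qed
  qed simp
  finally have "2 * (emeasure lborel ?A + emeasure lborel ?B) \<le> 2 * emeasure lborel C"
    by (intro mult_left_mono) auto
  then show ?thesis
    using emeasure_lborel_affine_vimage[of A 2 "- b"] emeasure_lborel_affine_vimage[of B 2 "- a"]
    by (simp add: distrib_left)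
qed

lemma brunn_minkowski_midpoint:
  fixes A B C :: "real set"
  assumes [measurable]: "A \<in> sets borel" "B \<in> sets borel" "C \<in> sets borel"
    and ne: "A \<noteq> {}" "B \<noteq> {}"
    and mid: "\<And>a b. a \<in> A \<Longrightarrow> b \<in> B \<Longrightarrow> (a + b) / 2 \<in> C"
  shows "emeasure lborel A + emeasure lborel B \<le> 2 * emeasure lborel C"
proof -
  have *: "emeasure lborel K + emeasure lborel L \<le> 2 * emeasure lborel C"
    if KL: "K \<subseteq> A" "compact K" "L \<subseteq> B" "compact L" for K L
  proof -
    \<comment> \<open>\<open>K\<close> and \<open>L\<close> may be empty; adjoining one point of
      \<open>A\<close> and one of \<open>B\<close> makes the compact case applicable.\<close>
    obtain a b where ab: "a \<in> A" "b \<in> B" using ne by auto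
    have "emeasure lborel K + emeasure lborel L \<le> emeasure lborel (insert a K) + emeasure lborel (insert b L)"
      using KL by (intro add_mono emeasure_mono) (auto simp: compact_imp_closed compact_insert)
    also have "\<dots> \<le> 2 * emeasure lborel C"
      using KL ab mid by (intro brunn_minkowski_midpoint_compact) (auto simp: compact_insert)
    finally show ?thesis .
  qed
  have ne': "{K. K \<subseteq> S \<and> compact K} \<noteq> {}" for S :: "real set"
    by (auto intro: exI[of _ "{}"])
  have **: "emeasure lborel A + emeasure lborel L \<le> 2 * emeasure lborel C"
    if L: "L \<subseteq> B" "compact L" for L
    unfolding lborel_inner_regular[OF assms(1)] ennreal_SUP_add_left[OF ne', symmetric]
    by (rule SUP_least) (use L * in blast)
  show ?thesis
    unfolding lborel_inner_regular[OF assms(2)] ennreal_SUP_add_right[OF ne']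
    by (rule SUP_least) (use ** in blast)
qed

section \<open>Prekopa-Leindler on the line, from Brunn-Minkowski for superlevel sets\<close>

lemma nn_integral_layer_cake:
  fixes u :: "real \<Rightarrow> ennreal"
  assumes [measurable]: "u \<in> borel_measurable borel" and le: "\<And>x. u x \<le> 1"
  shows "(\<integral>\<^sup>+x. u x \<partial>lborel) = (\<integral>\<^sup>+t. emeasure lborel {x. ennreal t < u x} * indicator {0..<1} t \<partial>lborel)"
proof -
  have "u x = (\<integral>\<^sup>+t. indicator {x. ennreal t < u x} x * indicator {0..<1} t \<partial>lborel)" for x
  proof -
    obtain r where r: "0 \<le> r" "r \<le> 1" "u x = ennreal r"
      using le[of x] by (cases "u x") (auto simp: top_unique)
    have "(\<integral>\<^sup>+t. indicator {x. ennreal t < u x} x * indicator {0..<1} t \<partial>lborel)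
        = (\<integral>\<^sup>+t. indicator {0..<r} t \<partial>lborel)"
      using r by (intro nn_integral_cong) (auto simp: indicator_def ennreal_less_iff)
    then show ?thesis using r by simp
  qed
  then have "(\<integral>\<^sup>+x. u x \<partial>lborel) = (\<integral>\<^sup>+x. \<integral>\<^sup>+t. indicator {x. ennreal t < u x} x * indicator {0..<1} t \<partial>lborel \<partial>lborel)"
    by (intro nn_integral_cong)
  also have "\<dots> = (\<integral>\<^sup>+t. \<integral>\<^sup>+x. indicator {x. ennreal t < u x} x * indicator {0..<1} t \<partial>lborel \<partial>lborel)"
    by (rule lborel_pair.Fubini') (simp add: indicator_def, measurable)
  also have "\<dots> = (\<integral>\<^sup>+t. emeasure lborel {x. ennreal t < u x} * indicator {0..<1} t \<partial>lborel)"
    by (intro nn_integral_cong) (simp add: nn_integral_multc)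
  finally show ?thesis .
qed

lemma ennreal_four_mult_le: "4 * (a * b) \<le> (a + b :: ennreal)\<^sup>2"
proof (cases "a = top \<or> b = top")
  case False
  then obtain x y where "a = ennreal x" "b = ennreal y" "0 \<le> x" "0 \<le> y"
    by (metis ennreal_cases)
  moreover have "4 * (x * y) \<le> (x + y)\<^sup>2"
    using sum_squares_bound[of x y] by (simp add: power2_sum)
  ultimately show ?thesis
    by (simp add: ennreal_mult[symmetric] ennreal_plus[symmetric] ennreal_power
        ennreal_numeral[symmetric] del: ennreal_plus ennreal_numeral)
qed (auto simp: power2_eq_square)

lemma ennreal_power2_less_imp_less: "a\<^sup>2 < (b::ennreal)\<^sup>2 \<Longrightarrow> a < b"
  by (meson linorder_not_le power_mono zero_le)

text \<open>Because both suprema are 1, the superlevel sets of \<open>u\<close> and \<open>v\<close>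
  are nonempty at exactly the same levels t < 1, so Brunn-Minkowski applies level by level;
  integrating over t gives a bound by the arithmetic mean.\<close>

lemma prekopa_leindler_midpoint_normalized:
  fixes u v w :: "real \<Rightarrow> ennreal"
  assumes [measurable]: "u \<in> borel_measurable borel" "v \<in> borel_measurable borel" "w \<in> borel_measurable borel"
    and sup: "(SUP x. u x) = 1" "(SUP x. v x) = 1"
    and mid: "\<And>x y. u x * v y \<le> (w ((x + y) / 2))\<^sup>2"
  shows "(\<integral>\<^sup>+x. u x \<partial>lborel) + (\<integral>\<^sup>+x. v x \<partial>lborel) \<le> 2 * (\<integral>\<^sup>+x. w x \<partial>lborel)"
proof -
  have u1: "u x \<le> 1" and v1: "v x \<le> 1" for x
    using sup by (metis SUP_upper UNIV_I)+
  \<comment> \<open>The layer cake formula is for functions up to 1; cutting \<open>w\<close> there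
    leaves its superlevel sets at levels t < 1 unchanged.\<close>
  define w' where "w' x = min 1 (w x)" for x
  have [measurable]: "w' \<in> borel_measurable borel" unfolding w'_def by simp
  let ?U = "\<lambda>t. {x. ennreal t < u x}" and ?V = "\<lambda>t. {x. ennreal t < v x}" and ?W = "\<lambda>t. {x. ennreal t < w' x}"
  have le: "emeasure lborel (?U t) * indicator {0..<1} t + emeasure lborel (?V t) * indicator {0..<1} t
     \<le> 2 * (emeasure lborel (?W t) * indicator {0..<1} t)" for t
  proof (cases "t \<in> {0..<1}")
    case True
    then have t: "ennreal t < 1" "0 \<le> t"
      by (auto simp: ennreal_less_one_iff)
    have "(?U t) \<noteq> {}" "(?V t) \<noteq> {}"
      using t(1) sup by (metis (mono_tags, lifting) empty_Collect_eq less_SUP_iff)+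
    moreover have "ennreal t < w' ((x + y) / 2)" if "ennreal t < u x" "ennreal t < v y" for x y
    proof -
      have "(ennreal t)\<^sup>2 < u x * v y"
      proof -
        obtain p q where "u x = ennreal p" "v y = ennreal q" "0 \<le> p" "0 \<le> q"
          using u1[of x] v1[of y] by (metis ennreal_cases ennreal_one_less_top linorder_not_le)
        then show ?thesis
          using that t mult_strict_mono'[of t p t q]
          by (simp add: ennreal_power ennreal_mult[symmetric] ennreal_less_iff power2_eq_square)
      qed
      also have "\<dots> \<le> (w ((x + y) / 2))\<^sup>2" by (rule mid)
      finally show ?thesis
        using t(1) by (auto simp: w'_def dest: ennreal_power2_less_imp_less)
    qed
    ultimately have "emeasure lborel (?U t) + emeasure lborel (?V t)
        \<le> 2 * emeasure lborel (?W t)"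
      by (intro brunn_minkowski_midpoint) auto
    then show ?thesis using True by simp
  qed auto
  have "(\<integral>\<^sup>+x. u x \<partial>lborel) + (\<integral>\<^sup>+x. v x \<partial>lborel) \<le> 2 * (\<integral>\<^sup>+x. w' x \<partial>lborel)"
    using le by (subst (1 2 3) nn_integral_layer_cake)
      (auto simp: u1 v1 w'_def[of "_"] nn_integral_add[symmetric] nn_integral_cmult[symmetric] intro!: nn_integral_mono)
  also have "\<dots> \<le> 2 * (\<integral>\<^sup>+x. w x \<partial>lborel)"
    by (intro mult_left_mono nn_integral_mono) (auto simp: w'_def)
  finally show ?thesis .
qed

text \<open>Dividing \<open>f\<close>, \<open>g\<close>, \<open>h\<close> by a, b and the geometric
  mean of a and b keeps the hypothesis and normalises the suprema; AM-GM turns the arithmetic mean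
  back into a product.\<close>

lemma prekopa_leindler_midpoint_bounded:
  fixes f g h :: "real \<Rightarrow> ennreal"
  assumes [measurable]: "f \<in> borel_measurable borel" "g \<in> borel_measurable borel" "h \<in> borel_measurable borel"
    and fin: "(SUP x. f x) < top" "(SUP x. g x) < top"
    and mid: "\<And>x y. f x * g y \<le> (h ((x + y) / 2))\<^sup>2"
  shows "(\<integral>\<^sup>+x. f x \<partial>lborel) * (\<integral>\<^sup>+x. g x \<partial>lborel) \<le> (\<integral>\<^sup>+x. h x \<partial>lborel)\<^sup>2"
proof (cases "(SUP x. f x) = 0 \<or> (SUP x. g x) = 0")
  case True
  then have "(\<forall>x. f x = 0) \<or> (\<forall>x. g x = 0)"
    by (metis SUP_upper UNIV_I le_zero_eq)
  then show ?thesis by auto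
next
  case False
  obtain a where a: "(SUP x. f x) = ennreal a" "a > 0"
    using fin(1) False by (cases "SUP x. f x") (auto simp: less_le)
  obtain b where b: "(SUP x. g x) = ennreal b" "b > 0"
    using fin(2) False by (cases "SUP x. g x") (auto simp: less_le)
  define c where "c = sqrt (a * b)"
  have c: "c > 0" "c\<^sup>2 = a * b" using a b by (auto simp: c_def)
  let ?u = "\<lambda>x. ennreal (inverse a) * f x" and ?v = "\<lambda>x. ennreal (inverse b) * g x"
    and ?w = "\<lambda>x. ennreal (inverse c) * h x"
  have c2: "ennreal (inverse a) * ennreal (inverse b) = (ennreal (inverse c))\<^sup>2"
    using a b c by (simp add: ennreal_mult[symmetric] ennreal_power power_inverse)
  have "(\<integral>\<^sup>+x. ?u x \<partial>lborel) + (\<integral>\<^sup>+x. ?v x \<partial>lborel) \<le> 2 * (\<integral>\<^sup>+x. ?w x \<partial>lborel)"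
  proof (rule prekopa_leindler_midpoint_normalized)
    show "(SUP x. ?u x) = 1" "(SUP x. ?v x) = 1"
      using a b by (simp_all add: SUP_mult_left_ennreal[symmetric] ennreal_mult[symmetric])
    show "?u x * ?v y \<le> (?w ((x + y) / 2))\<^sup>2" for x y
    proof -
      have "?u x * ?v y = (ennreal (inverse c))\<^sup>2 * (f x * g y)"
        by (simp add: c2[symmetric] mult_ac)
      also have "\<dots> \<le> (ennreal (inverse c))\<^sup>2 * (h ((x + y) / 2))\<^sup>2"
        by (intro mult_left_mono mid) auto
      finally show ?thesis by (simp add: power_mult_distrib)
    qed
  qed simp_all
  moreover define F G W where "F = (\<integral>\<^sup>+x. f x \<partial>lborel)" and "G = (\<integral>\<^sup>+x. g x \<partial>lborel)" and "W = (\<integral>\<^sup>+x. h x \<partial>lborel)"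
  ultimately have "ennreal (inverse a) * F + ennreal (inverse b) * G \<le> 2 * (ennreal (inverse c) * W)"
    by (simp add: nn_integral_cmult)
  then have "(ennreal (inverse a) * F + ennreal (inverse b) * G)\<^sup>2 \<le> (2 * (ennreal (inverse c) * W))\<^sup>2"
    by (rule power_mono) simp
  then have "4 * ((ennreal (inverse a) * F) * (ennreal (inverse b) * G)) \<le> (2 * (ennreal (inverse c) * W))\<^sup>2"
    using ennreal_four_mult_le order_trans by blast
  moreover have "4 * ((ennreal (inverse a) * F) * (ennreal (inverse b) * G)) = (4 * (ennreal (inverse c))\<^sup>2) * (F * G)"
    by (simp add: c2[symmetric] mult_ac)
  moreover have "(2 * (ennreal (inverse c) * W))\<^sup>2 = (4 * (ennreal (inverse c))\<^sup>2) * W\<^sup>2"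
    by (simp add: power_mult_distrib mult.assoc)
  ultimately have *: "(4 * (ennreal (inverse c))\<^sup>2) * (F * G) \<le> (4 * (ennreal (inverse c))\<^sup>2) * W\<^sup>2"
    by simp
  have 4: "4 * (ennreal (inverse c))\<^sup>2 = ennreal (4 * (inverse c)\<^sup>2)"
    using c by (simp add: ennreal_mult ennreal_power)
  have "F * G \<le> W\<^sup>2"
    using * c unfolding 4 by (subst (asm) ennreal_mult_le_mult_iff) auto
  then show ?thesis by (simp add: F_def G_def W_def)
qed

lemma nn_integral_truncate:
  fixes f :: "'b \<Rightarrow> ennreal"
  assumes [measurable]: "f \<in> borel_measurable M"
  shows "(\<integral>\<^sup>+x. f x \<partial>M) = (SUP n::nat. \<integral>\<^sup>+x. min (f x) (of_nat n) \<partial>M)"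
proof -
  have "(SUP n::nat. min (f x) (of_nat n)) = f x" for x
  proof (cases "f x = top")
    case True
    then show ?thesis using ennreal_SUP_of_nat_eq_top by simp
  next
    case False
    then obtain n where "f x \<le> of_nat n"
      using ennreal_Ex_less_of_nat[of "f x"] by (metis less_imp_le less_top)
    then show ?thesis
      by (intro antisym SUP_least SUP_upper2[of n]) auto
  qed
  then have "(\<integral>\<^sup>+x. f x \<partial>M) = (\<integral>\<^sup>+x. (SUP n::nat. min (f x) (of_nat n)) \<partial>M)" by simp
  also have "\<dots> = (SUP n::nat. \<integral>\<^sup>+x. min (f x) (of_nat n) \<partial>M)"
    by (rule nn_integral_monotone_convergence_SUP)
      (auto simp: incseq_def le_fun_def min_def intro: order_trans)
  finally show ?thesis .
qed

text \<open>Truncating \<open>f\<close> and \<open>g\<close> only shrinks the left side of the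
  hypothesis, and monotone convergence removes the truncation.\<close>

lemma prekopa_leindler_midpoint:
  fixes f g h :: "real \<Rightarrow> ennreal"
  assumes [measurable]: "f \<in> borel_measurable borel" "g \<in> borel_measurable borel" "h \<in> borel_measurable borel"
    and mid: "\<And>x y. f x * g y \<le> (h ((x + y) / 2))\<^sup>2"
  shows "(\<integral>\<^sup>+x. f x \<partial>lborel) * (\<integral>\<^sup>+x. g x \<partial>lborel) \<le> (\<integral>\<^sup>+x. h x \<partial>lborel)\<^sup>2"
proof -
  have *: "(\<integral>\<^sup>+x. min (f x) (of_nat m) \<partial>lborel) * (\<integral>\<^sup>+x. min (g x) (of_nat n) \<partial>lborel) \<le> (\<integral>\<^sup>+x. h x \<partial>lborel)\<^sup>2"
    for m n :: nat
  proof (rule prekopa_leindler_midpoint_bounded)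
    show "min (f x) (of_nat m) * min (g y) (of_nat n) \<le> (h ((x + y) / 2))\<^sup>2" for x y
      by (rule order_trans[OF mult_mono mid]) auto
    show "(SUP x. min (f x) (of_nat m)) < top" "(SUP x. min (g x) (of_nat n)) < top"
      by (rule le_less_trans[OF SUP_least of_nat_less_top], rule min.cobounded2)+
  qed simp_all
  have "(\<integral>\<^sup>+x. min (f x) (of_nat m) \<partial>lborel) * (\<integral>\<^sup>+x. g x \<partial>lborel) \<le> (\<integral>\<^sup>+x. h x \<partial>lborel)\<^sup>2" for m :: nat
    using * by (subst nn_integral_truncate[of g]) (auto simp: SUP_mult_left_ennreal intro!: SUP_least)
  then show ?thesis
    by (subst nn_integral_truncate[of f]) (auto simp: SUP_mult_right_ennreal intro!: SUP_least)
qed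

subsection \<open>Lebesgue measure in coordinates\<close>

text \<open>The construction of \<open>vol\<close> for an explicit basis, so that proofs can run by
  induction over the basis and choices of basis can be compared.\<close>

definition onb_vol :: "'a::real_inner set \<Rightarrow> 'a measure" where
  "onb_vol B = distr (\<Pi>\<^sub>M b\<in>B. lborel) borel (\<lambda>f. \<Sum>b\<in>B. f b *\<^sub>R b)"

definition orthonormal :: "'a::real_inner set \<Rightarrow> bool" where
  "orthonormal B \<longleftrightarrow> finite B \<and> pairwise orthogonal B \<and> (\<forall>b\<in>B. norm b = 1)"

lemma vol_eq_onb_vol: "vol E = onb_vol (onb E)"
  by (simp add: vol_def onb_vol_def)

lemma is_onb_iff: "is_onb E B \<longleftrightarrow> orthonormal B \<and> span B = E"
  by (auto simp: is_onb_def orthonormal_def)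

lemma orthonormal_finite: "orthonormal B \<Longrightarrow> finite B"
  by (simp add: orthonormal_def)

lemma orthonormal_inner:
  "orthonormal B \<Longrightarrow> a \<in> B \<Longrightarrow> b \<in> B \<Longrightarrow> a \<bullet> b = (if a = b then 1 else 0)"
  by (auto simp: orthonormal_def pairwise_def orthogonal_def norm_eq_1)

lemma orthonormal_sum_inner:
  assumes "orthonormal B" "b \<in> B"
  shows "(\<Sum>a\<in>B. f a *\<^sub>R a) \<bullet> b = f b"
proof -
  have "(\<Sum>a\<in>B. f a *\<^sub>R a) \<bullet> b = (\<Sum>a\<in>B. if a = b then f a else 0)"
    using assms by (auto simp: inner_sum_left orthonormal_inner intro!: sum.cong)
  then show ?thesis using assms by (simp add: orthonormal_finite)
qed

lemma orthonormal_expand: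
  assumes "orthonormal B" "x \<in> span B"
  shows "(\<Sum>b\<in>B. (x \<bullet> b) *\<^sub>R b) = x"
proof -
  obtain f where f: "x = (\<Sum>a\<in>B. f a *\<^sub>R a)"
    using assms by (auto simp: span_finite orthonormal_finite)
  show ?thesis
    unfolding f using assms(1) by (intro sum.cong) (simp_all add: orthonormal_sum_inner)
qed

lemma orthonormal_parseval:
  assumes "orthonormal B" "x \<in> span B"
  shows "x \<bullet> y = (\<Sum>b\<in>B. (x \<bullet> b) * (y \<bullet> b))"
proof -
  have "x \<bullet> y = (\<Sum>b\<in>B. (x \<bullet> b) *\<^sub>R b) \<bullet> y"
    by (simp only: orthonormal_expand[OF assms])
  then show ?thesis by (simp add: inner_sum_left inner_commute[of y])
qed

lemma orthonormal_norm2: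
  assumes "orthonormal B" "x \<in> span B"
  shows "(norm x)\<^sup>2 = (\<Sum>b\<in>B. (x \<bullet> b)\<^sup>2)"
  using orthonormal_parseval[OF assms, of x] by (simp only: power2_norm_eq_inner) (simp add: power2_eq_square)

lemma orthonormal_card:
  assumes "orthonormal B"
  shows "card B = dim (span B)"
proof -
  have "independent B"
    using assms pairwise_orthogonal_independent[of B] by (fastforce simp: orthonormal_def)
  then show ?thesis by (simp add: dim_span dim_eq_card_independent)
qed

lemma sets_onb_vol [simp, measurable_cong]: "sets (onb_vol B) = sets borel"
  by (simp add: onb_vol_def)

lemma space_onb_vol [simp]: "space (onb_vol B) = UNIV"
  by (simp add: onb_vol_def)

lemma nn_integral_onb_vol:
  assumes "finite B" "g \<in> borel_measurable borel"
  shows "(\<integral>\<^sup>+x. g x \<partial>onb_vol B) = (\<integral>\<^sup>+f. g (\<Sum>b\<in>B. f b *\<^sub>R b) \<partial>(\<Pi>\<^sub>M b\<in>B. lborel))"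
  unfolding onb_vol_def by (rule nn_integral_distr[OF measurable_vol]) (use assms in auto)

lemma nn_integral_onb_vol_empty [simp]:
  assumes [measurable]: "g \<in> borel_measurable borel"
  shows "(\<integral>\<^sup>+x. g x \<partial>onb_vol {}) = g 0"
  by (simp add: nn_integral_onb_vol PiM_empty nn_integral_count_space_finite)

lemma product_sigma_finite_lborel: "product_sigma_finite (\<lambda>b. lborel :: real measure)"
  by (simp add: product_sigma_finite_def sigma_finite_lborel)

lemma borel_measurable_line_integral:
  fixes g :: "'a::separable_inner \<Rightarrow> ennreal"
  assumes [measurable]: "g \<in> borel_measurable borel"
  shows "(\<lambda>x. \<integral>\<^sup>+t. g (x + t *\<^sub>R b) \<partial>lborel) \<in> borel_measurable borel"
  by measurable

text \<open>Fubini in the form that drives every induction over the basis; with \<open>b\<close> the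
  normal of a hyperplane it also slices a body into chords.\<close>

lemma nn_integral_onb_vol_insert:
  fixes g :: "'a::separable_inner \<Rightarrow> ennreal"
  assumes B: "finite B" "b \<notin> B" and [measurable]: "g \<in> borel_measurable borel"
  shows "(\<integral>\<^sup>+x. g x \<partial>onb_vol (insert b B)) = (\<integral>\<^sup>+x. \<integral>\<^sup>+t. g (x + t *\<^sub>R b) \<partial>lborel \<partial>onb_vol B)"
proof -
  interpret product_sigma_finite "\<lambda>b::'a. lborel :: real measure"
    by (rule product_sigma_finite_lborel)
  have meas: "(\<lambda>f. g (\<Sum>a\<in>insert b B. f a *\<^sub>R a)) \<in> borel_measurable (\<Pi>\<^sub>M b\<in>insert b B. lborel)"
    using B by (intro measurable_compose[OF measurable_vol]) auto
  have "(\<integral>\<^sup>+x. g x \<partial>onb_vol (insert b B)) =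
     (\<integral>\<^sup>+f. g (\<Sum>a\<in>insert b B. f a *\<^sub>R a) \<partial>(\<Pi>\<^sub>M b\<in>insert b B. lborel))"
    by (rule nn_integral_onb_vol) (use B in auto)
  also have "\<dots> = (\<integral>\<^sup>+f. \<integral>\<^sup>+t. g (\<Sum>a\<in>insert b B. (f(b := t)) a *\<^sub>R a) \<partial>lborel \<partial>(\<Pi>\<^sub>M b\<in>B. lborel))"
    by (rule product_nn_integral_insert[OF B meas])
  also have "\<dots> = (\<integral>\<^sup>+f. \<integral>\<^sup>+t. g ((\<Sum>a\<in>B. f a *\<^sub>R a) + t *\<^sub>R b) \<partial>lborel \<partial>(\<Pi>\<^sub>M b\<in>B. lborel))"
  proof (intro nn_integral_cong arg_cong[where f = g])
    fix f :: "'a \<Rightarrow> real" and t :: real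
    have "(\<Sum>a\<in>B. (if a = b then t else f a) *\<^sub>R a) = (\<Sum>a\<in>B. f a *\<^sub>R a)"
      using B(2) by (intro sum.cong) auto
    then show "(\<Sum>a\<in>insert b B. (f(b := t)) a *\<^sub>R a) = (\<Sum>a\<in>B. f a *\<^sub>R a) + t *\<^sub>R b"
      using B by (simp add: add.commute)
  qed
  also have "\<dots> = (\<integral>\<^sup>+x. \<integral>\<^sup>+t. g (x + t *\<^sub>R b) \<partial>lborel \<partial>onb_vol B)"
    by (rule nn_integral_onb_vol[symmetric]) (use B in \<open>auto intro: borel_measurable_line_integral\<close>)
  finally show ?thesis .
qed

lemma nn_integral_onb_vol_prod:
  fixes g :: "real \<Rightarrow> ennreal" and B :: "'a::separable_inner set"
  assumes B: "orthonormal B" and [measurable]: "g \<in> borel_measurable borel"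
  shows "(\<integral>\<^sup>+x. (\<Prod>b\<in>B. g (x \<bullet> b)) \<partial>onb_vol B) = (\<integral>\<^sup>+t. g t \<partial>lborel) ^ card B"
proof -
  interpret product_sigma_finite "\<lambda>b::'a. lborel :: real measure"
    by (rule product_sigma_finite_lborel)
  have "(\<integral>\<^sup>+x. (\<Prod>b\<in>B. g (x \<bullet> b)) \<partial>onb_vol B) = (\<integral>\<^sup>+f. (\<Prod>b\<in>B. g (f b)) \<partial>(\<Pi>\<^sub>M b\<in>B. lborel))"
    using B by (subst nn_integral_onb_vol)
      (auto simp: orthonormal_finite orthonormal_sum_inner intro!: nn_integral_cong prod.cong)
  also have "\<dots> = (\<Prod>b\<in>B. \<integral>\<^sup>+t. g t \<partial>lborel)"
    using B by (intro product_nn_integral_prod) (auto simp: orthonormal_finite)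
  finally show ?thesis by simp
qed

text \<open>The measure is carried by \<open>span B\<close>. Stated as an equation between Borel
  functions, so that the exceptional set is visibly measurable.\<close>

lemma AE_onb_vol_expand:
  fixes B :: "'a::separable_inner set"
  assumes B: "orthonormal B"
  shows "AE x in onb_vol B. (\<Sum>b\<in>B. (x \<bullet> b) *\<^sub>R b) = x"
  unfolding onb_vol_def
proof (subst AE_distr_iff)
  show "(\<lambda>f. \<Sum>b\<in>B. f b *\<^sub>R b) \<in> (\<Pi>\<^sub>M b\<in>B. lborel) \<rightarrow>\<^sub>M borel"
    using B by (intro measurable_vol) (simp add: orthonormal_finite)
  show "AE f in \<Pi>\<^sub>M b\<in>B. lborel. (\<Sum>b\<in>B. ((\<Sum>b\<in>B. f b *\<^sub>R b) \<bullet> b) *\<^sub>R b) = (\<Sum>b\<in>B. f b *\<^sub>R b)"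
    using B by (simp add: orthonormal_sum_inner cong: sum.cong)
qed simp

lemma AE_onb_vol_span:
  fixes B :: "'a::separable_inner set"
  assumes B: "orthonormal B"
  shows "AE x in onb_vol B. x \<in> span B"
  using AE_onb_vol_expand[OF B]
proof eventually_elim
  case (elim x)
  then show ?case by (metis (no_types, lifting) span_base span_scale span_sum)
qed

text \<open>Induction over the basis: the component of \<open>v\<close> along \<open>b\<close>
  shifts the inner integral over the line, and the rest, which lies in \<open>span B\<close>, shifts
  the outer one.\<close>

lemma nn_integral_onb_vol_translate:
  fixes g :: "'a::separable_inner \<Rightarrow> ennreal"
  assumes "finite B" and "g \<in> borel_measurable borel" and "v \<in> span B"
  shows "(\<integral>\<^sup>+x. g (x + v) \<partial>onb_vol B) = (\<integral>\<^sup>+x. g x \<partial>onb_vol B)"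
  using assms
proof (induction B arbitrary: g v rule: finite_induct)
  case (insert b B)
  note [measurable] = insert.prems(1)
  obtain s where s: "v - s *\<^sub>R b \<in> span B"
    using insert.prems(2) by (auto simp: span_insert)
  have "(\<integral>\<^sup>+x. g (x + v) \<partial>onb_vol (insert b B)) =
      (\<integral>\<^sup>+x. \<integral>\<^sup>+t. g (x + t *\<^sub>R b + v) \<partial>lborel \<partial>onb_vol B)"
    by (rule nn_integral_onb_vol_insert) (use insert.hyps in auto)
  also have "\<dots> = (\<integral>\<^sup>+x. \<integral>\<^sup>+t. g ((x + (v - s *\<^sub>R b)) + t *\<^sub>R b) \<partial>lborel \<partial>onb_vol B)"
  proof (rule nn_integral_cong)
    fix x
    show "(\<integral>\<^sup>+t. g (x + t *\<^sub>R b + v) \<partial>lborel) = (\<integral>\<^sup>+t. g ((x + (v - s *\<^sub>R b)) + t *\<^sub>R b) \<partial>lborel)"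
      by (subst (2) nn_integral_real_affine[of _ 1 s]) (simp_all add: algebra_simps)
  qed
  also have "\<dots> = (\<integral>\<^sup>+x. \<integral>\<^sup>+t. g (x + t *\<^sub>R b) \<partial>lborel \<partial>onb_vol B)"
    using insert.IH[OF borel_measurable_line_integral[OF insert.prems(1), of b] s] .
  also have "\<dots> = (\<integral>\<^sup>+x. g x \<partial>onb_vol (insert b B))"
    by (rule nn_integral_onb_vol_insert[symmetric]) (use insert.hyps in auto)
  finally show ?case .
qed simp

text \<open>Tensorisation: by the one-dimensional theorem the integrals of \<open>f\<close>,
  \<open>g\<close>, \<open>h\<close> along lines in direction \<open>b\<close> satisfy the same
  hypothesis, to which the induction hypothesis applies.\<close>

lemma prekopa_leindler_onb_vol:
  fixes f g h :: "'a::separable_inner \<Rightarrow> ennreal"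
  assumes "finite B"
    and "f \<in> borel_measurable borel" "g \<in> borel_measurable borel" "h \<in> borel_measurable borel"
    and "\<And>x y. f x * g y \<le> (h ((1/2) *\<^sub>R (x + y)))\<^sup>2"
  shows "(\<integral>\<^sup>+x. f x \<partial>onb_vol B) * (\<integral>\<^sup>+x. g x \<partial>onb_vol B) \<le> (\<integral>\<^sup>+x. h x \<partial>onb_vol B)\<^sup>2"
  using assms
proof (induction B arbitrary: f g h rule: finite_induct)
  case empty
  then show ?case using empty(4)[of 0 0] by simp
next
  case (insert b B)
  note [measurable] = insert.prems(1-3)
  note * = nn_integral_onb_vol_insert[OF insert.hyps]
  show ?case
    unfolding *[OF insert.prems(1)] *[OF insert.prems(2)] *[OF insert.prems(3)]
  proof (rule insert.IH)
    fix x y :: 'a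
    show "(\<integral>\<^sup>+t. f (x + t *\<^sub>R b) \<partial>lborel) * (\<integral>\<^sup>+t. g (y + t *\<^sub>R b) \<partial>lborel)
      \<le> (\<integral>\<^sup>+t. h ((1/2) *\<^sub>R (x + y) + t *\<^sub>R b) \<partial>lborel)\<^sup>2"
    proof (rule prekopa_leindler_midpoint)
      fix s t :: real
      have "(1/2) *\<^sub>R ((x + s *\<^sub>R b) + (y + t *\<^sub>R b)) = (1/2) *\<^sub>R (x + y) + ((s + t) / 2) *\<^sub>R b"
        by (simp add: algebra_simps add_divide_distrib)
      then show "f (x + s *\<^sub>R b) * g (y + t *\<^sub>R b) \<le> (h ((1/2) *\<^sub>R (x + y) + ((s + t) / 2) *\<^sub>R b))\<^sup>2"
        using insert.prems(4)[of "x + s *\<^sub>R b" "y + t *\<^sub>R b"] by simp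
    qed simp_all
  qed simp_all
qed

subsection \<open>Uniqueness of translation-invariant measures\<close>

text \<open>Lebesgue measure on \<open>E\<close> up to a factor, seen as a measure on the ambient
  space. Sigma-finiteness is for Fubini, and invariance is put in terms of integrals because it is
  applied to inner integrals.\<close>

definition haar_on :: "'a::real_inner set \<Rightarrow> 'a measure \<Rightarrow> bool" where
  "haar_on E M \<longleftrightarrow> sets M = sets borel \<and> sigma_finite_measure M \<and> (AE x in M. x \<in> E) \<and>
     (\<forall>v\<in>E. \<forall>g\<in>borel_measurable borel. (\<integral>\<^sup>+x. g (x + v) \<partial>M) = (\<integral>\<^sup>+x. (g x :: ennreal) \<partial>M))"

text \<open>Compute \<open>\<integral>\<integral> \<phi>(x) g(x + y) d\<mu>(x) d\<nu>(y)\<close> in two ways.\<close>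

lemma haar_on_unique:
  fixes \<mu> \<nu> :: "'a::separable_inner measure"
  assumes \<mu>: "haar_on E \<mu>" and \<nu>: "haar_on E \<nu>" and E: "subspace E"
    and [measurable]: "\<phi> \<in> borel_measurable borel" "g \<in> borel_measurable borel"
  shows "(\<integral>\<^sup>+x. \<phi> x \<partial>\<mu>) * (\<integral>\<^sup>+x. g x \<partial>\<nu>) = (\<integral>\<^sup>+x. g x \<partial>\<mu>) * (\<integral>\<^sup>+x. (\<phi> (- x) :: ennreal) \<partial>\<nu>)"
proof -
  have sets [measurable_cong]: "sets \<mu> = sets borel" "sets \<nu> = sets borel"
    using \<mu> \<nu> by (auto simp: haar_on_def)
  interpret \<mu>: sigma_finite_measure \<mu> using \<mu> by (simp add: haar_on_def)
  interpret \<nu>: sigma_finite_measure \<nu> using \<nu> by (simp add: haar_on_def)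
  interpret pair_sigma_finite \<mu> \<nu> ..
  have AE\<mu>: "AE x in \<mu>. x \<in> E" and AE\<nu>: "AE x in \<nu>. x \<in> E"
    using \<mu> \<nu> by (auto simp: haar_on_def)
  have tr\<mu>: "(\<integral>\<^sup>+x. h (x + v) \<partial>\<mu>) = (\<integral>\<^sup>+x. h x \<partial>\<mu>)" 
    if "v \<in> E" "h \<in> borel_measurable borel" for h :: "'a \<Rightarrow> ennreal" and v
    using \<mu> that by (auto simp: haar_on_def)
  have tr\<nu>: "(\<integral>\<^sup>+x. h (x + v) \<partial>\<nu>) = (\<integral>\<^sup>+x. h x \<partial>\<nu>)" 
    if "v \<in> E" "h \<in> borel_measurable borel" for h :: "'a \<Rightarrow> ennreal" and v
    using \<nu> that by (auto simp: haar_on_def)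
  have "(\<integral>\<^sup>+x. \<phi> x \<partial>\<mu>) * (\<integral>\<^sup>+x. g x \<partial>\<nu>) = (\<integral>\<^sup>+x. \<phi> x * (\<integral>\<^sup>+y. g y \<partial>\<nu>) \<partial>\<mu>)"
    by (simp add: nn_integral_multc)
  also have "\<dots> = (\<integral>\<^sup>+x. (\<integral>\<^sup>+y. \<phi> x * g (y + x) \<partial>\<nu>) \<partial>\<mu>)"
    using AE\<mu> by (intro nn_integral_cong_AE) (auto simp: nn_integral_cmult tr\<nu>)
  also have "\<dots> = (\<integral>\<^sup>+y. (\<integral>\<^sup>+x. \<phi> x * g (y + x) \<partial>\<mu>) \<partial>\<nu>)"
    by (rule Fubini'[symmetric]) measurable
  also have "\<dots> = (\<integral>\<^sup>+y. (\<integral>\<^sup>+x. \<phi> (x - y) * g x \<partial>\<mu>) \<partial>\<nu>)"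
  proof (rule nn_integral_cong_AE, use AE\<nu> in eventually_elim)
    fix y assume "y \<in> E"
    then show "(\<integral>\<^sup>+x. \<phi> x * g (y + x) \<partial>\<mu>) = (\<integral>\<^sup>+x. \<phi> (x - y) * g x \<partial>\<mu>)"
      using tr\<mu>[of y "\<lambda>x. \<phi> (x - y) * g x"] by (simp add: add.commute)
  qed
  also have "\<dots> = (\<integral>\<^sup>+x. (\<integral>\<^sup>+y. \<phi> (x - y) * g x \<partial>\<nu>) \<partial>\<mu>)"
    by (rule Fubini') measurable
  also have "\<dots> = (\<integral>\<^sup>+x. (\<integral>\<^sup>+y. \<phi> (- y) \<partial>\<nu>) * g x \<partial>\<mu>)"
  proof (rule nn_integral_cong_AE, use AE\<mu> in eventually_elim)
    fix x assume "x \<in> E"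
    then show "(\<integral>\<^sup>+y. \<phi> (x - y) * g x \<partial>\<nu>) = (\<integral>\<^sup>+y. \<phi> (- y) \<partial>\<nu>) * g x"
      using tr\<nu>[of x "\<lambda>y. \<phi> (x - y)"] by (simp add: nn_integral_multc)
  qed
  also have "\<dots> = (\<integral>\<^sup>+x. g x \<partial>\<mu>) * (\<integral>\<^sup>+x. \<phi> (- x) \<partial>\<nu>)"
    by (subst nn_integral_cmult) (auto simp: mult.commute)
  finally show ?thesis .
qed

section \<open>Gaussian integrals and the normalisation of Lebesgue measure\<close>

lemma nn_integral_gaussian:
  assumes a: "a > 0"
  shows "(\<integral>\<^sup>+t. ennreal (exp (- (a * t)\<^sup>2)) \<partial>lborel) = ennreal (sqrt pi / a)"
proof -
  \<comment> \<open>For this standard deviation the exponent of the normal density is -(a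
    t)^2.\<close>
  let ?\<sigma> = "1 / (a * sqrt 2)"
  have \<sigma>: "?\<sigma> > 0" using a by simp
  have eq: "exp (- (a * t)\<^sup>2) = sqrt pi / a * normal_density 0 ?\<sigma> t" for t
  proof -
    have "sqrt (2 * pi * ?\<sigma>\<^sup>2) = sqrt pi / a"
      using a by (simp add: power_divide power_mult_distrib real_sqrt_divide)
    moreover have "- (t - 0)\<^sup>2 / (2 * ?\<sigma>\<^sup>2) = - (a * t)\<^sup>2"
      using a by (simp add: power_divide power_mult_distrib)
    ultimately show ?thesis using a by (simp add: normal_density_def)
  qed
  have "(\<integral>\<^sup>+t. ennreal (exp (- (a * t)\<^sup>2)) \<partial>lborel) = (\<integral>\<^sup>+t. ennreal (sqrt pi / a) * ennreal (normal_density 0 ?\<sigma> t) \<partial>lborel)"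
    unfolding eq using a by (intro nn_integral_cong ennreal_mult) simp_all
  also have "\<dots> = ennreal (sqrt pi / a) * (\<integral>\<^sup>+t. ennreal (normal_density 0 ?\<sigma> t) \<partial>lborel)"
    by (rule nn_integral_cmult) simp
  also have "(\<integral>\<^sup>+t. ennreal (normal_density 0 ?\<sigma> t) \<partial>lborel) = ennreal 1"
    using integral_normal_density[OF \<sigma>, of 0] integrable_normal_density[OF \<sigma>, of 0]
    by (subst nn_integral_eq_integral) auto
  finally show ?thesis by simp
qed

text \<open>By Parseval the radial Gaussian is a product over the coordinates. The value depends on
  the basis only through its cardinality, which makes the Gaussian the test function for fixing
  constants.\<close>

lemma nn_integral_onb_vol_gaussian:
  fixes B :: "'a::separable_inner set"
  assumes B: "orthonormal B" and a: "a > 0"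
  shows "(\<integral>\<^sup>+x. ennreal (exp (- (a * norm x)\<^sup>2)) \<partial>onb_vol B) = ennreal ((sqrt pi / a) ^ card B)"
proof -
  have "(\<integral>\<^sup>+x. ennreal (exp (- (a * norm x)\<^sup>2)) \<partial>onb_vol B) =
      (\<integral>\<^sup>+x. (\<Prod>b\<in>B. ennreal (exp (- (a * (x \<bullet> b))\<^sup>2))) \<partial>onb_vol B)"
  proof (rule nn_integral_cong_AE, use AE_onb_vol_span[OF B] in eventually_elim)
    fix x assume "x \<in> span B"
    then have "- (a * norm x)\<^sup>2 = (\<Sum>b\<in>B. - (a * (x \<bullet> b))\<^sup>2)"
      using orthonormal_norm2[OF B] by (simp add: power_mult_distrib sum_distrib_left sum_negf)
    then show "ennreal (exp (- (a * norm x)\<^sup>2)) = (\<Prod>b\<in>B. ennreal (exp (- (a * (x \<bullet> b))\<^sup>2)))"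
      using B by (simp add: exp_sum orthonormal_finite prod_ennreal)
  qed
  also have "\<dots> = (\<integral>\<^sup>+t. ennreal (exp (- (a * t)\<^sup>2)) \<partial>lborel) ^ card B"
    by (rule nn_integral_onb_vol_prod[OF B]) simp
  finally show ?thesis
    using a by (simp add: nn_integral_gaussian ennreal_power)
qed

text \<open>On the ball, 1 is at most exp(r^2) times the Gaussian, whose integral is finite.\<close>

lemma emeasure_onb_vol_cball_finite:
  fixes B :: "'a::separable_inner set"
  assumes B: "orthonormal B"
  shows "emeasure (onb_vol B) (cball 0 r) < \<infinity>"
proof -
  have "emeasure (onb_vol B) (cball 0 r) = (\<integral>\<^sup>+x. indicator (cball 0 r) x \<partial>onb_vol B)"
    by simp
  also have "\<dots> \<le> (\<integral>\<^sup>+x. ennreal (exp (r\<^sup>2)) * ennreal (exp (- (1 * norm x)\<^sup>2)) \<partial>onb_vol B)"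
  proof (intro nn_integral_mono)
    fix x :: 'a
    have "1 \<le> exp (r\<^sup>2) * exp (- (1 * norm x)\<^sup>2)" if "norm x \<le> r"
      using power_mono[OF that, of 2] by (simp add: exp_add[symmetric])
    then show "indicator (cball 0 r) x \<le> ennreal (exp (r\<^sup>2)) * ennreal (exp (- (1 * norm x)\<^sup>2))"
      by (auto simp: indicator_def ennreal_mult[symmetric])
  qed
  also have "\<dots> = ennreal (exp (r\<^sup>2)) * ennreal ((sqrt pi / 1) ^ card B)"
    by (subst nn_integral_cmult) (simp_all only: nn_integral_onb_vol_gaussian[OF B zero_less_one], simp)
  also have "\<dots> < \<infinity>" by (simp add: ennreal_mult_less_top)
  finally show ?thesis .
qed

lemma haar_on_onb_vol:
  fixes B :: "'a::separable_inner set"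
  assumes B: "orthonormal B"
  shows "haar_on (span B) (onb_vol B)"
  unfolding haar_on_def
proof (intro conjI ballI)
  show "sigma_finite_measure (onb_vol B)"
  proof
    show "\<exists>A. countable A \<and> A \<subseteq> sets (onb_vol B) \<and> \<Union>A = space (onb_vol B) \<and> (\<forall>a\<in>A. emeasure (onb_vol B) a \<noteq> \<infinity>)"
    proof (intro exI[of _ "range (\<lambda>n. cball 0 (real n))"] conjI ballI)
      show "\<Union> (range (\<lambda>n. cball (0::'a) (real n))) = space (onb_vol B)"
        using real_arch_simple by auto
      show "\<And>a. a \<in> range (\<lambda>n. cball (0::'a) (real n)) \<Longrightarrow> emeasure (onb_vol B) a \<noteq> \<infinity>"
        using emeasure_onb_vol_cball_finite[OF B] by (metis imageE less_irrefl)
    qed auto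
  qed
  show "AE x in onb_vol B. x \<in> span B" by (rule AE_onb_vol_span[OF B])
  show "(\<integral>\<^sup>+x. g (x + v) \<partial>onb_vol B) = (\<integral>\<^sup>+x. g x \<partial>onb_vol B)"
    if "v \<in> span B" "g \<in> borel_measurable borel" for v and g :: "'a \<Rightarrow> ennreal"
    using that B by (intro nn_integral_onb_vol_translate) (auto simp: orthonormal_finite)
qed simp

text \<open>By \<open>haar_on_unique\<close> the two measures are proportional; the Gaussian is even
  and has the same integral for both, so the factor is 1.\<close>

lemma onb_vol_unique:
  fixes B C :: "'a::separable_inner set"
  assumes B: "orthonormal B" and C: "orthonormal C" and span: "span B = span C"
  shows "onb_vol B = onb_vol C"
proof (rule measure_eqI)
  fix T assume T: "T \<in> sets (onb_vol B)"
  let ?\<phi> = "\<lambda>x::'a. ennreal (exp (- (1 * norm x)\<^sup>2))"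
  have c: "card B = card C"
    using orthonormal_card[OF B] orthonormal_card[OF C] span by simp
  have "(\<integral>\<^sup>+x. ?\<phi> x \<partial>onb_vol B) * (\<integral>\<^sup>+x. indicator T x \<partial>onb_vol C) =
      (\<integral>\<^sup>+x. indicator T x \<partial>onb_vol B) * (\<integral>\<^sup>+x. ?\<phi> (- x) \<partial>onb_vol C)"
    using haar_on_onb_vol[OF B] haar_on_onb_vol[OF C] T unfolding span
    by (intro haar_on_unique[of "span C"]) auto
  then have "ennreal (sqrt pi ^ card C) * emeasure (onb_vol C) T = ennreal (sqrt pi ^ card C) * emeasure (onb_vol B) T"
    using T nn_integral_onb_vol_gaussian[OF B, of 1] nn_integral_onb_vol_gaussian[OF C, of 1] c
    by (simp add: mult.commute)
  then show "emeasure (onb_vol B) T = emeasure (onb_vol C) T"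
    by (subst (asm) ennreal_mult_cancel_left) auto
qed simp

text \<open>Frees later computations from the basis chosen in \<open>vol\<close>: a basis adapted to
  a hyperplane may be used instead.\<close>

lemma vol_eqI:
  fixes B :: "'a::separable_inner set"
  assumes "is_onb E B"
  shows "vol E = onb_vol B"
proof -
  have "is_onb E (onb E)"
    using assms by (intro is_onb_onb[of B]) (auto simp: is_onb_def)
  then show ?thesis
    using assms unfolding vol_eq_onb_vol is_onb_iff by (intro onb_vol_unique) auto
qed

lemma is_onb_subspace: "is_onb E B \<Longrightarrow> subspace E"
  by (auto simp: is_onb_def)

lemma is_onb_card: "is_onb E B \<Longrightarrow> card B = dim E"
  by (auto simp: is_onb_iff orthonormal_card)

lemma haar_on_vol:
  fixes B :: "'a::separable_inner set"
  assumes "is_onb E B"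
  shows "haar_on E (vol E)"
  using haar_on_onb_vol[of B] assms vol_eqI[OF assms] by (auto simp: is_onb_iff)

lemma sets_vol [simp, measurable_cong]: "sets (vol E) = sets borel"
  by (simp add: vol_def)

lemma space_vol [simp]: "space (vol E) = UNIV"
  by (simp add: vol_def)

section \<open>Linear maps of \<open>E\<close> and their volume factor\<close>

lemma linear_bounded_on_span:
  fixes A :: "'a::real_inner \<Rightarrow> 'a"
  assumes B: "is_onb E B" and A: "linear A"
  obtains C where "C > 0" "\<And>x. x \<in> E \<Longrightarrow> norm (A x) \<le> C * norm x"
proof
  let ?C = "1 + (\<Sum>b\<in>B. norm (A b))"
  show "?C > 0" by (intro add_pos_nonneg sum_nonneg) auto
  fix x assume "x \<in> E"
  then have "A x = (\<Sum>b\<in>B. (x \<bullet> b) *\<^sub>R A b)"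
    using B orthonormal_expand[of B x] linear_sum[OF A, of "\<lambda>b. (x \<bullet> b) *\<^sub>R b" B]
    by (simp add: is_onb_iff linear_cmul[OF A])
  then have "norm (A x) \<le> (\<Sum>b\<in>B. norm ((x \<bullet> b) *\<^sub>R A b))"
    by (simp add: sum_norm_le)
  also have "\<dots> \<le> (\<Sum>b\<in>B. norm x * norm (A b))"
  proof (rule sum_mono)
    fix b assume "b \<in> B"
    then have "\<bar>x \<bullet> b\<bar> \<le> norm x"
      using Cauchy_Schwarz_ineq2[of x b] B by (auto simp: is_onb_def)
    then show "norm ((x \<bullet> b) *\<^sub>R A b) \<le> norm x * norm (A b)"
      by (simp add: mult_right_mono)
  qed
  also have "\<dots> \<le> ?C * norm x"
    by (simp add: sum_distrib_left[symmetric] algebra_simps)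
  finally show "norm (A x) \<le> ?C * norm x" .
qed

lemma linear_inverse_on:
  fixes A :: "'a::real_inner \<Rightarrow> 'a"
  assumes B: "is_onb E B" and A: "linear A" "bij_betw A E E"
  obtains A' where "linear A'" "bij_betw A' E E" "\<And>x. x \<in> E \<Longrightarrow> A' (A x) = x" "\<And>x. x \<in> E \<Longrightarrow> A (A' x) = x"
proof
  \<comment> \<open>The inverse is prescribed on \<open>B\<close> and extended linearly, so that it
    is linear on the whole ambient space and not just on \<open>E\<close>.\<close>
  define A' where "A' x = (\<Sum>b\<in>B. (x \<bullet> b) *\<^sub>R inv_into E A b)" for x
  have BE: "B \<subseteq> E" using B by (auto simp: is_onb_def span_base)
  note sub = is_onb_subspace[OF B]
  have E: "inv_into E A b \<in> E" "A (inv_into E A b) = b" if "b \<in> E" for b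
    using that A(2) by (auto simp: bij_betw_def inv_into_into f_inv_into_f)
  show lin: "linear A'"
    unfolding A'_def by (rule linearI) (simp_all add: inner_add_left sum.distrib scaleR_add_left scaleR_sum_right)
  have A'E: "A' x \<in> E" for x
    unfolding A'_def using BE E sub by (intro subspace_sum subspace_scale) auto
  show AA': "A (A' x) = x" if "x \<in> E" for x
  proof -
    have "A (A' x) = (\<Sum>b\<in>B. (x \<bullet> b) *\<^sub>R b)"
      unfolding A'_def linear_sum[OF A(1)] linear_cmul[OF A(1)] using BE E by (intro sum.cong) auto
    then show ?thesis using that B by (simp add: is_onb_iff orthonormal_expand)
  qed
  show A'A: "A' (A x) = x" if "x \<in> E" for x
    using AA'[of "A x"] that A(2) A'E unfolding bij_betw_def inj_on_def by blast
  show "bij_betw A' E E"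
    by (rule bij_betw_byWitness[where f' = A]) (use AA' A'A A'E A(2) in \<open>auto simp: bij_betw_def\<close>)
qed

text \<open>
  The Gaussian plays the role of the ball in the comparison of \<open>c\<close> with \<open>a\<close>: its integral is
  known exactly for every scaling.
\<close>

lemma nn_integral_vol_linear:
  fixes A :: "'a::separable_inner \<Rightarrow> 'a"
  assumes B: "is_onb E B" and A: "linear A" "bij_betw A E E"
  obtains c where "c > 0"
    "\<And>g. g \<in> borel_measurable borel \<Longrightarrow> (\<integral>\<^sup>+x. g (A x) \<partial>vol E) = ennreal c * (\<integral>\<^sup>+x. g x \<partial>vol E)"
    "\<And>a. a > 0 \<Longrightarrow> (\<And>x. x \<in> E \<Longrightarrow> norm (A x) \<le> a * norm x) \<Longrightarrow> 1 \<le> c * a ^ dim E"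
    "\<And>a. a > 0 \<Longrightarrow> (\<And>x. x \<in> E \<Longrightarrow> a * norm x \<le> norm (A x)) \<Longrightarrow> c * a ^ dim E \<le> 1"
proof -
  note haar = haar_on_vol[OF B]
  have onB: "orthonormal B" and span: "span B = E" using B by (auto simp: is_onb_iff)
  have AE_E: "AE x in vol E. x \<in> E" using haar by (simp add: haar_on_def)
  \<comment> \<open>\<open>A\<close> may fail to be Borel outside \<open>E\<close>.
    \<open>A1\<close> agrees with it on \<open>E\<close> and is a finite combination of continuous
    functionals.\<close>
  define A1 where "A1 x = (\<Sum>b\<in>B. (x \<bullet> b) *\<^sub>R A b)" for x
  have [measurable]: "A1 \<in> borel_measurable borel" unfolding A1_def by simp
  have A1: "A1 x = A x" if "x \<in> E" for x
  proof -
    have "A1 x = A (\<Sum>b\<in>B. (x \<bullet> b) *\<^sub>R b)"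
      unfolding A1_def linear_sum[OF A(1)] linear_cmul[OF A(1)] ..
    then show ?thesis using that orthonormal_expand[OF onB] span by simp
  qed
  have A1E: "A1 x \<in> E" for x
    unfolding A1_def using A(2) span is_onb_subspace[OF B]
    by (intro subspace_sum subspace_scale) (auto simp: bij_betw_def span_base)
  have AE_A: "(\<integral>\<^sup>+x. h (A x) \<partial>vol E) = (\<integral>\<^sup>+x. h (A1 x) \<partial>vol E)" for h :: "'a \<Rightarrow> ennreal"
    by (rule nn_integral_cong_AE) (use AE_E A1 in \<open>auto elim!: eventually_mono\<close>)
  define \<nu> where "\<nu> = distr (vol E) borel A1"
  have sets\<nu> [simp]: "sets \<nu> = sets borel" "space \<nu> = UNIV" by (simp_all add: \<nu>_def)
  have nn\<nu>: "(\<integral>\<^sup>+x. h x \<partial>\<nu>) = (\<integral>\<^sup>+x. h (A1 x) \<partial>vol E)" if [measurable]: "h \<in> borel_measurable borel"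
    for h :: "'a \<Rightarrow> ennreal"
    unfolding \<nu>_def by (rule nn_integral_distr) simp_all
  obtain A' where A': "linear A'" "bij_betw A' E E" "\<And>x. x \<in> E \<Longrightarrow> A' (A x) = x" "\<And>x. x \<in> E \<Longrightarrow> A (A' x) = x"
    using linear_inverse_on[OF B A] by metis
  obtain C where C: "C > 0" "\<And>x. x \<in> E \<Longrightarrow> norm (A' x) \<le> C * norm x"
    using linear_bounded_on_span[OF B A'(1)] by metis
  obtain D where D: "D > 0" "\<And>x. x \<in> E \<Longrightarrow> norm (A x) \<le> D * norm x"
    using linear_bounded_on_span[OF B A(1)] by metis
  have low: "norm x / C \<le> norm (A x)" if "x \<in> E" for x
    using C(2)[of "A x"] A'(3)[OF that] C(1) that A(2)
    by (auto simp: field_simps bij_betw_def)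
  have haar\<nu>: "haar_on E \<nu>"
    unfolding haar_on_def
  proof (intro conjI ballI)
    have "emeasure \<nu> (cball 0 (real n)) \<noteq> \<infinity>" for n
    proof -
      have "emeasure \<nu> (cball 0 (real n)) = (\<integral>\<^sup>+x. indicator (cball 0 (real n)) (A1 x) \<partial>vol E)"
        by (subst nn\<nu>[symmetric]) (simp_all add: borel_measurable_indicator)
      also have "\<dots> \<le> (\<integral>\<^sup>+x. indicator (cball 0 (C * real n)) x \<partial>vol E)"
      proof (rule nn_integral_mono_AE, use AE_E in eventually_elim)
        fix x assume "x \<in> E"
        then have "norm x \<le> C * real n" if "norm (A x) \<le> real n"
          using low[of x] that C(1) by (simp add: field_simps mult.commute) (metis mult_left_mono less_imp_le order_trans mult.commute)
        then show "indicator (cball 0 (real n)) (A1 x) \<le> (indicator (cball 0 (C * real n)) x :: ennreal)"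
          using A1[OF \<open>x \<in> E\<close>] by (auto simp: indicator_def)
      qed
      also have "\<dots> = emeasure (onb_vol B) (cball 0 (C * real n))"
        by (simp add: vol_eqI[OF B])
      also have "\<dots> < \<infinity>" by (rule emeasure_onb_vol_cball_finite[OF onB])
      finally show ?thesis by simp
    qed
    then show "sigma_finite_measure \<nu>"
      by (intro sigma_finite_measure.intro exI[of _ "range (\<lambda>n. cball 0 (real n))"])
        (auto simp: real_arch_simple)
    show "AE x in \<nu>. x \<in> E"
    proof -
      have "AE x in \<nu>. (\<Sum>b\<in>B. (x \<bullet> b) *\<^sub>R b) = x"
        unfolding \<nu>_def using orthonormal_expand[OF onB] A1E span
        by (subst AE_distr_iff) auto
      then show ?thesis
        by eventually_elim (metis (no_types, lifting) span span_base span_scale span_sum)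
    qed
    fix v and g :: "'a \<Rightarrow> ennreal" assume v: "v \<in> E" and [measurable]: "g \<in> borel_measurable borel"
    \<comment> \<open>Translating the image by \<open>v\<close> amounts to translating the argument
      by \<open>A' v\<close>.\<close>
    have "A' v \<in> E" using A'(2) v by (auto simp: bij_betw_def)
    have "(\<integral>\<^sup>+x. g (x + v) \<partial>\<nu>) = (\<integral>\<^sup>+x. g (A1 (x + A' v)) \<partial>vol E)"
      using A1[OF \<open>A' v \<in> E\<close>] A'(4)[OF v]
      by (subst nn\<nu>) (auto simp: A1_def inner_add_left scaleR_add_left sum.distrib)
    also have "\<dots> = (\<integral>\<^sup>+x. g (A1 x) \<partial>vol E)"
      using haar \<open>A' v \<in> E\<close> unfolding haar_on_def by (auto dest!: bspec[of _ _ "\<lambda>x. g (A1 x)"])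
    finally show "(\<integral>\<^sup>+x. g (x + v) \<partial>\<nu>) = (\<integral>\<^sup>+x. g x \<partial>\<nu>)" by (simp add: nn\<nu>)
  qed simp
  let ?\<phi> = "\<lambda>x::'a. ennreal (exp (- (1 * norm x)\<^sup>2))"
  define s where "s = sqrt pi ^ dim E"
  have s: "s > 0" by (simp add: s_def)
  have gauss: "(\<integral>\<^sup>+x. ennreal (exp (- (a * norm x)\<^sup>2)) \<partial>vol E) = ennreal (s / a ^ dim E)" if "a > 0" for a
    using nn_integral_onb_vol_gaussian[OF onB that] is_onb_card[OF B]
    by (simp add: vol_eqI[OF B] s_def power_divide)
  \<comment> \<open>Uniqueness identifies the factor of \<open>A\<close> as the integral of the
    Gaussian composed with \<open>A\<close>, divided by \<open>s\<close>; norm bounds for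
    \<open>A\<close> sandwich that integral between rescaled Gaussians.\<close>
  have *: "ennreal s * (\<integral>\<^sup>+x. g (A x) \<partial>vol E) = (\<integral>\<^sup>+x. g x \<partial>vol E) * (\<integral>\<^sup>+x. ?\<phi> (A x) \<partial>vol E)"
    if [measurable]: "g \<in> borel_measurable borel" for g
    using haar_on_unique[OF haar haar\<nu> is_onb_subspace[OF B], of ?\<phi> g] gauss[of 1]
    by (simp add: nn\<nu> AE_A[of g] AE_A[of "\<lambda>x. ennreal (exp (- (norm x)\<^sup>2))"])
  have lowG: "ennreal (s / a ^ dim E) \<le> (\<integral>\<^sup>+x. ?\<phi> (A x) \<partial>vol E)"
    if a: "a > 0" "\<And>x. x \<in> E \<Longrightarrow> norm (A x) \<le> a * norm x" for a
    unfolding gauss[OF a(1), symmetric]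
    by (rule nn_integral_mono_AE) (use AE_E a(2) in \<open>auto elim!: eventually_mono intro!: power_mono ennreal_leI\<close>)
  have upG: "(\<integral>\<^sup>+x. ?\<phi> (A x) \<partial>vol E) \<le> ennreal (s / a ^ dim E)"
    if a: "a > 0" "\<And>x. x \<in> E \<Longrightarrow> a * norm x \<le> norm (A x)" for a
    unfolding gauss[OF a(1), symmetric]
    by (rule nn_integral_mono_AE) (use AE_E a in \<open>auto elim!: eventually_mono intro!: power_mono ennreal_leI\<close>)
  have "(\<integral>\<^sup>+x. ?\<phi> (A x) \<partial>vol E) \<noteq> top" 
    using upG[of "1 / C"] C(1) low by (auto simp: top_unique)
  then obtain G where G: "(\<integral>\<^sup>+x. ?\<phi> (A x) \<partial>vol E) = ennreal G" "G \<ge> 0"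
    by (metis ennreal_cases)
  have "0 < s / D ^ dim E" using s D by simp
  also have "\<dots> \<le> G" using lowG[OF D] G by simp
  finally have "G > 0" .
  show thesis
  proof (rule that[of "G / s"])
    show "G / s > 0" using \<open>G > 0\<close> s by simp
    fix g :: "'a \<Rightarrow> ennreal" assume g: "g \<in> borel_measurable borel"
    have "ennreal s * (\<integral>\<^sup>+x. g (A x) \<partial>vol E) = ennreal s * (ennreal (G / s) * (\<integral>\<^sup>+x. g x \<partial>vol E))"
      unfolding mult.assoc[symmetric] using *[OF g] G s by (simp add: ennreal_mult[symmetric] mult.commute)
    then show "(\<integral>\<^sup>+x. g (A x) \<partial>vol E) = ennreal (G / s) * (\<integral>\<^sup>+x. g x \<partial>vol E)"
      using s by (subst (asm) ennreal_mult_cancel_left) auto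
  next
    fix a :: real assume a: "a > 0" "\<And>x. x \<in> E \<Longrightarrow> norm (A x) \<le> a * norm x"
    then show "1 \<le> G / s * a ^ dim E"
      using lowG[OF a] s G by (simp add: field_simps)
  next
    fix a :: real assume a: "a > 0" "\<And>x. x \<in> E \<Longrightarrow> a * norm x \<le> norm (A x)"
    then show "G / s * a ^ dim E \<le> 1"
      using upG[OF a] s G by (simp add: field_simps)
  qed
qed

lemma emeasure_vol_cube:
  fixes B :: "'a::separable_inner set"
  assumes B: "is_onb E B" and r: "r \<ge> 0"
  shows "emeasure (vol E) {x. \<forall>b\<in>B. \<bar>x \<bullet> b\<bar> \<le> r} = ennreal ((2 * r) ^ dim E)"
proof -
  have onB: "orthonormal B" using B by (simp add: is_onb_iff)
  have [measurable]: "{x. \<forall>b\<in>B. \<bar>x \<bullet> b\<bar> \<le> r} \<in> sets borel"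
    using orthonormal_finite[OF onB] by measurable
  have "emeasure (vol E) {x. \<forall>b\<in>B. \<bar>x \<bullet> b\<bar> \<le> r} = (\<integral>\<^sup>+x. indicator {x. \<forall>b\<in>B. \<bar>x \<bullet> b\<bar> \<le> r} x \<partial>vol E)"
    by simp
  also have "\<dots> = (\<integral>\<^sup>+x. (\<Prod>b\<in>B. indicator {-r..r} (x \<bullet> b)) \<partial>onb_vol B)"
    unfolding vol_eqI[OF B]
  proof (intro nn_integral_cong)
    fix x
    show "indicator {x. \<forall>b\<in>B. \<bar>x \<bullet> b\<bar> \<le> r} x = (\<Prod>b\<in>B. indicator {-r..r} (x \<bullet> b) :: ennreal)"
    proof (cases "\<forall>b\<in>B. \<bar>x \<bullet> b\<bar> \<le> r")
      case True
      then have "x \<bullet> b \<in> {-r..r}" if "b \<in> B" for b using that by (auto simp: abs_le_iff)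
      with True show ?thesis by simp
    next
      case False
      then obtain b where "b \<in> B" "x \<bullet> b \<notin> {-r..r}" by (auto simp: abs_le_iff)
      then have "(\<Prod>b\<in>B. indicator {-r..r} (x \<bullet> b) :: ennreal) = 0"
        using orthonormal_finite[OF onB] by (intro prod_zero bexI[of _ b]) (auto simp: indicator_def)
      with False show ?thesis by simp
    qed
  qed
  also have "\<dots> = (\<integral>\<^sup>+t. indicator {-r..r} t \<partial>lborel) ^ card B"
    by (rule nn_integral_onb_vol_prod[OF onB]) simp
  finally show ?thesis using r is_onb_card[OF B] by (simp add: ennreal_power)
qed

subsection \<open>Tail decay of concave functions on convex bodies\<close>

text \<open>Where k w \<le> h < (k + 1) w, the fourth power of h is at most w^4 (k + 1)^4. If the
  mass of {h \<ge> k w} is at most q^k times the total, this series bounds the fourth moment in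
  units of w^4.\<close>

definition tail_const :: "real \<Rightarrow> real" where
  "tail_const q = (\<Sum>k. (real k + 1) ^ 4 * q ^ k)"

lemma summable_tail_const:
  assumes "0 \<le> q" "q < 1"
  shows "summable (\<lambda>k. (real k + 1) ^ 4 * q ^ k)"
proof -
  \<comment> \<open>One half of q^k = t^(8k) absorbs the fourth power, since (k + 1) t^k \<le> 1/(1
    - t); the other half is the geometric majorant.\<close>
  define t where "t = root 8 q"
  have t: "0 \<le> t" "t < 1" "q = t ^ 8"
    using assms by (auto simp: t_def)
  have bd: "(real k + 1) * t ^ k \<le> 1 / (1 - t)" for k
  proof -
    have "(real k + 1) * t ^ k = (\<Sum>i<Suc k. t ^ k)" by simp
    also have "\<dots> \<le> (\<Sum>i<Suc k. t ^ i)"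
      using t by (intro sum_mono power_decreasing) auto
    also have "\<dots> = (1 - t ^ Suc k) / (1 - t)"
      using t by (subst sum_gp_strict) auto
    also have "\<dots> \<le> 1 / (1 - t)"
      using t by (intro divide_right_mono) auto
    finally show ?thesis .
  qed
  have t4: "t ^ 4 < 1" using t by (simp add: power_less_one_iff)
  have le: "norm ((real k + 1) ^ 4 * q ^ k) \<le> (1 / (1 - t)) ^ 4 * (t ^ 4) ^ k" for k
  proof -
    have "(real k + 1) ^ 4 * q ^ k = ((real k + 1) * t ^ k) ^ 4 * (t ^ 4) ^ k"
      unfolding t(3) by (simp add: power_mult_distrib power_mult[symmetric] power_add[symmetric])
    also have "\<dots> \<le> (1 / (1 - t)) ^ 4 * (t ^ 4) ^ k"
      using t bd by (intro mult_right_mono power_mono) auto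
    finally show ?thesis using t by simp
  qed
  have "summable (\<lambda>k. (1 / (1 - t)) ^ 4 * (t ^ 4) ^ k)"
    using t t4 by (intro summable_mult summable_geometric) auto
  then show ?thesis
    by (rule summable_comparison_test'[where N = 0]) (rule le)
qed

lemma tail_const_ge_1:
  assumes "0 \<le> q" "q < 1"
  shows "tail_const q \<ge> 1"
  using sum_le_suminf[OF summable_tail_const[OF assms], of "{0}"] assms
  by (simp add: tail_const_def)

text \<open>Midpoint log-concavity makes the ratios \<open>G ((k + 1) w) / G (k w)\<close> non-increasing in \<open>k\<close>.\<close>

lemma midpoint_log_concave_decay:
  fixes G :: "real \<Rightarrow> real"
  assumes nonneg: "\<And>t. 0 \<le> G t" and anti: "\<And>s t. s \<le> t \<Longrightarrow> G t \<le> G s"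
    and mid: "\<And>s t. G s * G t \<le> (G ((s + t) / 2))\<^sup>2"
    and w: "w > 0" "0 \<le> q" "G w \<le> q * G 0"
  shows "G (real k * w) \<le> q ^ k * G 0"
proof -
  have step: "G (real (Suc k) * w) \<le> q * G (real k * w)" for k
  proof (induction k)
    case (Suc k)
    have "G (real (Suc (Suc k)) * w) * G (real k * w) \<le> (G (real (Suc k) * w))\<^sup>2"
      using mid[of "real (Suc (Suc k)) * w" "real k * w"] by (simp add: algebra_simps add_divide_distrib)
    also have "\<dots> \<le> G (real (Suc k) * w) * (q * G (real k * w))"
      unfolding power2_eq_square by (intro mult_left_mono Suc nonneg)
    finally have *: "G (real (Suc (Suc k)) * w) * G (real k * w) \<le> (q * G (real (Suc k) * w)) * G (real k * w)"
      by (simp add: mult_ac)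
    \<comment> \<open>The inequality is divided by \<open>G (real k * w)\<close>; if this value is
      0, monotonicity makes the later ones 0 as well.\<close>
    show ?case
    proof (cases "G (real k * w) = 0")
      case True
      then have "G (real (Suc (Suc k)) * w) = 0"
        using anti[of "real k * w" "real (Suc (Suc k)) * w"] nonneg w(1)
        by (simp add: antisym algebra_simps)
      then show ?thesis using nonneg w(2) by simp
    next
      case False
      then show ?thesis using * nonneg[of "real k * w"] by (simp add: less_le)
    qed
  qed (use w in simp)
  show ?thesis
  proof (induction k)
    case (Suc k)
    have "G (real (Suc k) * w) \<le> q * G (real k * w)" by (rule step)
    also have "\<dots> \<le> q * (q ^ k * G 0)" by (intro mult_left_mono Suc w)
    finally show ?case by simp
  qed simp
qed

text \<open>The tail of \<open>h\<close> is midpoint log-concave by \<open>mid\<close>, so one drop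
  by the factor \<open>q\<close> over the width \<open>w\<close> repeats at every multiple of
  \<open>w\<close>; the layers of width \<open>w\<close> are then summed.\<close>

lemma nn_integral_tail_moment:
  fixes h :: "'a \<Rightarrow> real"
  assumes "finite_measure M" and [measurable]: "h \<in> borel_measurable M"
    and mid: "\<And>s t. measure M {x\<in>space M. s \<le> h x} * measure M {x\<in>space M. t \<le> h x}
                \<le> (measure M {x\<in>space M. (s + t) / 2 \<le> h x})\<^sup>2"
    and w: "w > 0" "0 \<le> q" "q < 1"
    and le: "measure M {x\<in>space M. w \<le> h x} \<le> q * measure M {x\<in>space M. 0 \<le> h x}"
  shows "(\<integral>\<^sup>+x. ennreal ((max 0 (h x)) ^ 4) \<partial>M) \<le> ennreal (tail_const q * w ^ 4 * measure M (space M))"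
proof -
  interpret finite_measure M by fact
  define G where "G t = measure M {x\<in>space M. t \<le> h x}" for t
  have G: "G (real k * w) \<le> q ^ k * G 0" for k
    by (rule midpoint_log_concave_decay)
      (use mid w le in \<open>auto simp: G_def intro!: finite_measure_mono\<close>)
  let ?S = "\<lambda>k. {x\<in>space M. real k * w \<le> h x}" and ?c = "\<lambda>k. ennreal (w ^ 4 * (real k + 1) ^ 4)"
  have "(\<integral>\<^sup>+x. ennreal ((max 0 (h x)) ^ 4) \<partial>M)
      \<le> (\<integral>\<^sup>+x. (\<Sum>k. ?c k * indicator (?S k) x) \<partial>M)"
  proof (rule nn_integral_mono)
    fix x assume x: "x \<in> space M"
    define k where "k = nat \<lfloor>h x / w\<rfloor>"
    have single_term: "F k \<le> (\<Sum>k. F k)" for F :: "nat \<Rightarrow> ennreal"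
      using sum_le_suminf[of F "{k}"] by simp
    show "ennreal ((max 0 (h x)) ^ 4)
      \<le> (\<Sum>k. ?c k * indicator (?S k) x)"
    proof (cases "h x \<ge> 0")
      case True
      then have k: "real k \<le> h x / w" "h x / w < real k + 1"
        using w by (auto simp: k_def)
      then have "(max 0 (h x)) ^ 4 \<le> (w * (real k + 1)) ^ 4"
        using w True by (intro power_mono) (auto simp: field_simps)
      then have "ennreal ((max 0 (h x)) ^ 4)
          \<le> ?c k * indicator (?S k) x"
        using k w x by (simp add: power_mult_distrib le_divide_eq ennreal_leI)
      also have "\<dots> \<le> (\<Sum>k. ?c k * indicator (?S k) x)"
        by (rule single_term)
      finally show ?thesis .
    qed simp
  qed
  also have "\<dots> = (\<Sum>k. \<integral>\<^sup>+x. ?c k * indicator (?S k) x \<partial>M)"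
    by (rule nn_integral_suminf) measurable
  also have "\<dots> = (\<Sum>k. ?c k * emeasure M (?S k))"
    by (intro suminf_cong nn_integral_cmult_indicator) measurable
  also have "\<dots> \<le> (\<Sum>k. ennreal ((w ^ 4 * measure M (space M)) * ((real k + 1) ^ 4 * q ^ k)))"
  proof (rule suminf_le)
    fix k :: nat
    have "w ^ 4 * (real k + 1) ^ 4 * G (real k * w) \<le> w ^ 4 * (real k + 1) ^ 4 * (q ^ k * measure M (space M))"
      using w G[of k] bounded_measure[of "{x\<in>space M. 0 \<le> h x}"]
      by (intro mult_left_mono order_trans[OF G] ) (auto simp: G_def)
    then show "?c k * emeasure M (?S k)
        \<le> ennreal ((w ^ 4 * measure M (space M)) * ((real k + 1) ^ 4 * q ^ k))"
      using w by (simp add: emeasure_eq_measure ennreal_mult[symmetric] G_def mult_ac ennreal_leI)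
  qed auto
  also have "\<dots> = ennreal (\<Sum>k. (w ^ 4 * measure M (space M)) * ((real k + 1) ^ 4 * q ^ k))"
    using w by (intro suminf_ennreal2 summable_mult summable_tail_const) auto
  also have "(\<Sum>k. (w ^ 4 * measure M (space M)) * ((real k + 1) ^ 4 * q ^ k)) = tail_const q * w ^ 4 * measure M (space M)"
    unfolding tail_const_def using summable_tail_const[OF w(2,3)] by (subst suminf_mult) auto
  finally show ?thesis .
qed

text \<open>Uniform measure on \<open>K\<close> without normalisation, of total mass the volume of
  \<open>K\<close>. Set integrals over \<open>K\<close> thereby become plain integrals against a
  finite measure.\<close>

definition body :: "'a::real_inner set \<Rightarrow> 'a set \<Rightarrow> 'a measure" where
  "body E K = density (vol E) (\<lambda>x. ennreal (indicator K x))"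

section \<open>Integration over a body\<close>

lemma sets_body [simp, measurable_cong]: "sets (body E K) = sets borel"
  by (simp add: body_def)

lemma space_body [simp]: "space (body E K) = UNIV"
  by (simp add: body_def)

lemma convex_body_borel: "convex_body E K \<Longrightarrow> K \<in> sets borel"
  by (auto simp: convex_body_def compact_imp_closed)

lemma nn_integral_body:
  assumes "K \<in> sets borel" "g \<in> borel_measurable borel"
  shows "(\<integral>\<^sup>+x. g x \<partial>body E K) = (\<integral>\<^sup>+x. g x * indicator K x \<partial>vol E)"
  unfolding body_def using assms
  by (subst nn_integral_density) (auto intro!: nn_integral_cong simp: indicator_def)

lemma emeasure_body:
  assumes "K \<in> sets borel" "T \<in> sets borel"
  shows "emeasure (body E K) T = emeasure (vol E) (K \<inter> T)"
proof -
  have "emeasure (body E K) T = (\<integral>\<^sup>+x. indicator T x * indicator K x \<partial>vol E)"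
    using nn_integral_body[OF assms(1), of "indicator T" E] assms(2) by simp
  also have "\<dots> = (\<integral>\<^sup>+x. indicator (K \<inter> T) x \<partial>vol E)"
    by (intro nn_integral_cong) (auto simp: indicator_def)
  finally show ?thesis using assms by simp
qed

lemma measure_body:
  assumes "K \<in> sets borel" "T \<in> sets borel"
  shows "measure (body E K) T = measure (vol E) (K \<inter> T)"
  using emeasure_body[OF assms] by (simp add: measure_def)

lemma integral_body:
  fixes f :: "'a::real_inner \<Rightarrow> real"
  assumes [measurable]: "K \<in> sets borel" "f \<in> borel_measurable borel"
  shows "(LINT x|body E K. f x) = (LINT x:K|vol E. f x)"
  unfolding body_def set_lebesgue_integral_def
  by (subst integral_density) auto

lemma AE_body:
  assumes [measurable]: "K \<in> sets borel"
  shows "AE x in body E K. x \<in> K"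
  unfolding body_def by (subst AE_density) (auto simp: indicator_def)

lemma emeasure_vol_bounded_finite:
  fixes K :: "'a::separable_inner set"
  assumes B: "is_onb E B" and "bounded K"
  shows "emeasure (vol E) K < \<infinity>"
proof -
  obtain r where "K \<subseteq> cball 0 r"
    using assms(2) by (metis bounded_iff mem_cball_0 subsetI)
  then have "emeasure (vol E) K \<le> emeasure (vol E) (cball 0 r)"
    by (intro emeasure_mono) auto
  also have "\<dots> < \<infinity>"
    using emeasure_onb_vol_cball_finite B by (auto simp: vol_eqI[OF B] is_onb_iff)
  finally show ?thesis .
qed

lemma finite_measure_body:
  fixes K :: "'a::separable_inner set"
  assumes B: "is_onb E B" and K: "compact K"
  shows "finite_measure (body E K)"
proof
  show "emeasure (body E K) (space (body E K)) \<noteq> \<infinity>"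
    using emeasure_vol_bounded_finite[OF B compact_imp_bounded[OF K]] K
    by (simp add: emeasure_body compact_imp_closed)
qed

lemma integrable_body:
  fixes K :: "'a::separable_inner set" and f :: "'a \<Rightarrow> real"
  assumes B: "is_onb E B" and K: "compact K"
    and f: "f \<in> borel_measurable borel" "\<And>x. x \<in> K \<Longrightarrow> \<bar>f x\<bar> \<le> C"
  shows "integrable (body E K) f"
proof -
  interpret finite_measure "body E K" by (rule finite_measure_body[OF B K])
  have "AE x in body E K. x \<in> K"
    using K by (intro AE_body) (auto simp: compact_imp_closed)
  then have "AE x in body E K. norm (f x) \<le> C"
    by eventually_elim (use f(2) in auto)
  then show ?thesis
    by (rule integrable_const_bound) (use f(1) in simp)
qed

lemma integrable_body_continuous:
  fixes K :: "'a::separable_inner set" and f :: "'a \<Rightarrow> real"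
  assumes B: "is_onb E B" and K: "compact K" and f: "continuous_on UNIV f"
  shows "integrable (body E K) f"
proof -
  have "bounded (f ` K)"
    using K f by (meson compact_continuous_image compact_imp_bounded continuous_on_subset subset_UNIV)
  then obtain C where "\<And>x. x \<in> K \<Longrightarrow> \<bar>f x\<bar> \<le> C"
    by (auto simp: bounded_iff)
  then show ?thesis
    using f by (intro integrable_body[OF B K]) (auto intro: borel_measurable_continuous_onI)
qed

text \<open>Midpoints only: this is what Brunn-Minkowski yields for chord lengths and what the tail
  estimate consumes.\<close>

definition midconcave_on :: "'a::real_vector set \<Rightarrow> ('a \<Rightarrow> real) \<Rightarrow> bool" where
  "midconcave_on K h \<longleftrightarrow> (\<forall>x\<in>K. \<forall>y\<in>K. (h x + h y) / 2 \<le> h ((1/2) *\<^sub>R (x + y)))"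

lemma convex_midpoint: "convex K \<Longrightarrow> x \<in> K \<Longrightarrow> y \<in> K \<Longrightarrow> (1/2) *\<^sub>R (x + y) \<in> K"
  unfolding scaleR_add_right by (rule convexD) auto

text \<open>Prekopa-Leindler for indicators of superlevel sets, that is, Brunn-Minkowski in its
  multiplicative form.\<close>

lemma measure_body_midpoint:
  fixes K :: "'a::separable_inner set"
  assumes B: "is_onb E B" and K: "compact K" "convex K"
    and h [measurable]: "h \<in> borel_measurable borel" and conc: "midconcave_on K h"
  shows "measure (body E K) {x. s \<le> h x} * measure (body E K) {x. t \<le> h x}
       \<le> (measure (body E K) {x. (s + t) / 2 \<le> h x})\<^sup>2"
proof -
  interpret finite_measure "body E K" by (rule finite_measure_body[OF B K(1)])
  have Kb [measurable]: "K \<in> sets borel" using K(1) by (auto simp: compact_imp_closed)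
  let ?S = "\<lambda>t. K \<inter> {x. t \<le> h x}"
  have [measurable]: "?S t \<in> sets borel" for t by measurable
  have "(\<integral>\<^sup>+x. indicator (?S s) x \<partial>onb_vol B) * (\<integral>\<^sup>+x. indicator (?S t) x \<partial>onb_vol B)
      \<le> (\<integral>\<^sup>+x. indicator (?S ((s + t) / 2)) x \<partial>onb_vol B)\<^sup>2"
  proof (rule prekopa_leindler_onb_vol)
    show "finite B" using B by (simp add: is_onb_def)
    fix x y
    have "(1/2) *\<^sub>R (x + y) \<in> ?S ((s + t) / 2)" if "x \<in> ?S s" "y \<in> ?S t"
    proof -
      have "(s + t) / 2 \<le> (h x + h y) / 2" using that by auto
      also have "\<dots> \<le> h ((1/2) *\<^sub>R (x + y))" using conc that by (auto simp: midconcave_on_def)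
      finally show ?thesis using that convex_midpoint[OF K(2)] by auto
    qed
    then show "indicator (?S s) x * indicator (?S t) y
        \<le> (indicator (?S ((s + t) / 2)) ((1/2) *\<^sub>R (x + y)) :: ennreal)\<^sup>2"
      by (simp add: indicator_def)
  qed simp_all
  then have "emeasure (vol E) (?S s) * emeasure (vol E) (?S t) \<le> (emeasure (vol E) (?S ((s + t) / 2)))\<^sup>2"
    by (simp add: vol_eqI[OF B])
  then have "emeasure (body E K) {x. s \<le> h x} * emeasure (body E K) {x. t \<le> h x}
      \<le> (emeasure (body E K) {x. (s + t) / 2 \<le> h x})\<^sup>2"
    by (simp add: emeasure_body)
  then show ?thesis
    by (simp add: emeasure_eq_measure ennreal_mult[symmetric] ennreal_power)
qed

lemma tail_moment_body:
  fixes K :: "'a::separable_inner set"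
  assumes B: "is_onb E B" and K: "compact K" "convex K"
    and h [measurable]: "h \<in> borel_measurable borel" and conc: "midconcave_on K h"
    and bd: "\<And>x. x \<in> K \<Longrightarrow> \<bar>h x\<bar> \<le> C"
    and w: "w > 0" "0 \<le> q" "q < 1"
    and le: "measure (body E K) {x. w \<le> h x} \<le> q * measure (body E K) {x. 0 \<le> h x}"
  shows "(LINT x|body E K. (max 0 (h x)) ^ 4) \<le> tail_const q * w ^ 4 * measure (vol E) K"
proof -
  have Kb [measurable]: "K \<in> sets borel" using K(1) by (auto simp: compact_imp_closed)
  have "integrable (body E K) (\<lambda>x. (max 0 (h x)) ^ 4)"
  proof (rule integrable_body[OF B K(1), where C = "\<bar>C\<bar> ^ 4"])
    fix x assume "x \<in> K"
    then show "\<bar>(max 0 (h x)) ^ 4\<bar> \<le> \<bar>C\<bar> ^ 4"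
      using bd[of x] by (auto simp: power_abs intro!: power_mono)
  qed simp
  then have "ennreal (LINT x|body E K. (max 0 (h x)) ^ 4) = (\<integral>\<^sup>+x. ennreal ((max 0 (h x)) ^ 4) \<partial>body E K)"
    by (intro nn_integral_eq_integral[symmetric]) auto
  also have "\<dots> \<le> ennreal (tail_const q * w ^ 4 * measure (body E K) (space (body E K)))"
    by (rule nn_integral_tail_moment)
      (use w le measure_body_midpoint[OF B K h conc] finite_measure_body[OF B K(1)] in auto)
  finally show ?thesis
    using tail_const_ge_1[OF w(2,3)] by (simp add: measure_body)
qed

text \<open>A reverse Hoelder inequality. Markov at twice the mean \<open>A\<close> gives a drop by
  q = 1/2 over the width w = 2 A, and 16 = 2^4.\<close>

lemma fourth_moment_concave:
  fixes K :: "'a::separable_inner set"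
  assumes B: "is_onb E B" and K: "compact K" "convex K"
    and h [measurable]: "h \<in> borel_measurable borel" and conc: "midconcave_on K h"
    and bd: "\<And>x. x \<in> K \<Longrightarrow> 0 \<le> h x" "\<And>x. x \<in> K \<Longrightarrow> h x \<le> C"
    and A: "A > 0" "(LINT x|body E K. h x) = A * measure (vol E) K"
  shows "(LINT x|body E K. (h x) ^ 4) \<le> 16 * tail_const (1/2) * A ^ 4 * measure (vol E) K"
proof -
  interpret finite_measure "body E K" by (rule finite_measure_body[OF B K(1)])
  have Kb [measurable]: "K \<in> sets borel" using K(1) by (auto simp: compact_imp_closed)
  have AE: "AE x in body E K. x \<in> K" by (rule AE_body) simp
  then have AE0: "AE x in body E K. 0 \<le> h x" by eventually_elim (rule bd)
  have int: "integrable (body E K) h"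
    using bd by (intro integrable_body[OF B K(1)]) auto
  have "2 * A * measure (body E K) {x. 2 * A \<le> h x} \<le> (LINT x|body E K. h x)"
    using integral_Markov_inequality_measure[OF int _ AE0, of UNIV "2 * A"] A 
    by (simp add: field_simps)
  then have "measure (body E K) {x. 2 * A \<le> h x} \<le> (1/2) * measure (vol E) K"
    using A by (simp add: field_simps)
  also have "measure (vol E) K = measure (body E K) {x. 0 \<le> h x}"
    using AE0 by (subst measure_eq_AE[of "{x. 0 \<le> h x}" UNIV]) (auto simp: measure_body)
  finally have "(LINT x|body E K. (max 0 (h x)) ^ 4) \<le> tail_const (1/2) * (2 * A) ^ 4 * measure (vol E) K"
    using bd A(1) by (intro tail_moment_body[OF B K h conc, where C = C]) fastforce+
  moreover have "(LINT x|body E K. (max 0 (h x)) ^ 4) = (LINT x|body E K. (h x) ^ 4)"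
    using AE0 by (intro integral_cong_AE) (auto simp: max_def)
  ultimately show ?thesis by (simp add: power_mult_distrib mult_ac)
qed

text \<open>For each sign let h = \<plusminus>(x \<bullet> u - c) + e. The slab lies in {h \<ge> 0}
  and misses {h \<ge> 2 e}, so passing from level 0 to level 2 e loses at least the fraction
  \<open>d\<close>; the tail estimate with w = 2 e then bounds each side, and 32 = 2 * 2^4.\<close>

lemma fourth_moment_anticoncentration:
  fixes K :: "'a::separable_inner set"
  assumes B: "is_onb E B" and K: "compact K" "convex K"
    and e: "e > 0" and d: "0 < d" "d \<le> 1"
    and le: "d * measure (vol E) K \<le> measure (body E K) {x. \<bar>x \<bullet> u - c\<bar> < e}"
  shows "(LINT x|body E K. (x \<bullet> u - c) ^ 4) \<le> 32 * tail_const (1 - d) * e ^ 4 * measure (vol E) K"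
proof -
  interpret finite_measure "body E K" by (rule finite_measure_body[OF B K(1)])
  have Kb [measurable]: "K \<in> sets borel" using K(1) by (auto simp: compact_imp_closed)
  have half: "(LINT x|body E K. (max 0 (s * (x \<bullet> u - c) + e)) ^ 4) \<le> tail_const (1 - d) * (2 * e) ^ 4 * measure (vol E) K"
    if s: "s = 1 \<or> s = -1" for s :: real
  proof -
    let ?h = "\<lambda>x. s * (x \<bullet> u - c) + e"
    have "bounded (?h ` K)"
      using K by (intro compact_imp_bounded compact_continuous_image continuous_intros)
    then obtain C where C: "\<And>x. x \<in> K \<Longrightarrow> \<bar>?h x\<bar> \<le> C"
      by (auto simp: bounded_iff)
    have "measure (body E K) {x. 2 * e \<le> ?h x} + measure (body E K) {x. \<bar>x \<bullet> u - c\<bar> < e}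
        = measure (body E K) ({x. 2 * e \<le> ?h x} \<union> {x. \<bar>x \<bullet> u - c\<bar> < e})"
      using s by (intro finite_measure_Union[symmetric]) auto
    also have "\<dots> \<le> measure (body E K) {x. 0 \<le> ?h x}"
      using s e by (intro finite_measure_mono) auto
    finally have 1: "measure (body E K) {x. 2 * e \<le> ?h x} + d * measure (vol E) K \<le> measure (body E K) {x. 0 \<le> ?h x}"
      using le by simp
    \<comment> \<open>The mass of {h \<ge> 0} is at most the total, so the lost fraction may be
      taken relative to {h \<ge> 0}, as the tail estimate requires.\<close>
    have "measure (body E K) {x. 0 \<le> ?h x} \<le> measure (body E K) UNIV"
      by (intro finite_measure_mono) auto
    then have "d * measure (body E K) {x. 0 \<le> ?h x} \<le> d * measure (vol E) K"
      using d by (intro mult_left_mono) (auto simp: measure_body)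
    with 1 have 2: "measure (body E K) {x. 2 * e \<le> ?h x} \<le> (1 - d) * measure (body E K) {x. 0 \<le> ?h x}"
      by (simp add: algebra_simps)
    have "midconcave_on K ?h"
      by (auto simp: midconcave_on_def inner_add_left field_simps)
    then show ?thesis
      using C e d 2 by (intro tail_moment_body[OF B K, where C = C]) auto
  qed
  have int: "integrable (body E K) (\<lambda>x. (max 0 (s * (x \<bullet> u - c) + e)) ^ 4)" for s
    by (intro integrable_body_continuous[OF B K(1)] continuous_intros)
  have "(LINT x|body E K. (x \<bullet> u - c) ^ 4)
      \<le> (LINT x|body E K. (max 0 (1 * (x \<bullet> u - c) + e)) ^ 4 + (max 0 ((-1) * (x \<bullet> u - c) + e)) ^ 4)"
  proof (rule integral_mono)
    fix x
    let ?y = "x \<bullet> u - c"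
    have "?y ^ 4 \<le> (max 0 (?y + e)) ^ 4 + (max 0 (- ?y + e)) ^ 4"
    proof (cases "?y \<ge> 0")
      case True
      then have "?y ^ 4 \<le> (max 0 (?y + e)) ^ 4" using e by (intro power_mono) auto
      then show ?thesis by (simp add: add_increasing2)
    next
      case False
      then have "(- ?y) ^ 4 \<le> (max 0 (- ?y + e)) ^ 4" using e by (intro power_mono) auto
      then have "?y ^ 4 \<le> (max 0 (- ?y + e)) ^ 4" by (simp only: power_minus_even even_numeral)
      then show ?thesis by (simp only: add_increasing zero_le_power max.cobounded1)
    qed
    then show "?y ^ 4 \<le> (max 0 (1 * ?y + e)) ^ 4 + (max 0 ((-1) * ?y + e)) ^ 4" by simp
  qed (intro integrable_body_continuous[OF B K(1)] continuous_intros)+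
  also have "\<dots> = (LINT x|body E K. (max 0 (1 * (x \<bullet> u - c) + e)) ^ 4) + (LINT x|body E K. (max 0 ((-1) * (x \<bullet> u - c) + e)) ^ 4)"
    by (rule Bochner_Integration.integral_add) (rule int)+
  also have "\<dots> \<le> 2 * (tail_const (1 - d) * (2 * e) ^ 4 * measure (vol E) K)"
    using half[of 1] half[of "-1"] by simp
  finally show ?thesis by (simp add: power_mult_distrib mult_ac)
qed

subsection \<open>Convex bodies\<close>

lemma interior_of_top_of_set_nonempty_iff:
  fixes E :: "'a::real_normed_vector set"
  shows "(top_of_set E) interior_of K \<noteq> {} \<longleftrightarrow> (\<exists>x\<in>E. \<exists>r>0. ball x r \<inter> E \<subseteq> K)"
proof
  assume "(top_of_set E) interior_of K \<noteq> {}"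
  then obtain x T where T: "openin (top_of_set E) T" "x \<in> T" "T \<subseteq> K"
    by (auto simp: interior_of_def)
  then obtain U where U: "open U" "T = E \<inter> U" by (auto simp: openin_open)
  then obtain r where "r > 0" "ball x r \<subseteq> U" using T(2) by (meson IntD2 openE)
  then show "\<exists>x\<in>E. \<exists>r>0. ball x r \<inter> E \<subseteq> K" using U T by blast
next
  assume "\<exists>x\<in>E. \<exists>r>0. ball x r \<inter> E \<subseteq> K"
  then obtain x r where x: "x \<in> E" "r > 0" "ball x r \<inter> E \<subseteq> K" by auto
  have "openin (top_of_set E) (E \<inter> ball x r)" by (rule openin_open_Int[OF open_ball])
  moreover have "x \<in> E \<inter> ball x r" "E \<inter> ball x r \<subseteq> K" using x by auto
  ultimately have "x \<in> (top_of_set E) interior_of K"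
    unfolding interior_of_def by (simp only: mem_Collect_eq) (rule exI, intro conjI)
  then show "(top_of_set E) interior_of K \<noteq> {}" by auto
qed

lemma convex_body_iff:
  fixes E :: "'a::real_inner set"
  shows "convex_body E K \<longleftrightarrow> K \<subseteq> E \<and> convex K \<and> compact K \<and> (\<exists>x\<in>E. \<exists>r>0. ball x r \<inter> E \<subseteq> K)"
  unfolding convex_body_def interior_of_top_of_set_nonempty_iff ..

lemma is_onb_expand: "is_onb E B \<Longrightarrow> x \<in> E \<Longrightarrow> (\<Sum>b\<in>B. (x \<bullet> b) *\<^sub>R b) = x"
  by (simp add: is_onb_iff orthonormal_expand)

lemma is_onb_subset: "is_onb E B \<Longrightarrow> b \<in> B \<Longrightarrow> b \<in> E"
  by (auto simp: is_onb_def span_base)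

lemma is_onb_coeff_bound:
  assumes "is_onb E B" "x \<in> E" "r \<ge> 0" "\<And>b. b \<in> B \<Longrightarrow> \<bar>x \<bullet> b\<bar> \<le> r"
  shows "norm x \<le> r * sqrt (dim E)"
proof -
  have "(norm x)\<^sup>2 = (\<Sum>b\<in>B. (x \<bullet> b)\<^sup>2)"
    using assms by (intro orthonormal_norm2) (auto simp: is_onb_iff)
  also have "\<dots> \<le> (\<Sum>b\<in>B. r\<^sup>2)"
    using assms(4) by (intro sum_mono) (metis abs_ge_zero power2_abs power_mono)
  also have "\<dots> = (r * sqrt (dim E))\<^sup>2"
    using is_onb_card[OF assms(1)] by (simp add: power_mult_distrib mult.commute)
  finally show ?thesis
    by (rule power2_le_imp_le) (use assms(3) in simp)
qed

lemma AE_vol: "is_onb E B \<Longrightarrow> AE x in vol E. x \<in> (E :: 'a::separable_inner set)"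
  using haar_on_vol unfolding haar_on_def by blast

lemma nn_integral_vol_translate:
  fixes g :: "'a::separable_inner \<Rightarrow> ennreal"
  assumes "is_onb E B" "g \<in> borel_measurable borel" "v \<in> E"
  shows "(\<integral>\<^sup>+x. g (x + v) \<partial>vol E) = (\<integral>\<^sup>+x. g x \<partial>vol E)"
  using haar_on_vol[OF assms(1)] assms(2,3) unfolding haar_on_def by blast

lemma convex_body_measure_pos:
  fixes K :: "'a::separable_inner set"
  assumes B: "is_onb E B" and K: "convex_body E K"
  shows "0 < measure (vol E) K"
proof -
  have [measurable]: "K \<in> sets borel" by (rule convex_body_borel[OF K])
  obtain x r where x: "x \<in> E" "r > 0" "ball x r \<inter> E \<subseteq> K"
    using K by (auto simp: convex_body_iff)
  \<comment> \<open>Half side of a cube whose half diagonal is below \<open>r\<close>; the summand 1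
    keeps the quotient meaningful in dimension 0.\<close>
  define s where "s = r / (2 * (sqrt (dim E) + 1))"
  have sd: "sqrt (dim E) + 1 > 0" by (simp add: add_nonneg_pos)
  have s: "s > 0" "s * sqrt (dim E) < r"
  proof -
    show "s > 0" using x(2) sd by (simp add: s_def)
    have "s * sqrt (dim E) \<le> s * (sqrt (dim E) + 1)" using \<open>s > 0\<close> by simp
    also have "\<dots> = r / 2" using sd by (simp add: s_def field_simps)
    finally show "s * sqrt (dim E) < r" using x(2) by simp
  qed
  let ?C = "{y. \<forall>b\<in>B. \<bar>y \<bullet> b\<bar> \<le> s}"
  have [measurable]: "?C \<in> sets borel"
  proof -
    have "finite B" using B by (simp add: is_onb_def)
    then show ?thesis by measurable
  qed
  have "ennreal ((2 * s) ^ dim E) = emeasure (vol E) ?C"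
    using emeasure_vol_cube[OF B, of s] s by simp
  also have "\<dots> = (\<integral>\<^sup>+y. indicator ?C y \<partial>vol E)" by simp
  also have "\<dots> \<le> (\<integral>\<^sup>+y. indicator K (y + x) \<partial>vol E)"
  proof (rule nn_integral_mono_AE, use AE_vol[OF B] in eventually_elim)
    fix y assume y: "y \<in> E"
    have "y + x \<in> K" if "y \<in> ?C"
    proof -
      have "norm y \<le> s * sqrt (dim E)"
        using that s by (intro is_onb_coeff_bound[OF B y]) auto
      then have "y + x \<in> ball x r" using s by (simp add: dist_norm)
      then show ?thesis using x y is_onb_subspace[OF B] by (auto simp: subspace_add)
    qed
    then show "indicator ?C y \<le> (indicator K (y + x) :: ennreal)" by (auto simp: indicator_def)
  qed
  also have "\<dots> = emeasure (vol E) K"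
    using nn_integral_vol_translate[OF B, of "indicator K" x] x by simp
  finally have "emeasure (vol E) K \<noteq> 0"
    using zero_less_power[of "2 * s" "dim E"] s(1) by (auto simp: ennreal_eq_0_iff simp del: zero_less_power power_mult_distrib)
  moreover have "emeasure (vol E) K < \<infinity>"
    using K by (intro emeasure_vol_bounded_finite[OF B]) (auto simp: convex_body_def compact_imp_bounded)
  ultimately show ?thesis by (simp add: measure_def enn2real_positive_iff less_top zero_less_iff_neq_zero)
qed

subsection \<open>Affine images\<close>

lemma convex_body_affine_image:
  fixes E :: "'a::real_inner set"
  assumes B: "is_onb E B" and K: "convex_body E K" and A: "linear A" "bij_betw A E E" and v: "v \<in> E"
  shows "convex_body E ((\<lambda>x. A x + v) ` K)"
proof -
  note sub = is_onb_subspace[OF B]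
  have KE: "K \<subseteq> E" and conv: "convex K" and comp: "compact K" using K by (auto simp: convex_body_def)
  obtain C where C: "C > 0" "\<And>x. x \<in> E \<Longrightarrow> norm (A x) \<le> C * norm x"
    using linear_bounded_on_span[OF B A(1)] by metis
  obtain A' where A': "linear A'" "bij_betw A' E E" "\<And>x. x \<in> E \<Longrightarrow> A' (A x) = x" "\<And>x. x \<in> E \<Longrightarrow> A (A' x) = x"
    using linear_inverse_on[OF B A] by metis
  obtain D where D: "D > 0" "\<And>x. x \<in> E \<Longrightarrow> norm (A' x) \<le> D * norm x"
    using linear_bounded_on_span[OF B A'(1)] by metis
  have AE: "A x \<in> E" "A' x \<in> E" if "x \<in> E" for x using A(2) A'(2) that by (auto simp: bij_betw_def)
  have "continuous_on K (\<lambda>x. A x + v)"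
  proof (rule continuous_on_eq)
    show "continuous_on K (\<lambda>x. (\<Sum>b\<in>B. (x \<bullet> b) *\<^sub>R A b) + v)" by (intro continuous_intros)
    fix x assume "x \<in> K"
    then have "A x = A (\<Sum>b\<in>B. (x \<bullet> b) *\<^sub>R b)" using is_onb_expand[OF B, of x] KE by auto
    then show "(\<Sum>b\<in>B. (x \<bullet> b) *\<^sub>R A b) + v = A x + v"
      by (simp add: linear_sum[OF A(1)] linear_cmul[OF A(1)])
  qed
  then have c1: "compact ((\<lambda>x. A x + v) ` K)" using comp by (rule compact_continuous_image)
  have "(\<lambda>x. A x + v) ` K = (\<lambda>x. v + x) ` (A ` K)" by (auto simp: image_image add.commute)
  then have c2: "convex ((\<lambda>x. A x + v) ` K)"
    using conv A(1) by (simp add: convex_linear_image)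
  obtain x r where x: "x \<in> E" "r > 0" "ball x r \<inter> E \<subseteq> K" using K by (auto simp: convex_body_iff)
  \<comment> \<open>On \<open>E\<close> the inverse stretches by at most \<open>D\<close>, so a ball
    of radius r/D is pulled back into the ball of radius \<open>r\<close>.\<close>
  have "ball (A x + v) (r / D) \<inter> E \<subseteq> (\<lambda>x. A x + v) ` K"
  proof
    fix y assume y: "y \<in> ball (A x + v) (r / D) \<inter> E"
    let ?z = "y - (A x + v)"
    have z: "?z \<in> E" using y x v AE sub by (auto intro!: subspace_diff subspace_add)
    have "norm (A' ?z) \<le> D * norm ?z" by (rule D(2)[OF z])
    also have "\<dots> < r" using y D(1) by (auto simp: dist_norm norm_minus_commute field_simps)
    finally have "x + A' ?z \<in> ball x r" by (simp add: dist_norm)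
    moreover have "x + A' ?z \<in> E" using x z AE sub by (auto intro: subspace_add)
    ultimately have "x + A' ?z \<in> K" using x by auto
    moreover have "A (x + A' ?z) + v = y"
      using A'(4)[OF z] by (simp add: linear_add[OF A(1)])
    ultimately show "y \<in> (\<lambda>x. A x + v) ` K" by (metis (no_types, lifting) imageI)
  qed
  then show ?thesis
    unfolding convex_body_iff using c1 c2 KE x D AE v sub
    by (auto intro!: subspace_add bexI[of _ "A x + v"] exI[of _ "r / D"])
qed

text \<open>The image of the uniform measure on \<open>K\<close> is c times the uniform measure on
  the image body. The factor c cancels in normalised means, and norm bounds for \<open>A\<close>
  control it in volumes.\<close>

lemma volume_affine_image:
  fixes A :: "'a::separable_inner \<Rightarrow> 'a"
  assumes B: "is_onb E B" and K: "convex_body E K" and A: "linear A" "bij_betw A E E" and v: "v \<in> E"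
  shows volume_affine_image_le:
      "\<And>a. a > 0 \<Longrightarrow> (\<And>x. x \<in> E \<Longrightarrow> norm (A x) \<le> a * norm x) \<Longrightarrow>
        measure (vol E) ((\<lambda>x. A x + v) ` K) \<le> a ^ dim E * measure (vol E) K"
    and volume_affine_image_ge:
      "\<And>a. a > 0 \<Longrightarrow> (\<And>x. x \<in> E \<Longrightarrow> a * norm x \<le> norm (A x)) \<Longrightarrow>
        a ^ dim E * measure (vol E) K \<le> measure (vol E) ((\<lambda>x. A x + v) ` K)"
    and mean_affine_image:
      "\<And>f g. f \<in> borel_measurable borel \<Longrightarrow> g \<in> borel_measurable borel \<Longrightarrow> (\<And>x. x \<in> K \<Longrightarrow> f (A x + v) = g x) \<Longrightarrow>
        (LINT x|body E ((\<lambda>x. A x + v) ` K). f x) / measure (vol E) ((\<lambda>x. A x + v) ` K)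
          = (LINT x|body E K. (g x :: real)) / measure (vol E) K"
proof -
  let ?T = "\<lambda>x. A x + v"
  have KE: "K \<subseteq> E" using K by (auto simp: convex_body_def)
  have [measurable]: "K \<in> sets borel" by (rule convex_body_borel[OF K])
  have TK [measurable]: "?T ` K \<in> sets borel"
    by (rule convex_body_borel[OF convex_body_affine_image[OF assms]])
  obtain c where c: "c > 0"
    "\<And>g. g \<in> borel_measurable borel \<Longrightarrow> (\<integral>\<^sup>+x. g (A x) \<partial>vol E) = ennreal c * (\<integral>\<^sup>+x. g x \<partial>vol E)"
    "\<And>a. a > 0 \<Longrightarrow> (\<And>x. x \<in> E \<Longrightarrow> norm (A x) \<le> a * norm x) \<Longrightarrow> 1 \<le> c * a ^ dim E"
    "\<And>a. a > 0 \<Longrightarrow> (\<And>x. x \<in> E \<Longrightarrow> a * norm x \<le> norm (A x)) \<Longrightarrow> c * a ^ dim E \<le> 1"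
    using nn_integral_vol_linear[OF B A] by metis
  define T1 where "T1 x = (\<Sum>b\<in>B. (x \<bullet> b) *\<^sub>R A b) + v" for x
  have [measurable]: "T1 \<in> borel_measurable borel" unfolding T1_def by simp
  have T1: "T1 x = A x + v" if "x \<in> E" for x
  proof -
    have "A x = A (\<Sum>b\<in>B. (x \<bullet> b) *\<^sub>R b)" using is_onb_expand[OF B, of x] that by auto
    then show ?thesis by (simp add: linear_sum[OF A(1)] linear_cmul[OF A(1)] T1_def)
  qed
  have eq: "distr (body E K) borel T1 = density (body E (?T ` K)) (\<lambda>_. ennreal c)"
  proof (rule measure_eqI)
    fix S assume "S \<in> sets (distr (body E K) borel T1)"
    then have [measurable]: "S \<in> sets borel" by simp
    have T1S: "T1 -` S \<in> sets borel" using measurable_sets_borel[of T1 borel S] by simp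
    have "emeasure (distr (body E K) borel T1) S = emeasure (vol E) (K \<inter> T1 -` S)"
      using T1S by (subst emeasure_distr) (auto simp: emeasure_body)
    also have "\<dots> = (\<integral>\<^sup>+x. indicator (K \<inter> T1 -` S) x \<partial>vol E)"
      using T1S by simp
    also have "\<dots> = (\<integral>\<^sup>+x. indicator (?T ` K \<inter> S) (A x + v) \<partial>vol E)"
    proof (rule nn_integral_cong_AE, use AE_vol[OF B] in eventually_elim)
      fix x assume x: "x \<in> E"
      have "A x + v \<in> ?T ` K \<longleftrightarrow> x \<in> K"
      proof
        assume "A x + v \<in> ?T ` K"
        then obtain y where y: "y \<in> K" "A x = A y" by auto
        then have "x = y"
          using inj_onD[OF bij_betw_imp_inj_on[OF A(2)] y(2) x] KE by auto
        with y show "x \<in> K" by simp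
      qed simp
      then show "indicator (K \<inter> T1 -` S) x = (indicator (?T ` K \<inter> S) (A x + v) :: ennreal)"
        using T1[OF x] by (auto simp: indicator_def)
    qed
    also have "\<dots> = ennreal c * (\<integral>\<^sup>+x. indicator (?T ` K \<inter> S) (x + v) \<partial>vol E)"
      by (rule c(2)) measurable
    also have "(\<integral>\<^sup>+x. indicator (?T ` K \<inter> S) (x + v) \<partial>vol E) = (\<integral>\<^sup>+x. indicator (?T ` K \<inter> S) x \<partial>vol E)"
      by (rule nn_integral_vol_translate[OF B _ v]) measurable
    also have "ennreal c * \<dots> = emeasure (density (body E (?T ` K)) (\<lambda>_. ennreal c)) S"
      by (simp add: emeasure_density_const emeasure_body)
    finally show "emeasure (distr (body E K) borel T1) S = emeasure (density (body E (?T ` K)) (\<lambda>_. ennreal c)) S" .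
  qed simp
  have int: "(LINT x|body E K. g x) = c * (LINT x|body E (?T ` K). f x)"
    if [measurable]: "f \<in> borel_measurable borel" "g \<in> borel_measurable borel"
      and fg: "\<And>x. x \<in> K \<Longrightarrow> f (A x + v) = g x" for f g :: "'a \<Rightarrow> real"
  proof -
    have "(LINT x|body E K. g x) = (LINT x|body E K. f (T1 x))"
    proof (rule integral_cong_AE)
      have "AE x in body E K. x \<in> K" by (rule AE_body) simp
      then show "AE x in body E K. g x = f (T1 x)"
        by eventually_elim (use fg T1 KE in auto)
    qed simp_all
    also have "\<dots> = (LINT x|distr (body E K) borel T1. f x)"
      by (rule integral_distr[symmetric]) simp_all
    also have "\<dots> = c * (LINT x|body E (?T ` K). f x)"
      unfolding eq using c(1) by (subst integral_density) simp_all
    finally show ?thesis .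
  qed
  note cb = convex_body_affine_image[OF assms]
  have vol: "measure (vol E) K = c * measure (vol E) (?T ` K)"
    using int[of "\<lambda>_. 1" "\<lambda>_. 1"] by (simp add: measure_body)
  have pos: "measure (vol E) (?T ` K) > 0" by (rule convex_body_measure_pos[OF B cb])
  { fix f g :: "'a \<Rightarrow> real"
    assume fg: "f \<in> borel_measurable borel" "g \<in> borel_measurable borel" "\<And>x. x \<in> K \<Longrightarrow> f (A x + v) = g x"
    show "(LINT x|body E (?T ` K). f x) / measure (vol E) (?T ` K) = (LINT x|body E K. g x) / measure (vol E) K"
      using int[OF fg] c(1) by (simp add: vol) }
  fix a :: real assume a: "a > 0"
  { assume "\<And>x. x \<in> E \<Longrightarrow> norm (A x) \<le> a * norm x"
    then have "1 \<le> c * a ^ dim E" by (rule c(3)[OF a])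
    from mult_right_mono[OF this, of "measure (vol E) (?T ` K)"]
    show "measure (vol E) (?T ` K) \<le> a ^ dim E * measure (vol E) K" by (simp add: vol mult_ac) }
  { assume "\<And>x. x \<in> E \<Longrightarrow> a * norm x \<le> norm (A x)"
    then have "c * a ^ dim E \<le> 1" by (rule c(4)[OF a])
    from mult_right_mono[OF this, of "measure (vol E) (?T ` K)"]
    show "a ^ dim E * measure (vol E) K \<le> measure (vol E) (?T ` K)" by (simp add: vol mult_ac) }
qed

subsection \<open>Isotropic bodies\<close>

lemma integral_body_const:
  fixes K :: "'a::separable_inner set"
  assumes B: "is_onb E B" and K: "compact K"
  shows "(LINT x|body E K. c) = c * measure (vol E) K"
  using K by (simp add: measure_body compact_imp_closed mult.commute)

lemma isotropic_withD:
  fixes K :: "'a::separable_inner set"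
  assumes B: "is_onb E B" and iso: "isotropic_with E K L"
  shows "convex_body E K" "compact K" "convex K" "K \<subseteq> E" "K \<in> sets borel" "measure (vol E) K = 1" "L > 0"
    "\<And>u. u \<in> E \<Longrightarrow> (LINT x|body E K. x \<bullet> u) = 0"
    "\<And>u. u \<in> E \<Longrightarrow> (LINT x|body E K. (x \<bullet> u)\<^sup>2) = L\<^sup>2 * (norm u)\<^sup>2"
proof -
  show K: "convex_body E K" "measure (vol E) K = 1" "L > 0"
    using iso by (auto simp: isotropic_with_def)
  then show comp: "compact K" "convex K" "K \<subseteq> E" by (auto simp: convex_body_def)
  show Kb [measurable]: "K \<in> sets borel" by (rule convex_body_borel[OF K(1)])
  have O: "is_onb E (onb E)" using B by (intro is_onb_onb[of B]) (auto simp: is_onb_def)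
  have "barycenter E K = 0" using iso by (simp add: isotropic_with_def)
  then have bar: "(\<Sum>b\<in>onb E. (LINT x|body E K. x \<bullet> b) *\<^sub>R b) = 0"
    using K(2) by (simp add: barycenter_def integral_body)
  have 0: "(LINT x|body E K. x \<bullet> b) = 0" if "b \<in> onb E" for b
    using orthonormal_sum_inner[of "onb E" b "\<lambda>b. LINT x|body E K. x \<bullet> b"] O that bar by (simp add: is_onb_iff)
  fix u assume u: "u \<in> E"
  have "x \<bullet> u = (\<Sum>b\<in>onb E. (u \<bullet> b) * (x \<bullet> b))" for x
    using orthonormal_parseval[of "onb E" u x] O u by (simp only: is_onb_iff inner_commute[of x u])
  then have "(LINT x|body E K. x \<bullet> u) = (LINT x|body E K. (\<Sum>b\<in>onb E. (u \<bullet> b) * (x \<bullet> b)))"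
    by simp
  also have "\<dots> = (\<Sum>b\<in>onb E. (LINT x|body E K. (u \<bullet> b) * (x \<bullet> b)))"
    by (intro Bochner_Integration.integral_sum integrable_body_continuous[OF B comp(1)] continuous_intros)
  also have "\<dots> = 0" using 0 by simp
  finally show "(LINT x|body E K. x \<bullet> u) = 0" .
  show "(LINT x|body E K. (x \<bullet> u)\<^sup>2) = L\<^sup>2 * (norm u)\<^sup>2"
  proof (cases "u = 0")
    case False
    have "sgn u \<in> E" using u is_onb_subspace[OF B] by (simp add: sgn_div_norm subspace_scale)
    moreover have "norm (sgn u) = 1" using False by (simp add: norm_sgn)
    ultimately have "(LINT x|body E K. (x \<bullet> sgn u)\<^sup>2) = L\<^sup>2"
      using iso by (simp add: isotropic_with_def integral_body)
    moreover have "(x \<bullet> u)\<^sup>2 = (norm u)\<^sup>2 * (x \<bullet> sgn u)\<^sup>2" for x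
      using False by (simp add: sgn_div_norm power_mult_distrib divide_simps)
    ultimately show ?thesis by simp
  qed simp
qed

lemma isotropic_withI:
  fixes K :: "'a::separable_inner set"
  assumes B: "is_onb E B" and K: "convex_body E K" "measure (vol E) K = 1" "L > 0"
    and 0: "\<And>u. u \<in> E \<Longrightarrow> (LINT x|body E K. x \<bullet> u) = 0"
    and 2: "\<And>u. u \<in> E \<Longrightarrow> norm u = 1 \<Longrightarrow> (LINT x|body E K. (x \<bullet> u)\<^sup>2) = L\<^sup>2"
  shows "isotropic_with E K L"
proof -
  have [measurable]: "K \<in> sets borel" by (rule convex_body_borel[OF K(1)])
  have O: "is_onb E (onb E)" using B by (intro is_onb_onb[of B]) (auto simp: is_onb_def)
  have "barycenter E K = 0"
    unfolding barycenter_def using 0 is_onb_subset[OF O] by (simp add: integral_body[symmetric])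
  then show ?thesis using K 2 by (simp add: isotropic_with_def integral_body)
qed

definition adjoint_on :: "'a::real_inner set \<Rightarrow> ('a \<Rightarrow> 'a) \<Rightarrow> 'a \<Rightarrow> 'a" where
  "adjoint_on B A u = (\<Sum>b\<in>B. (A b \<bullet> u) *\<^sub>R b)"

lemma adjoint_on:
  assumes B: "is_onb E B" and A: "linear A"
  shows "x \<in> E \<Longrightarrow> A x \<bullet> u = x \<bullet> adjoint_on B A u" "adjoint_on B A u \<in> E"
proof -
  show "adjoint_on B A u \<in> E"
    unfolding adjoint_on_def using B is_onb_subspace[OF B]
    by (intro subspace_sum subspace_scale) (auto simp: is_onb_subset)
  assume "x \<in> E"
  then have "A x = A (\<Sum>b\<in>B. (x \<bullet> b) *\<^sub>R b)" using is_onb_expand[OF B, of x] by auto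
  then show "A x \<bullet> u = x \<bullet> adjoint_on B A u"
    by (simp add: linear_sum[OF A] linear_cmul[OF A] adjoint_on_def inner_sum_left inner_sum_right mult.commute)
qed

text \<open>From |A x|^2 = x \<bullet> A'(A x) and Cauchy-Schwarz. The bound for \<open>A'\<close>
  is asked for at \<open>A x\<close> alone, so one that is known only on a subspace can be
  used.\<close>

lemma norm_le_of_adjoint:
  fixes x :: "'a::real_inner"
  assumes adj: "\<And>u. A x \<bullet> u = x \<bullet> A' u" and a: "a \<ge> 0"
    and le: "norm (A' (A x)) \<le> a * norm (A x)"
  shows "norm (A x) \<le> a * norm x"
proof (cases "A x = 0")
  case False
  have "norm (A x) * norm (A x) = x \<bullet> A' (A x)"
    using adj[of "A x"] by (simp add: power2_norm_eq_inner[symmetric] power2_eq_square)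
  also have "\<dots> \<le> norm x * norm (A' (A x))" by (rule norm_cauchy_schwarz)
  also have "\<dots> \<le> norm x * (a * norm (A x))"
    by (intro mult_left_mono le) auto
  finally have "norm (A x) * norm (A x) \<le> (a * norm x) * norm (A x)" by (simp add: mult_ac)
  then show ?thesis using False by simp
qed (use a in simp)

text \<open>Comparing second moments in direction u gives L2^2 |u|^2 = L1^2 |w|^2 + (v \<bullet>
  u)^2 for w the adjoint of \<open>A\<close> at u. Hence \<open>A\<close> stretches by at most
  L2/L1, and as both volumes are 1, this ratio cannot be below 1.\<close>

lemma isotropic_const_le:
  fixes K :: "'a::separable_inner set"
  assumes B: "is_onb E B" and dim: "dim E \<ge> 1" and iso1: "isotropic_with E K L1"
    and A: "linear A" "bij_betw A E E" and v: "v \<in> E"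
    and iso2: "isotropic_with E ((\<lambda>x. A x + v) ` K) L2"
  shows "L1 \<le> L2"
proof -
  note 1 = isotropic_withD[OF B iso1] and 2 = isotropic_withD[OF B iso2]
  have int: "integrable (body E K) f" if "continuous_on UNIV f" for f :: "'a \<Rightarrow> real"
    using integrable_body_continuous[OF B 1(2) that] .
  have adj: "norm (adjoint_on B A u) \<le> L2 / L1 * norm u" if u: "u \<in> E" for u
  proof -
    let ?w = "adjoint_on B A u"
    note w = adjoint_on[OF B A(1), where u = u]
    have "L2\<^sup>2 * (norm u)\<^sup>2 = (LINT x|body E ((\<lambda>x. A x + v) ` K). (x \<bullet> u)\<^sup>2)"
      using 2(9)[OF u] by simp
    also have "\<dots> = (LINT x|body E K. (x \<bullet> ?w)\<^sup>2 + (2 * (v \<bullet> u)) * (x \<bullet> ?w) + (v \<bullet> u)\<^sup>2)"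
      using mean_affine_image[OF B 1(1) A v, of "\<lambda>x. (x \<bullet> u)\<^sup>2" "\<lambda>x. (x \<bullet> ?w)\<^sup>2 + (2 * (v \<bullet> u)) * (x \<bullet> ?w) + (v \<bullet> u)\<^sup>2"] 1(4,6) 2(6) w(1)
      by (auto simp: inner_add_left power2_sum algebra_simps subset_iff)
    also have "\<dots> = (LINT x|body E K. (x \<bullet> ?w)\<^sup>2) + (2 * (v \<bullet> u)) * (LINT x|body E K. x \<bullet> ?w) + (LINT x|body E K. (v \<bullet> u)\<^sup>2)"
      by (simp add: int continuous_intros)
    also have "\<dots> = L1\<^sup>2 * (norm ?w)\<^sup>2 + (v \<bullet> u)\<^sup>2"
      using 1(8,9)[OF w(2)] integral_body_const[OF B 1(2), of "(v \<bullet> u)\<^sup>2"] 1(6) by simp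
    finally have "L1\<^sup>2 * (norm ?w)\<^sup>2 \<le> L2\<^sup>2 * (norm u)\<^sup>2" by simp
    then have "(L1 * norm ?w)\<^sup>2 \<le> (L2 * norm u)\<^sup>2" by (simp add: power_mult_distrib)
    then have "L1 * norm ?w \<le> L2 * norm u"
      by (rule power2_le_imp_le) (use 2(7) in simp)
    then show ?thesis using 1(7) by (simp add: field_simps)
  qed
  have "norm (A x) \<le> L2 / L1 * norm x" if "x \<in> E" for x
  proof (rule norm_le_of_adjoint)
    have "A x \<in> E" using A(2) that by (auto simp: bij_betw_def)
    then show "norm (adjoint_on B A (A x)) \<le> L2 / L1 * norm (A x)" by (rule adj)
  qed (use 1(7) 2(7) adjoint_on(1)[OF B A(1) that] in simp_all)
  then have "1 \<le> (L2 / L1) ^ dim E"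
    using volume_affine_image_le[OF B 1(1) A v, of "L2 / L1"] 1(6,7) 2(6,7) by simp
  then have "\<not> L2 / L1 < 1"
    using power_Suc_less_one[of "L2 / L1" "dim E - 1"] dim 1(7) 2(7) by auto
  then show ?thesis using 1(7) by (simp add: field_simps)
qed

text \<open>Two isotropic images of \<open>K\<close> are affine images of each other, so
  \<open>isotropic_const_le\<close> in both directions makes the description in
  \<open>isotropy_const\<close> unique.\<close>

lemma isotropy_const_eq:
  fixes K :: "'a::separable_inner set"
  assumes B: "is_onb E B" and dim: "dim E \<ge> 1" and KE: "K \<subseteq> E"
    and T: "affine_iso E T" and iso: "isotropic_with E (T ` K) L"
  shows "isotropy_const E K = L"
proof -
  note sub = is_onb_subspace[OF B]
  have le: "L1 \<le> L2" if T1: "affine_iso E T1" and iso1: "isotropic_with E (T1 ` K) L1"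
    and T2: "affine_iso E T2" and iso2: "isotropic_with E (T2 ` K) L2" for T1 T2 L1 L2
  proof -
    obtain A1 v1 where A1: "linear A1" "bij_betw A1 E E" "v1 \<in> E" "T1 = (\<lambda>x. A1 x + v1)"
      using T1 by (auto simp: affine_iso_def)
    obtain A2 v2 where A2: "linear A2" "bij_betw A2 E E" "v2 \<in> E" "T2 = (\<lambda>x. A2 x + v2)"
      using T2 by (auto simp: affine_iso_def)
    obtain A' where A': "linear A'" "bij_betw A' E E" "\<And>x. x \<in> E \<Longrightarrow> A' (A1 x) = x"
      using linear_inverse_on[OF B A1(1,2)] by metis
    \<comment> \<open>Linear part and translation of \<open>T2\<close> composed with the inverse of
      \<open>T1\<close>.\<close>
    let ?A = "A2 \<circ> A'" and ?v = "v2 - A2 (A' v1)"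
    have lin: "linear ?A" by (rule linear_compose[OF A'(1) A2(1)])
    have bij: "bij_betw ?A E E" by (rule bij_betw_trans[OF A'(2) A2(2)])
    have v: "?v \<in> E" using A2 A'(2) A1(3) sub by (auto simp: bij_betw_def intro!: subspace_diff)
    have "(\<lambda>x. ?A x + ?v) ` (T1 ` K) = T2 ` K"
      unfolding image_image
    proof (rule image_cong[OF refl])
      fix x assume "x \<in> K"
      then show "?A (T1 x) + ?v = T2 x"
        using KE A'(3)[of x] by (simp add: A1(4) A2(4) linear_add[OF A'(1)] linear_add[OF A2(1)] subset_iff)
    qed
    then show ?thesis
      using isotropic_const_le[OF B dim iso1 lin bij v] iso2 by simp
  qed
  show ?thesis
    unfolding isotropy_const_def
    by (rule the_equality) (use T iso le in \<open>blast intro: antisym\<close>)+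
qed

lemma affine_iso_id:
  assumes "subspace E" shows "affine_iso E (\<lambda>x. x)"
  unfolding affine_iso_def
  by (rule exI[of _ "\<lambda>x. x"], rule exI[of _ 0]) (use assms in \<open>auto simp: subspace_0 bij_betw_def linear_id[unfolded id_def]\<close>)

lemma isotropy_const_isotropic:
  fixes K :: "'a::separable_inner set"
  assumes B: "is_onb E B" and dim: "dim E \<ge> 1" and iso: "isotropic_with E K L"
  shows "isotropy_const E K = L"
  using isotropic_withD(4)[OF B iso] iso
  by (intro isotropy_const_eq[OF B dim _ affine_iso_id[OF is_onb_subspace[OF B]]]) auto

subsection \<open>Inradius and size of the isotropy constant\<close>

text \<open>The constant of \<open>fourth_moment_concave\<close>: normalised fourth moment against
  the fourth power of the mean.\<close>

definition moment_const :: real where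
  "moment_const = 16 * tail_const (1/2)"

lemma moment_const_ge: "moment_const \<ge> 16"
  using tail_const_ge_1[of "1/2"] by (simp add: moment_const_def)

text \<open>AM-GM with the expected size \<open>a\<close> of y as parameter. Being linear in y^4 it
  can be integrated directly, in place of Cauchy-Schwarz.\<close>

lemma square_le_fourth:
  fixes a y :: real
  assumes "a > 0"
  shows "y\<^sup>2 \<le> (a\<^sup>2 + y ^ 4 / a\<^sup>2) / 2"
proof -
  have "2 * (a * (y\<^sup>2 / a)) \<le> a\<^sup>2 + (y\<^sup>2 / a)\<^sup>2"
    using sum_squares_bound[of a "y\<^sup>2 / a"] by (simp only: mult.assoc)
  moreover have "a * (y\<^sup>2 / a) = y\<^sup>2" "(y\<^sup>2 / a)\<^sup>2 = y ^ 4 / a\<^sup>2"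
    using assms by (simp_all add: power_divide flip: power_mult)
  ultimately show ?thesis by simp
qed

text \<open>If p is outside \<open>K\<close>, separation gives a unit vector u with x \<bullet> u
  \<le> \<rho> on \<open>K\<close>. Then \<rho> - x \<bullet> u is nonnegative and concave with mean
  \<rho>, so its fourth moment is at most \<open>moment_const\<close> \<rho>^4, which is too small
  for a variance L^2.\<close>

lemma isotropic_contains_ball:
  fixes K :: "'a::separable_inner set"
  assumes B: "is_onb E B" and iso: "isotropic_with E K L"
    and p: "p \<in> E" "norm p \<le> L / sqrt (4 + moment_const)"
  shows "p \<in> K"
proof (rule ccontr)
  assume pK: "p \<notin> K"
  note K = isotropic_withD[OF B iso]
  define \<rho> where "\<rho> = L / sqrt (4 + moment_const)"
  have \<rho>: "\<rho> > 0" "(4 + moment_const) * \<rho>\<^sup>2 = L\<^sup>2"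
    using K(7) moment_const_ge by (auto simp: \<rho>_def power_divide)
  have "K \<noteq> {}" using K(6) by auto
  \<comment> \<open>The nearest point of \<open>K\<close>; the direction p - q separates p from
    \<open>K\<close> and stays in \<open>E\<close>.\<close>
  then obtain q where q: "q \<in> K" "\<And>x. x \<in> K \<Longrightarrow> dist p q \<le> dist p x"
    using continuous_attains_inf[OF K(2), of "dist p"] continuous_on_dist[OF continuous_on_const continuous_on_id]
    by (metis (no_types, lifting))
  define w where "w = p - q"
  have w0: "w \<noteq> 0" using q(1) pK by (auto simp: w_def)
  have wE: "w \<in> E" unfolding w_def using p q K(4) is_onb_subspace[OF B] by (auto intro: subspace_diff)
  define u where "u = sgn w"
  have u: "u \<in> E" "norm u = 1"
    using wE w0 is_onb_subspace[OF B] by (auto simp: u_def sgn_div_norm subspace_scale)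
  have xu: "x \<bullet> u \<le> \<rho>" if x: "x \<in> K" for x
  proof -
    have "w \<bullet> (x - q) \<le> 0"
      unfolding w_def using q x K(2,3) by (intro any_closest_point_dot[of K]) (auto simp: compact_imp_closed)
    then have "x \<bullet> w \<le> q \<bullet> w" by (simp add: inner_diff_right inner_commute)
    also have "\<dots> \<le> p \<bullet> w" using inner_ge_zero[of w] by (simp add: w_def inner_diff_left)
    also have "\<dots> \<le> norm p * norm w" by (rule norm_cauchy_schwarz)
    also have "\<dots> \<le> \<rho> * norm w" using p(2) by (intro mult_right_mono) (auto simp: \<rho>_def)
    finally show ?thesis using w0 by (simp add: u_def sgn_div_norm field_simps)
  qed
  let ?f = "\<lambda>x. \<rho> - x \<bullet> u"
  have int: "integrable (body E K) f" if "continuous_on UNIV f" for f :: "'a \<Rightarrow> real"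
    using integrable_body_continuous[OF B K(2) that] .
  have "bounded (?f ` K)"
    using K(2) by (intro compact_imp_bounded compact_continuous_image continuous_intros)
  then obtain C where C: "\<And>x. x \<in> K \<Longrightarrow> \<bar>?f x\<bar> \<le> C" by (auto simp: bounded_iff)
  have "(LINT x|body E K. (?f x) ^ 4) \<le> 16 * tail_const (1/2) * \<rho> ^ 4 * measure (vol E) K"
  proof (rule fourth_moment_concave[OF B K(2,3), where C = C])
    show "midconcave_on K ?f" by (auto simp: midconcave_on_def inner_add_left field_simps)
    show "(LINT x|body E K. ?f x) = \<rho> * measure (vol E) K"
      using K(8)[OF u(1)] integral_body_const[OF B K(2), of \<rho>] by (simp add: int continuous_intros)
  qed (use xu C \<rho> in \<open>auto simp: abs_le_iff\<close>)
  then have f4: "(LINT x|body E K. (?f x) ^ 4) \<le> moment_const * \<rho> ^ 4"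
    by (simp add: moment_const_def K(6))
  have "L\<^sup>2 = (LINT x|body E K. (x \<bullet> u)\<^sup>2)"
    using K(9)[OF u(1)] u(2) by simp
  also have "\<dots> \<le> (LINT x|body E K. 3 * \<rho>\<^sup>2 + (1 / \<rho>\<^sup>2) * (?f x) ^ 4)"
  proof (rule integral_mono)
    fix x
    \<comment> \<open>The right side minus the left side is (2 \<rho> - x \<bullet> u)^2.\<close>
    have "(x \<bullet> u)\<^sup>2 \<le> 2 * \<rho>\<^sup>2 + 2 * (?f x)\<^sup>2"
      using zero_le_power2[of "2 * \<rho> - x \<bullet> u"] by (simp add: power2_eq_square algebra_simps)
    also have "\<dots> \<le> 2 * \<rho>\<^sup>2 + (\<rho>\<^sup>2 + (?f x) ^ 4 / \<rho>\<^sup>2)"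
      using square_le_fourth[OF \<rho>(1), of "?f x"] by simp
    finally show "(x \<bullet> u)\<^sup>2 \<le> 3 * \<rho>\<^sup>2 + (1 / \<rho>\<^sup>2) * (?f x) ^ 4" by simp
  qed (intro int continuous_intros)+
  also have "\<dots> = (LINT x|body E K. 3 * \<rho>\<^sup>2) + (1 / \<rho>\<^sup>2) * (LINT x|body E K. (?f x) ^ 4)"
    by (subst Bochner_Integration.integral_add) (use \<rho>(1) in \<open>auto intro!: int continuous_intros\<close>)
  also have "\<dots> \<le> 3 * \<rho>\<^sup>2 + (1 / \<rho>\<^sup>2) * (moment_const * \<rho> ^ 4)"
    using f4 integral_body_const[OF B K(2), of "3 * \<rho>\<^sup>2"] K(6) by (intro add_mono mult_left_mono) auto
  also have "\<dots> = (3 + moment_const) * \<rho>\<^sup>2"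
  proof -
    have "(1 / \<rho>\<^sup>2) * (moment_const * \<rho> ^ 4) = moment_const * \<rho>\<^sup>2"
      using \<rho>(1) by (simp add: power2_eq_square power4_eq_xxxx)
    then show ?thesis by (simp add: algebra_simps)
  qed
  \<comment> \<open>The 4 in the radius, where the estimate gives 3, makes this strict.\<close>
  also have "\<dots> < (4 + moment_const) * \<rho>\<^sup>2"
    using \<rho>(1) by (intro mult_strict_right_mono) simp_all
  also have "\<dots> = L\<^sup>2" by (rule \<rho>(2))
  finally show False by simp
qed

text \<open>The inscribed ball of radius \<rho> contains a cube of side 2 \<rho> / sqrt n, whose
  volume is at most that of \<open>K\<close>, namely 1.\<close>

lemma isotropic_const_upper:
  fixes K :: "'a::separable_inner set" and L :: real
  assumes B: "is_onb E B" and iso: "isotropic_with E K L" and dim: "dim E \<ge> 1"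
  shows "4 * L\<^sup>2 \<le> (4 + moment_const) * dim E"
proof -
  note K = isotropic_withD[OF B iso]
  define \<rho> where "\<rho> = L / sqrt (4 + moment_const)"
  have \<rho>: "\<rho> > 0" "(4 + moment_const) * \<rho>\<^sup>2 = L\<^sup>2"
    using K(7) moment_const_ge by (auto simp: \<rho>_def power_divide)
  define r where "r = \<rho> / sqrt (dim E)"
  have r: "r > 0" "r * sqrt (dim E) = \<rho>" using \<rho> dim by (auto simp: r_def)
  let ?C = "{y. \<forall>b\<in>B. \<bar>y \<bullet> b\<bar> \<le> r}"
  have "ennreal ((2 * r) ^ dim E) = emeasure (vol E) ?C"
    using emeasure_vol_cube[OF B, of r] r by simp
  also have "\<dots> \<le> emeasure (vol E) K"
  proof (rule emeasure_mono_AE, use AE_vol[OF B] in eventually_elim)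
    fix y assume y: "y \<in> E"
    have "y \<in> K" if "y \<in> ?C"
    proof (rule isotropic_contains_ball[OF B iso y])
      have "norm y \<le> r * sqrt (dim E)"
        using that r by (intro is_onb_coeff_bound[OF B y]) auto
      then show "norm y \<le> L / sqrt (4 + moment_const)" using r by (simp add: \<rho>_def)
    qed
    then show "y \<in> ?C \<longrightarrow> y \<in> K" by blast
  qed (simp add: K(5))
  also have "\<dots> = 1"
  proof -
    have "emeasure (vol E) K \<noteq> top" using K(6) by (auto simp: measure_def)
    then show ?thesis using K(6) by (simp add: emeasure_eq_ennreal_measure)
  qed
  finally have "(2 * r) ^ dim E \<le> 1" by (simp only: ennreal_le_1)
  then have "2 * r \<le> 1"
    using one_less_power[of "2 * r" "dim E"] dim by force
  then have "2 * \<rho> \<le> sqrt (dim E)" using r(2)[symmetric] mult_right_mono[of "2 * r" 1 "sqrt (dim E)"] by simp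
  then have "(2 * \<rho>)\<^sup>2 \<le> (sqrt (dim E))\<^sup>2" using \<rho>(1) by (intro power_mono) auto
  then have "4 * \<rho>\<^sup>2 \<le> dim E" by (simp add: power_mult_distrib)
  then have "(4 + moment_const) * (4 * \<rho>\<^sup>2) \<le> (4 + moment_const) * dim E"
    using moment_const_ge by (intro mult_left_mono) auto
  then show ?thesis using \<rho>(2) by simp
qed

text \<open>The mean of |x|^2 is n L^2. By Markov all but a mass 16 n L^2 of \<open>K\<close> has
  |x| < 1/4 and so lies in a cube of side 1/2, whose volume is at most 1/2.\<close>

lemma isotropic_const_lower:
  fixes K :: "'a::separable_inner set" and L :: real
  assumes B: "is_onb E B" and iso: "isotropic_with E K L" and dim: "dim E \<ge> 1"
  shows "1 \<le> 32 * dim E * L\<^sup>2"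
proof -
  note K = isotropic_withD[OF B iso]
  interpret finite_measure "body E K" by (rule finite_measure_body[OF B K(2)])
  have fin: "finite B" using B by (simp add: is_onb_def)
  let ?g = "\<lambda>x. \<Sum>b\<in>B. (x \<bullet> b)\<^sup>2"
  have int: "integrable (body E K) f" if "continuous_on UNIV f" for f :: "'a \<Rightarrow> real"
    using integrable_body_continuous[OF B K(2) that] .
  have "(LINT x|body E K. ?g x) = (\<Sum>b\<in>B. (LINT x|body E K. (x \<bullet> b)\<^sup>2))"
    by (intro Bochner_Integration.integral_sum int continuous_intros)
  also have "\<dots> = (\<Sum>b\<in>B. L\<^sup>2)"
  proof (rule sum.cong[OF refl])
    fix b assume "b \<in> B"
    then show "(LINT x|body E K. (x \<bullet> b)\<^sup>2) = L\<^sup>2"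
      using K(9)[OF is_onb_subset[OF B]] B by (simp add: is_onb_def)
  qed
  finally have g: "(LINT x|body E K. ?g x) = dim E * L\<^sup>2" using is_onb_card[OF B] by simp
  have [measurable]: "{x. 1/16 \<le> ?g x} \<in> sets borel"
    by (intro borel_closed closed_Collect_le continuous_intros)
  have m1: "measure (body E K) {x. 1/16 \<le> ?g x} \<le> 16 * (dim E * L\<^sup>2)"
    using integral_Markov_inequality_measure[OF int, of ?g UNIV "1/16"] g
    by (simp add: sum_nonneg continuous_intros)
  let ?C = "{y. \<forall>b\<in>B. \<bar>y \<bullet> b\<bar> \<le> 1/4}"
  have [measurable]: "?C \<in> sets borel" using fin by measurable
  have sub: "\<bar>y \<bullet> b\<bar> \<le> 1/4" if "\<not> 1/16 \<le> ?g y" "b \<in> B" for y b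
  proof -
    have "(y \<bullet> b)\<^sup>2 \<le> ?g y" using that fin by (intro member_le_sum) auto
    then have "\<bar>y \<bullet> b\<bar>\<^sup>2 \<le> (1/4)\<^sup>2" using that by (simp add: power_divide)
    then show ?thesis by (rule power2_le_imp_le) simp
  qed
  have "emeasure (body E K) ?C \<le> emeasure (vol E) ?C"
    unfolding emeasure_body[OF K(5) \<open>?C \<in> sets borel\<close>]
    by (rule emeasure_mono[OF Int_lower2]) (simp only: sets_vol \<open>?C \<in> sets borel\<close>)
  also have "\<dots> = ennreal ((2 * (1/4)) ^ dim E)"
    by (rule emeasure_vol_cube[OF B]) simp
  finally have "measure (body E K) ?C \<le> (1/2) ^ dim E"
    by (simp add: emeasure_eq_measure)
  also have "\<dots> \<le> (1/2) ^ 1" using dim by (intro power_decreasing) auto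
  finally have m2: "measure (body E K) ?C \<le> 1/2" by simp
  have "1 = measure (body E K) UNIV" using K by (simp add: measure_body)
  also have "\<dots> \<le> measure (body E K) ({x. 1/16 \<le> ?g x} \<union> ?C)"
  proof (rule finite_measure_mono)
    show "UNIV \<subseteq> {x. 1/16 \<le> ?g x} \<union> ?C" using sub by blast
  qed measurable
  also have "\<dots> \<le> measure (body E K) {x. 1/16 \<le> ?g x} + measure (body E K) ?C"
    by (rule measure_Un_le) measurable
  also have "\<dots> \<le> 16 * (dim E * L\<^sup>2) + 1/2" using m1 m2 by simp
  finally show ?thesis by simp
qed

text \<open>The outcome of \<open>variance_lower\<close>: 512 = 32 * 2^4 and the argument 1/4 belong
  to a slab of half width 2 \<sigma> with 3/4 of the mass, the other summand to the second moment of
  the chord length.\<close>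

definition lower_var_const :: real where
  "lower_var_const = (512 * tail_const (1/4) + (1 + moment_const) / 2) / 2"

text \<open>Half of the fraction of \<open>Q\<close> on which \<open>large_chord_measure\<close>
  finds chords of at least half the mean length.\<close>

definition mass_const :: real where
  "mass_const = 1 / (4 * (1 + moment_const))"

text \<open>The outcome of \<open>variance_upper\<close>, whose slab has half width e with e^2 = 4
  L^2 / \<open>mass_const\<close>.\<close>

definition upper_var_const :: real where
  "upper_var_const = 2 / mass_const * (1 + 32 * tail_const (1 - mass_const))"

lemma mass_const: "0 < mass_const" "mass_const \<le> 1"
  using moment_const_ge by (simp_all add: mass_const_def field_simps)

lemma lower_var_const_pos: "0 < lower_var_const"
  using moment_const_ge tail_const_ge_1[of "1/4"]
  unfolding lower_var_const_def by (intro divide_pos_pos add_pos_pos) auto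

lemma upper_var_const_pos: "0 < upper_var_const"
  using mass_const tail_const_ge_1[of "1 - mass_const"] by (simp add: upper_var_const_def)

lemma scaled_mult_le_half_sum_squares:
  fixes a b l :: real
  assumes "l > 0"
  shows "a * b \<le> (l * a\<^sup>2 + b\<^sup>2 / l) / 2"
proof -
  have "0 \<le> (l * a - b)\<^sup>2 / l" using assms by simp
  also have "\<dots> = l * a\<^sup>2 + b\<^sup>2 / l - 2 * (a * b)"
    using assms by (simp add: power2_eq_square field_simps)
  finally show ?thesis by simp
qed

lemma power_le_imp_le_base_pos:
  fixes a b :: real
  assumes "a ^ k \<le> b ^ k" "0 \<le> b" "1 \<le> k"
  shows "a \<le> b"
  using power_le_imp_le_base[of a "k - 1" b] assms by simp

subsection \<open>Linear algebra\<close>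

text \<open>Gram-Schmidt for a form that is positive definite on \<open>span B\<close>. The new
  family is indexed by \<open>B\<close> itself, so that it defines a linear map which whitens a
  covariance form.\<close>

lemma gram_schmidt_form:
  fixes M :: "'a::real_inner \<Rightarrow> 'a \<Rightarrow> real"
  assumes add: "\<And>x y z. M (x + y) z = M x z + M y z" and scale: "\<And>r x y. M (r *\<^sub>R x) y = r * M x y"
    and sym: "\<And>x y. M x y = M y x" and pos: "\<And>x. x \<in> span B \<Longrightarrow> x \<noteq> 0 \<Longrightarrow> M x x > 0"
    and B: "finite B" "independent B"
  shows "\<exists>e. (\<forall>b\<in>B. \<forall>b'\<in>B. M (e b) (e b') = (if b = b' then 1 else 0)) \<and> span (e ` B) = span B"
  using B pos
proof (induction B rule: finite_induct)
  case (insert b B)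
  have indep: "independent B" "b \<notin> span B"
    using insert.prems(1) insert.hyps by (auto simp: independent_insert)
  have sub: "span B \<subseteq> span (insert b B)" by (rule span_mono) auto
  have posB: "M x x > 0" if "x \<in> span B" "x \<noteq> 0" for x
    using that sub by (intro insert.prems(2)) auto
  from insert.IH[OF indep(1) posB] obtain e where
    "\<forall>c\<in>B. \<forall>c'\<in>B. M (e c) (e c') = (if c = c' then 1 else 0)" and span_e: "span (e ` B) = span B"
    by auto
  then have e: "\<And>c c'. c \<in> B \<Longrightarrow> c' \<in> B \<Longrightarrow> M (e c) (e c') = (if c = c' then 1 else 0)" by blast
  have sum_left: "M (\<Sum>c\<in>A. g c) z = (\<Sum>c\<in>A. M (g c) z)" if "finite A" for A g z
    using that by (induction A rule: finite_induct) (use scale[of 0] in \<open>auto simp: add\<close>)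
  \<comment> \<open>The projection of b onto \<open>span B\<close> that is orthogonal for
    \<open>M\<close>.\<close>
  define p where "p = (\<Sum>c\<in>B. M b (e c) *\<^sub>R e c)"
  have pB: "p \<in> span B"
    unfolding p_def span_e[symmetric] by (intro span_sum span_scale span_base) auto
  define w where "w = b - p"
  have w0: "w \<noteq> 0" using pB indep(2) by (auto simp: w_def)
  have wI: "w \<in> span (insert b B)" unfolding w_def by (rule span_diff[OF span_base subsetD[OF sub pB]]) simp
  have bw: "b = w + p" by (simp add: w_def)
  have w_orth: "M w (e c) = 0" if c: "c \<in> B" for c
  proof -
    have "M p (e c) = (\<Sum>c'\<in>B. M b (e c') * M (e c') (e c))"
      unfolding p_def by (simp add: sum_left insert.hyps(1) scale)
    also have "\<dots> = (\<Sum>c'\<in>B. if c' = c then M b (e c') else 0)"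
      using e c by (intro sum.cong) auto
    also have "\<dots> = M b (e c)" using c insert.hyps(1) by simp
    finally have "M p (e c) = M b (e c)" .
    then show ?thesis using add[of w p "e c"] bw by simp
  qed
  have Mw: "M w w > 0" by (rule insert.prems(2)[OF wI w0])
  define v where "v = (1 / sqrt (M w w)) *\<^sub>R w"
  have "M v v = (1 / sqrt (M w w)) * M w v" unfolding v_def by (rule scale)
  also have "M w v = M v w" by (rule sym)
  also have "M v w = (1 / sqrt (M w w)) * M w w" unfolding v_def by (rule scale)
  finally have v1: "M v v = 1" using Mw by simp
  have v2: "M v (e c) = 0" if "c \<in> B" for c unfolding v_def scale w_orth[OF that] by simp
  have v3: "M (e c) v = 0" if "c \<in> B" for c unfolding sym[of "e c" v] by (rule v2[OF that])
  note v = v1 v2 v3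
  let ?e = "e(b := v)"
  have "?e ` insert b B = insert v (e ` B)" using insert.hyps(2) by auto
  moreover have "span (insert v (e ` B)) = span (insert b B)"
  proof (rule antisym)
    have "v \<in> span (insert b B)" unfolding v_def by (intro span_scale wI)
    moreover have "e ` B \<subseteq> span (insert b B)" using span_e sub span_superset[of "e ` B"] by blast
    ultimately show "span (insert v (e ` B)) \<subseteq> span (insert b B)"
      by (intro span_minimal) auto
    have "span (e ` B) \<subseteq> span (insert v (e ` B))" by (rule span_mono) auto
    then have B_sub: "span B \<subseteq> span (insert v (e ` B))" using span_e by simp
    have "w = sqrt (M w w) *\<^sub>R v" using Mw by (simp add: v_def)
    then have "w \<in> span (insert v (e ` B))" by (metis insertI1 span_base span_scale)
    then have "b \<in> span (insert v (e ` B))" unfolding bw using B_sub pB by (intro span_add) auto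
    then show "span (insert b B) \<subseteq> span (insert v (e ` B))"
      using B_sub span_superset[of B] by (intro span_minimal) auto
  qed
  moreover have "M (?e c) (?e c') = (if c = c' then 1 else 0)" if "c \<in> insert b B" "c' \<in> insert b B" for c c'
    using that e v insert.hyps(2) by auto
  ultimately show ?case by (intro exI[of _ ?e]) simp
qed simp

text \<open>Otherwise one more vector of \<open>H\<close> could be adjoined to \<open>C\<close>,
  giving more independent vectors than there are spanning ones.\<close>

lemma independent_card_span:
  fixes H :: "'a::real_vector set"
  assumes "finite B" "H \<subseteq> span B" "independent C" "C \<subseteq> H" "card B \<le> card C"
  shows "H \<subseteq> span C"
proof
  fix x assume x: "x \<in> H"
  show "x \<in> span C"
  proof (rule ccontr)
    assume nx: "x \<notin> span C"
    then have "x \<notin> C" using span_base by auto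
    have "independent (insert x C)" using nx \<open>x \<notin> C\<close> assms(3) by (simp add: independent_insert)
    then have "finite (insert x C) \<and> card (insert x C) \<le> card B"
      using assms(1,2,4) x by (intro independent_span_bound) auto
    then show False using \<open>x \<notin> C\<close> assms(5) by (auto simp: card_insert_if)
  qed
qed

subsection \<open>The projection of an isotropic body onto a hyperplane\<close>

lemma (in finite_measure) chebyshev_complement:
  fixes g :: "'a \<Rightarrow> real"
  assumes [measurable]: "g \<in> borel_measurable M" and int: "integrable M (\<lambda>x. (g x)\<^sup>2)" and e: "e > 0"
  shows "measure M (space M) \<le> (LINT x|M. (g x)\<^sup>2) / e\<^sup>2 + measure M {x\<in>space M. \<bar>g x\<bar> < e}"
proof -
  have "measure M (space M) \<le> measure M ({x\<in>space M. e\<^sup>2 \<le> (g x)\<^sup>2} \<union> {x\<in>space M. \<bar>g x\<bar> < e})"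
  proof (rule finite_measure_mono)
    have "\<bar>g x\<bar> < e" if "\<not> e\<^sup>2 \<le> (g x)\<^sup>2" for x
      using that e by (intro power2_less_imp_less[of "\<bar>g x\<bar>" e]) (simp_all only: power2_abs not_le less_imp_le)
    then show "space M \<subseteq> {x\<in>space M. e\<^sup>2 \<le> (g x)\<^sup>2} \<union> {x\<in>space M. \<bar>g x\<bar> < e}" by blast
  qed measurable
  also have "\<dots> \<le> measure M {x\<in>space M. e\<^sup>2 \<le> (g x)\<^sup>2} + measure M {x\<in>space M. \<bar>g x\<bar> < e}"
    by (rule measure_Un_le) measurable
  also have "measure M {x\<in>space M. e\<^sup>2 \<le> (g x)\<^sup>2} \<le> (LINT x|M. (g x)\<^sup>2) / e\<^sup>2"
    by (rule integral_Markov_inequality_measure[OF int sets.empty_sets]) (use e in simp_all)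
  finally show ?thesis by simp
qed

text \<open>The hyperplane is given by an orthonormal basis that the normal \<theta> completes to
  one of \<open>E\<close>; Lebesgue measure on \<open>E\<close> then splits into
  \<open>vol H\<close> and length along \<theta>.\<close>

locale hyperplane_projection =
  fixes E H B :: "'a::separable_inner set" and \<theta> :: 'a and K :: "'a set" and L :: real
  assumes onb_H: "is_onb H B" and onb_E: "is_onb E (insert \<theta> B)" and \<theta>_notin: "\<theta> \<notin> B"
    and dim_H: "dim H \<ge> 1" and iso: "isotropic_with E K L"
begin

lemmas K = isotropic_withD[OF onb_E iso]

definition P :: "'a \<Rightarrow> 'a" where "P x = x - (x \<bullet> \<theta>) *\<^sub>R \<theta>"

definition Q :: "'a set" where "Q = P ` K"

definition chord :: "'a \<Rightarrow> real set" where "chord y = {t. y + t *\<^sub>R \<theta> \<in> K}"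

definition f :: "'a \<Rightarrow> real" where "f y = measure lborel (chord y)"

abbreviation M :: "'a measure" where "M \<equiv> body H Q"

abbreviation V :: real where "V \<equiv> measure (vol H) Q"

section \<open>The projected body and its chords\<close>

lemma norm_\<theta>: "norm \<theta> = 1" and \<theta>_E: "\<theta> \<in> E"
  using onb_E by (auto simp: is_onb_def span_base)

lemma \<theta>_\<theta>: "\<theta> \<bullet> \<theta> = 1"
  using norm_\<theta> by (simp add: norm_eq_1)

lemma sub_H: "subspace H" and sub_E: "subspace E"
  using is_onb_subspace onb_H onb_E by auto

lemma H_E: "H \<subseteq> E"
  using onb_H onb_E span_mono[of B "insert \<theta> B"] by (auto simp: is_onb_def)

lemma inner_\<theta>: "y \<in> H \<Longrightarrow> y \<bullet> \<theta> = 0"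
proof -
  assume "y \<in> H"
  then have "y \<in> span B" using onb_H by (simp add: is_onb_def)
  moreover have "orthogonal \<theta> b" if "b \<in> B" for b
    using onb_E \<theta>_notin that by (auto simp: is_onb_def pairwise_def)
  ultimately have "orthogonal \<theta> y" using orthogonal_to_span by blast
  then show ?thesis by (simp add: orthogonal_def inner_commute)
qed

lemma P_H: "x \<in> E \<Longrightarrow> P x \<in> H"
proof -
  assume "x \<in> E"
  then have "x \<in> span (insert \<theta> B)" using onb_E by (simp add: is_onb_def)
  then obtain k where k: "x - k *\<^sub>R \<theta> \<in> span B" by (auto simp: span_insert)
  then have "x - k *\<^sub>R \<theta> \<in> H" using onb_H by (simp add: is_onb_def)
  moreover from inner_\<theta>[OF this] have "x \<bullet> \<theta> = k" by (simp add: inner_diff_left \<theta>_\<theta>)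
  ultimately show ?thesis by (simp add: P_def)
qed

lemma P_add: "y \<in> H \<Longrightarrow> P (y + t *\<^sub>R \<theta>) = y"
  by (simp add: P_def inner_add_left inner_\<theta> \<theta>_\<theta>)

lemma linear_P: "linear P"
  by (rule linearI) (simp_all add: P_def inner_add_left algebra_simps)

lemma orth_proj_eq: "x \<in> E \<Longrightarrow> orth_proj H x = P x"
  unfolding orth_proj_def
proof (rule the_equality)
  assume x: "x \<in> E"
  show "P x \<in> H \<and> (\<forall>z\<in>H. orthogonal (x - P x) z)"
    using P_H[OF x] inner_\<theta> by (simp add: P_def orthogonal_def inner_commute)
  fix y assume y: "y \<in> H \<and> (\<forall>z\<in>H. orthogonal (x - y) z)"
  have "P x - y \<in> H" using P_H[OF x] y sub_H by (simp add: subspace_diff)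
  moreover have "(x - P x) \<bullet> (P x - y) = 0"
    using inner_\<theta>[OF \<open>P x - y \<in> H\<close>] by (simp add: P_def inner_commute)
  ultimately have "(P x - y) \<bullet> (P x - y) = 0"
    using y by (auto simp: orthogonal_def inner_diff_left)
  then show "y = P x" by simp
qed

lemma Q_eq: "orth_proj H ` K = Q"
  unfolding Q_def using K(4) orth_proj_eq by (intro image_cong) auto

lemma chord_Q: "y \<in> H \<Longrightarrow> chord y \<noteq> {} \<longleftrightarrow> y \<in> Q"
proof
  assume y: "y \<in> H"
  { assume "chord y \<noteq> {}"
    then obtain t where "y + t *\<^sub>R \<theta> \<in> K" by (auto simp: chord_def)
    then show "y \<in> Q" using P_add[OF y] unfolding Q_def by (metis imageI) }
  { assume "y \<in> Q"
    then obtain x where "x \<in> K" "y = P x" by (auto simp: Q_def)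
    then have "x \<bullet> \<theta> \<in> chord y" by (simp add: chord_def P_def)
    then show "chord y \<noteq> {}" by auto }
qed

lemma convex_body_Q: "convex_body H Q"
proof -
  have QH: "Q \<subseteq> H" unfolding Q_def using K(4) P_H by auto
  have "continuous_on K P" unfolding P_def by (intro continuous_intros)
  then have comp: "compact Q" unfolding Q_def using K(2) by (rule compact_continuous_image)
  have conv: "convex Q" unfolding Q_def by (rule convex_linear_image[OF linear_P K(3)])
  obtain x r where x: "x \<in> E" "r > 0" "ball x r \<inter> E \<subseteq> K" using K(1) by (auto simp: convex_body_iff)
  have "ball (P x) r \<inter> H \<subseteq> Q"
  proof
    fix y assume y: "y \<in> ball (P x) r \<inter> H"
    let ?z = "y + (x \<bullet> \<theta>) *\<^sub>R \<theta>"
    have "x - ?z = P x - y" by (simp add: P_def)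
    then have "?z \<in> ball x r" using y by (simp only: mem_ball dist_norm Int_iff)
    moreover have "?z \<in> E" using y H_E \<theta>_E sub_E by (auto intro: subspace_add subspace_scale)
    ultimately have "?z \<in> K" using x by auto
    then show "y \<in> Q" using P_add[of y "x \<bullet> \<theta>"] y unfolding Q_def by (metis IntD2 imageI)
  qed
  then show ?thesis unfolding convex_body_iff using QH comp conv x P_H by blast
qed

lemma Q_props: "compact Q" "convex Q" "Q \<subseteq> H" "Q \<in> sets borel" "V > 0"
  using convex_body_Q convex_body_borel[OF convex_body_Q] convex_body_measure_pos[OF onb_H convex_body_Q]
  by (auto simp: convex_body_def)

lemma chord_borel [measurable]: "chord y \<in> sets borel"
  unfolding chord_def using K(5) by measurable

lemma emeasure_chord: "emeasure lborel (chord y) = (\<integral>\<^sup>+t. indicator K (y + t *\<^sub>R \<theta>) \<partial>lborel)"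
proof -
  have "emeasure lborel (chord y) = (\<integral>\<^sup>+t. indicator (chord y) t \<partial>lborel)" by simp
  also have "\<dots> = (\<integral>\<^sup>+t. indicator K (y + t *\<^sub>R \<theta>) \<partial>lborel)"
    by (intro nn_integral_cong) (auto simp: chord_def indicator_def)
  finally show ?thesis .
qed

lemma f_borel [measurable]: "f \<in> borel_measurable borel"
proof -
  have [measurable]: "K \<in> sets borel" by (rule K(5))
  have "(\<lambda>y. emeasure lborel (chord y)) \<in> borel_measurable borel"
    unfolding emeasure_chord by (rule borel_measurable_line_integral) simp
  then show ?thesis unfolding f_def measure_def by simp
qed

lemma f_nonneg: "0 \<le> f y"
  by (simp add: f_def)

lemma f_bound:
  obtains R where "R > 0" "\<And>y. y \<in> H \<Longrightarrow> emeasure lborel (chord y) = ennreal (f y)" "\<And>y. y \<in> H \<Longrightarrow> f y \<le> R"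
proof -
  obtain R where R: "R > 0" "\<And>x. x \<in> K \<Longrightarrow> norm x \<le> R"
    using compact_imp_bounded[OF K(2)] by (auto simp: bounded_pos)
  have le: "emeasure lborel (chord y) \<le> ennreal (2 * R)" if y: "y \<in> H" for y
  proof -
    have "chord y \<subseteq> {-R..R}"
    proof
      fix t assume "t \<in> chord y"
      then have "norm (y + t *\<^sub>R \<theta>) \<le> R" using R by (simp add: chord_def)
      moreover have "t = (y + t *\<^sub>R \<theta>) \<bullet> \<theta>" by (simp add: inner_add_left inner_\<theta>[OF y] \<theta>_\<theta>)
      then have "\<bar>t\<bar> \<le> norm (y + t *\<^sub>R \<theta>)"
        using Cauchy_Schwarz_ineq2[of "y + t *\<^sub>R \<theta>" \<theta>] norm_\<theta> by simp
      ultimately show "t \<in> {-R..R}" by auto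
    qed
    then have "emeasure lborel (chord y) \<le> emeasure lborel {-R..R}" by (intro emeasure_mono) auto
    then show ?thesis using R(1) by simp
  qed
  have eq: "emeasure lborel (chord y) = ennreal (f y)" if "y \<in> H" for y
    unfolding f_def using le[OF that] by (intro emeasure_eq_ennreal_measure) (auto simp: top_unique)
  have "f y \<le> 2 * R" if "y \<in> H" for y
    using le[OF that] eq[OF that] R(1) by simp
  then show thesis using that[of "2 * R"] R(1) eq by simp
qed

lemma emeasure_chord_eq: "y \<in> H \<Longrightarrow> emeasure lborel (chord y) = ennreal (f y)"
  using f_bound by metis

text \<open>Convexity puts the midpoints of two chords into the chord over the midpoint;
  Brunn-Minkowski on the line compares the lengths.\<close>

lemma midconcave_f: "midconcave_on Q f"
  unfolding midconcave_on_def
proof (intro ballI)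
  fix x y assume xy: "x \<in> Q" "y \<in> Q"
  then have H: "x \<in> H" "y \<in> H" "(1/2) *\<^sub>R (x + y) \<in> H"
    using Q_props(3) sub_H by (auto intro!: subspace_add subspace_scale)
  have "emeasure lborel (chord x) + emeasure lborel (chord y) \<le> 2 * emeasure lborel (chord ((1/2) *\<^sub>R (x + y)))"
  proof (rule brunn_minkowski_midpoint)
    show "chord x \<noteq> {}" "chord y \<noteq> {}" using xy H chord_Q by auto
    fix s t assume "s \<in> chord x" "t \<in> chord y"
    then have "(1/2) *\<^sub>R ((x + s *\<^sub>R \<theta>) + (y + t *\<^sub>R \<theta>)) \<in> K"
      using convex_midpoint[OF K(3)] by (simp add: chord_def)
    also have "(1/2) *\<^sub>R ((x + s *\<^sub>R \<theta>) + (y + t *\<^sub>R \<theta>)) = (1/2) *\<^sub>R (x + y) + ((s + t) / 2) *\<^sub>R \<theta>"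
      by (simp add: algebra_simps add_divide_distrib)
    finally show "(s + t) / 2 \<in> chord ((1/2) *\<^sub>R (x + y))" by (simp add: chord_def)
  qed simp_all
  then have "ennreal (f x + f y) \<le> ennreal (2 * f ((1/2) *\<^sub>R (x + y)))"
    using H f_nonneg by (simp add: emeasure_chord_eq ennreal_mult)
  then have "f x + f y \<le> 2 * f ((1/2) *\<^sub>R (x + y))"
    using f_nonneg by (simp only: ennreal_le_iff mult_nonneg_nonneg zero_le_numeral)
  then show "(f x + f y) / 2 \<le> f ((1/2) *\<^sub>R (x + y))"
    by simp
qed

section \<open>Moments of the chord length and of linear functionals\<close>

lemma fubini:
  assumes [measurable]: "g \<in> borel_measurable borel"
  shows "(\<integral>\<^sup>+x. g x \<partial>body E K) = (\<integral>\<^sup>+y. \<integral>\<^sup>+t. g (y + t *\<^sub>R \<theta>) * indicator K (y + t *\<^sub>R \<theta>) \<partial>lborel \<partial>vol H)"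
proof -
  have [measurable]: "K \<in> sets borel" by (rule K(5))
  have "(\<integral>\<^sup>+x. g x \<partial>body E K) = (\<integral>\<^sup>+x. g x * indicator K x \<partial>vol E)"
    by (rule nn_integral_body) simp_all
  also have "\<dots> = (\<integral>\<^sup>+x. g x * indicator K x \<partial>onb_vol (insert \<theta> B))"
    by (simp add: vol_eqI[OF onb_E])
  also have "\<dots> = (\<integral>\<^sup>+y. \<integral>\<^sup>+t. g (y + t *\<^sub>R \<theta>) * indicator K (y + t *\<^sub>R \<theta>) \<partial>lborel \<partial>onb_vol B)"
    using onb_H \<theta>_notin by (intro nn_integral_onb_vol_insert) (auto simp: is_onb_def)
  finally show ?thesis by (simp add: vol_eqI[OF onb_H])
qed

text \<open>A function that is constant along \<theta> integrates over the chord to its value times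
  \<open>f y\<close>. This carries moments of \<open>K\<close> over to the density \<open>f\<close>
  on \<open>Q\<close>.\<close>

lemma integral_K_eq:
  assumes g: "continuous_on UNIV g" "\<And>x. 0 \<le> g x" "\<And>y t. y \<in> H \<Longrightarrow> g (y + t *\<^sub>R \<theta>) = g y"
  shows "(LINT x|body E K. g x) = (LINT y|M. f y * g y)"
proof -
  have [measurable]: "g \<in> borel_measurable borel" "K \<in> sets borel" "Q \<in> sets borel"
    using g K(5) Q_props(4) by (auto intro: borel_measurable_continuous_onI)
  have "(\<integral>\<^sup>+x. ennreal (g x) \<partial>body E K)
      = (\<integral>\<^sup>+y. \<integral>\<^sup>+t. ennreal (g (y + t *\<^sub>R \<theta>)) * indicator K (y + t *\<^sub>R \<theta>) \<partial>lborel \<partial>vol H)"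
    by (rule fubini) simp
  also have "\<dots> = (\<integral>\<^sup>+y. ennreal (f y * g y) * indicator Q y \<partial>vol H)"
  proof (rule nn_integral_cong_AE, use AE_vol[OF onb_H] in eventually_elim)
    fix y assume y: "y \<in> H"
    have "(\<integral>\<^sup>+t. ennreal (g (y + t *\<^sub>R \<theta>)) * indicator K (y + t *\<^sub>R \<theta>) \<partial>lborel) = ennreal (g y) * emeasure lborel (chord y)"
      unfolding g(3)[OF y] emeasure_chord by (rule nn_integral_cmult) simp
    also have "\<dots> = ennreal (f y * g y) * indicator Q y"
    proof (cases "y \<in> Q")
      case True
      then show ?thesis using emeasure_chord_eq[OF y] f_nonneg g(2) by (simp add: ennreal_mult mult.commute)
    next
      case False
      then show ?thesis using chord_Q[OF y] by simp
    qed
    finally show "(\<integral>\<^sup>+t. ennreal (g (y + t *\<^sub>R \<theta>)) * indicator K (y + t *\<^sub>R \<theta>) \<partial>lborel) = ennreal (f y * g y) * indicator Q y" .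
  qed
  also have "\<dots> = (\<integral>\<^sup>+y. ennreal (f y * g y) \<partial>M)"
    by (rule nn_integral_body[symmetric]) simp_all
  finally show ?thesis
    using g(2) f_nonneg by (simp add: integral_eq_nn_integral)
qed

lemma integrable_Q:
  assumes "continuous_on UNIV (g :: 'a \<Rightarrow> real)"
  shows "integrable M g"
  by (rule integrable_body_continuous[OF onb_H Q_props(1) assms])

lemma integrable_f_power: "integrable M (\<lambda>y. (f y) ^ n)"
proof -
  obtain R where R: "R > 0" "\<And>y. y \<in> H \<Longrightarrow> f y \<le> R" using f_bound by metis
  have "\<bar>(f y) ^ n\<bar> \<le> R ^ n" if "y \<in> Q" for y
    using R f_nonneg[of y] Q_props(3) that power_mono[of "f y" R n] by auto
  then show ?thesis by (intro integrable_body[OF onb_H Q_props(1)]) auto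
qed

lemma integral_f: "(LINT y|M. f y) = 1"
  using integral_K_eq[of "\<lambda>_. 1"] integral_body_const[OF onb_E K(2), of 1] K(6) by simp

text \<open>The reverse Hoelder inequality for the concave function \<open>f\<close>, whose mean
  over \<open>Q\<close> is 1/V.\<close>

lemma fourth_moment_f: "(LINT y|M. (f y) ^ 4) \<le> moment_const * (1 / V) ^ 4 * V"
proof -
  obtain R where R: "R > 0" "\<And>y. y \<in> H \<Longrightarrow> f y \<le> R" using f_bound by metis
  show ?thesis
    unfolding moment_const_def
    by (rule fourth_moment_concave[OF onb_H Q_props(1,2) f_borel midconcave_f, where C = R])
      (use R Q_props f_nonneg integral_f in auto)
qed

lemma second_moment_f: "(LINT y|M. (f y)\<^sup>2) \<le> (1 + moment_const) / 2 / V"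
proof -
  have V: "V > 0" by (rule Q_props)
  have "(LINT y|M. (f y)\<^sup>2) \<le> (LINT y|M. (1/V)\<^sup>2 / 2 + (V\<^sup>2 / 2) * (f y) ^ 4)"
  proof (rule integral_mono)
    fix y
    show "(f y)\<^sup>2 \<le> (1/V)\<^sup>2 / 2 + (V\<^sup>2 / 2) * (f y) ^ 4"
      using square_le_fourth[of "1/V" "f y"] V by (simp add: field_simps)
  qed (intro Bochner_Integration.integrable_add integrable_mult_right integrable_f_power integrable_Q continuous_on_const)+
  also have "\<dots> = (1/V)\<^sup>2 / 2 * V + (V\<^sup>2 / 2) * (LINT y|M. (f y) ^ 4)"
    using integral_body_const[OF onb_H Q_props(1), of "(1/V)\<^sup>2 / 2"]
    by (subst Bochner_Integration.integral_add)
      (intro integrable_mult_right integrable_f_power integrable_Q continuous_on_const | simp)+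
  also have "\<dots> \<le> (1/V)\<^sup>2 / 2 * V + (V\<^sup>2 / 2) * (moment_const * (1 / V) ^ 4 * V)"
    using fourth_moment_f by (intro add_left_mono mult_left_mono) auto
  also have "\<dots> = (1 + moment_const) / 2 / V"
    using V by (simp add: field_simps power2_eq_square power4_eq_xxxx)
  finally show ?thesis .
qed

lemma finite_Q: "finite_measure M"
  by (rule finite_measure_body[OF onb_H Q_props(1)])

lemma measure_Q_UNIV: "measure M UNIV = V"
  using Q_props(4) by (simp add: measure_body)

lemma integrable_f_mult:
  assumes g: "continuous_on UNIV g"
  shows "integrable M (\<lambda>y. f y * g y)"
proof -
  obtain R where R: "R > 0" "\<And>y. y \<in> H \<Longrightarrow> f y \<le> R" using f_bound by metis
  have "bounded (g ` Q)"
    using g Q_props(1) by (meson compact_continuous_image compact_imp_bounded continuous_on_subset subset_UNIV)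
  then obtain C where C: "\<And>y. y \<in> Q \<Longrightarrow> \<bar>g y\<bar> \<le> C" by (auto simp: bounded_iff)
  have [measurable]: "g \<in> borel_measurable borel" using g by (rule borel_measurable_continuous_onI)
  have "\<bar>f y * g y\<bar> \<le> R * C" if "y \<in> Q" for y
    unfolding abs_mult using R C[OF that] f_nonneg[of y] that Q_props(3) by (intro mult_mono) auto
  then show ?thesis by (intro integrable_body[OF onb_H Q_props(1)]) auto
qed

text \<open>
  The density \<open>f\<close> is not bounded by a constant times its mean, only its second moment is: hence the
  Cauchy--Schwarz inequality with the fourth moment of the functional.
\<close>

lemma variance_lower:
  assumes u: "u \<in> H" "norm u = 1" and \<sigma>: "\<sigma> > 0"
    and le: "(LINT y|M. (y \<bullet> u - m)\<^sup>2) \<le> \<sigma>\<^sup>2 * V"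
  shows "L\<^sup>2 \<le> lower_var_const * \<sigma>\<^sup>2"
proof -
  interpret finite_measure "M" by (rule finite_Q)
  have V: "V > 0" by (rule Q_props)
  let ?Y = "\<lambda>y. y \<bullet> u - m"
  have \<sigma>2: "\<sigma>\<^sup>2 > 0" using \<sigma> by simp
  \<comment> \<open>Chebyshev at distance 2 \<sigma>: at least 3/4 of the mass of \<open>Q\<close>
    lies in the slab, whence \<open>tail_const (1/4)\<close> below.\<close>
  have "V \<le> (LINT y|M. (?Y y)\<^sup>2) / (2 * \<sigma>)\<^sup>2 + measure M {y. \<bar>?Y y\<bar> < 2 * \<sigma>}"
    using chebyshev_complement[of ?Y "2 * \<sigma>"] \<sigma> by (simp add: integrable_Q continuous_intros measure_Q_UNIV)
  moreover have "(LINT y|M. (?Y y)\<^sup>2) / (2 * \<sigma>)\<^sup>2 \<le> \<sigma>\<^sup>2 * V / (2 * \<sigma>)\<^sup>2"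
    using le by (intro divide_right_mono) auto
  moreover have "\<sigma>\<^sup>2 * V / (2 * \<sigma>)\<^sup>2 = V / 4" using \<sigma> by (simp add: power2_eq_square)
  ultimately have m2: "3/4 * V \<le> measure M {y. \<bar>?Y y\<bar> < 2 * \<sigma>}" by linarith
  have Y4: "(LINT y|M. (?Y y) ^ 4) \<le> 512 * tail_const (1/4) * \<sigma> ^ 4 * V"
    using fourth_moment_anticoncentration[OF onb_H Q_props(1,2) _ _ _ m2] \<sigma> by (simp add: power_mult_distrib)
  \<comment> \<open>The centre m is arbitrary while \<open>K\<close> has its barycenter at 0, so
    recentring can only add m^2.\<close>
  have "L\<^sup>2 \<le> (LINT x|body E K. (?Y x)\<^sup>2)"
  proof -
    have int: "integrable (body E K) g" if "continuous_on UNIV g" for g :: "'a \<Rightarrow> real"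
      using integrable_body_continuous[OF onb_E K(2) that] .
    have uE: "u \<in> E" using u H_E by auto
    have "(LINT x|body E K. (?Y x)\<^sup>2) = (LINT x|body E K. (x \<bullet> u)\<^sup>2 - (2 * m) * (x \<bullet> u) + m\<^sup>2)"
      by (simp add: power2_diff algebra_simps)
    also have "\<dots> = (LINT x|body E K. (x \<bullet> u)\<^sup>2) - (2 * m) * (LINT x|body E K. x \<bullet> u) + (LINT x|body E K. m\<^sup>2)"
      by (simp add: int continuous_intros)
    also have "\<dots> = L\<^sup>2 + m\<^sup>2"
      using K(6,8,9) uE u(2) integral_body_const[OF onb_E K(2), of "m\<^sup>2"] by simp
    finally show ?thesis by simp
  qed
  also have "\<dots> = (LINT y|M. f y * (?Y y)\<^sup>2)"
  proof (rule integral_K_eq)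
    show "((y + t *\<^sub>R \<theta>) \<bullet> u - m)\<^sup>2 = (y \<bullet> u - m)\<^sup>2" for y t
      using inner_\<theta>[OF u(1)] by (simp add: inner_add_left inner_commute[of \<theta>])
  qed (auto intro!: continuous_intros)
  \<comment> \<open>AM-GM with a weight that balances the typical sizes 1/V of \<open>f\<close> and
    \<sigma>^2 of the squared functional.\<close>
  also have "\<dots> \<le> (LINT y|M. (\<sigma>\<^sup>2 * V / 2) * (f y)\<^sup>2 + (1 / (2 * \<sigma>\<^sup>2 * V)) * (?Y y) ^ 4)"
  proof (rule integral_mono)
    fix y
    have "f y * (?Y y)\<^sup>2 \<le> (\<sigma>\<^sup>2 * V * (f y)\<^sup>2 + ((?Y y)\<^sup>2)\<^sup>2 / (\<sigma>\<^sup>2 * V)) / 2"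
      using \<sigma>2 V by (intro scaled_mult_le_half_sum_squares) simp
    then show "f y * (?Y y)\<^sup>2 \<le> (\<sigma>\<^sup>2 * V / 2) * (f y)\<^sup>2 + (1 / (2 * \<sigma>\<^sup>2 * V)) * (?Y y) ^ 4"
      by (simp add: field_simps)
  qed (intro Bochner_Integration.integrable_add integrable_mult_right integrable_f_power integrable_f_mult integrable_Q continuous_intros)+
  also have "\<dots> = (\<sigma>\<^sup>2 * V / 2) * (LINT y|M. (f y)\<^sup>2) + (1 / (2 * \<sigma>\<^sup>2 * V)) * (LINT y|M. (?Y y) ^ 4)"
    by (subst Bochner_Integration.integral_add)
      (intro integrable_mult_right integrable_f_power integrable_Q continuous_intros | simp)+
  also have "\<dots> \<le> (\<sigma>\<^sup>2 * V / 2) * ((1 + moment_const) / 2 / V) + (1 / (2 * \<sigma>\<^sup>2 * V)) * (512 * tail_const (1/4) * \<sigma> ^ 4 * V)"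
    using second_moment_f Y4 V \<sigma>2 by (intro add_mono mult_left_mono) auto
  also have "\<dots> = lower_var_const * \<sigma>\<^sup>2"
    using V \<sigma> by (simp add: lower_var_const_def field_simps power2_eq_square power4_eq_xxxx)
  finally show ?thesis .
qed

text \<open>Paley--Zygmund.\<close>

lemma large_chord_measure: "2 * mass_const * V \<le> measure M {y. 1 / (2 * V) \<le> f y}"
proof -
  interpret finite_measure "M" by (rule finite_Q)
  have V: "V > 0" by (rule Q_props)
  let ?S = "{y. 1 / (2 * V) \<le> f y}"
  have S [measurable]: "?S \<in> sets borel" by measurable
  have int_S: "integrable M (indicator ?S :: 'a \<Rightarrow> real)" by (simp add: emeasure_eq_measure)
  define c where "c = (1 + moment_const) / 2"
  have c: "c > 0" using moment_const_ge by (simp add: c_def)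
  \<comment> \<open>Chosen so that the term with the second moment of \<open>f\<close> contributes
    1/4; small chords contribute at most 1/2, and 1/4 is left for the set \<open>?S\<close>.\<close>
  define l where "l = V / (2 * c)"
  have l: "l > 0" using V c by (simp add: l_def)
  have "1 = (LINT y|M. f y)" by (simp add: integral_f)
  also have "\<dots> \<le> (LINT y|M. 1 / (2 * V) + ((l / 2) * (f y)\<^sup>2 + (1 / (2 * l)) * indicator ?S y))"
  proof (rule integral_mono)
    fix y
    show "f y \<le> 1 / (2 * V) + ((l / 2) * (f y)\<^sup>2 + (1 / (2 * l)) * indicator ?S y)"
    proof (cases "y \<in> ?S")
      case True
      have "f y * 1 \<le> (l * (f y)\<^sup>2 + 1\<^sup>2 / l) / 2" by (rule scaled_mult_le_half_sum_squares[OF l])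
      then show ?thesis using True V by (simp add: add_divide_distrib add_increasing)
    next
      case False
      then have "f y \<le> 1 / (2 * V)" by simp
      then show ?thesis using l by (simp add: False add_increasing2)
    qed
    show "integrable M f" using integrable_f_power[of 1] by simp
  qed (intro Bochner_Integration.integrable_add integrable_mult_right integrable_f_power int_S integrable_Q continuous_on_const)+
  also have "\<dots> = 1 / (2 * V) * V + ((l / 2) * (LINT y|M. (f y)\<^sup>2) + (1 / (2 * l)) * measure M ?S)"
    using integral_body_const[OF onb_H Q_props(1), of "1 / (2 * V)"] integrable_f_power[of 2]
    by (subst Bochner_Integration.integral_add | simp add: emeasure_eq_measure)+
  also have "\<dots> \<le> 1 / (2 * V) * V + ((l / 2) * (c / V) + (1 / (2 * l)) * measure M ?S)"
    using second_moment_f l by (intro add_left_mono add_right_mono mult_left_mono) (auto simp: c_def)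
  also have "\<dots> = 3/4 + c / V * measure M ?S"
    using V c by (simp add: l_def field_simps)
  finally have "1/4 \<le> c / V * measure M ?S" by linarith
  then have "V \<le> 4 * c * measure M ?S" using V by (simp add: field_simps)
  moreover have "2 * mass_const = 1 / (4 * c)"
    using moment_const_ge by (simp add: mass_const_def c_def field_simps)
  ultimately show ?thesis
    using c mult_left_mono[of V "4 * c * measure M ?S" "1 / (4 * c)"] by simp
qed

text \<open>If the slab |y \<bullet> u| < e carried less than the fraction
  \<open>mass_const\<close>, long chords over at least that fraction of \<open>Q\<close> would lie
  outside it and make the second moment of \<open>K\<close> too large. So the slab has enough mass,
  and \<open>fourth_moment_anticoncentration\<close> applies.\<close>

lemma variance_upper:
  assumes u: "u \<in> H" "norm u = 1"
  shows "(LINT y|M. (y \<bullet> u)\<^sup>2) \<le> upper_var_const * L\<^sup>2 * V"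
proof -
  interpret finite_measure "M" by (rule finite_Q)
  have V: "V > 0" by (rule Q_props)
  note d = mass_const
  \<comment> \<open>With this e the assumption refuted below leads to 2 L^2 \<le> L^2.\<close>
  define e where "e = 2 * L / sqrt mass_const"
  have e: "e > 0" "e\<^sup>2 * mass_const = 4 * L\<^sup>2"
    using K(7) d by (simp_all add: e_def power_divide power_mult_distrib)
  let ?S = "{y. 1 / (2 * V) \<le> f y}" and ?T = "{y. \<bar>y \<bullet> u - 0\<bar> < e}"
  have S [measurable]: "?S \<in> sets borel" "?T \<in> sets borel" by measurable
  have "mass_const * V \<le> measure M ?T"
  proof (rule ccontr)
    assume "\<not> ?thesis"
    then have T: "measure M ?T \<le> mass_const * V" by simp
    have "measure M ?S \<le> measure M ((?S - ?T) \<union> ?T)"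
      by (rule finite_measure_mono) (auto intro: S)
    also have "\<dots> \<le> measure M (?S - ?T) + measure M ?T"
      by (rule measure_Un_le) (auto intro: S)
    finally have ST: "mass_const * V \<le> measure M (?S - ?T)"
      using large_chord_measure T by simp
    have int: "integrable M (indicator (?S - ?T) :: 'a \<Rightarrow> real)"
      using S by (simp add: emeasure_eq_measure)
    have "2 * L\<^sup>2 = (1 / (2 * V)) * e\<^sup>2 * (mass_const * V)"
      using e(2) V by (simp add: field_simps)
    also have "\<dots> \<le> (1 / (2 * V)) * e\<^sup>2 * measure M (?S - ?T)"
      using ST V by (intro mult_left_mono) auto
    also have "\<dots> = (LINT y|M. ((1 / (2 * V)) * e\<^sup>2) * indicator (?S - ?T) y)"
      using S by simp
    also have "\<dots> \<le> (LINT y|M. f y * (y \<bullet> u)\<^sup>2)"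
    proof (rule integral_mono)
      fix y
      show "((1 / (2 * V)) * e\<^sup>2) * indicator (?S - ?T) y \<le> f y * (y \<bullet> u)\<^sup>2"
      proof (cases "y \<in> ?S - ?T")
        case True
        then have "e\<^sup>2 \<le> \<bar>y \<bullet> u\<bar>\<^sup>2" using e by (intro power_mono) auto
        then have "(1 / (2 * V)) * e\<^sup>2 \<le> f y * (y \<bullet> u)\<^sup>2" using True f_nonneg by (intro mult_mono) auto
        with True show ?thesis by simp
      next
        case False
        then show ?thesis using f_nonneg by simp
      qed
    qed (intro integrable_mult_right int integrable_f_mult continuous_intros)+
    also have "\<dots> = (LINT x|body E K. (x \<bullet> u)\<^sup>2)"
    proof (rule integral_K_eq[symmetric])
      show "((y + t *\<^sub>R \<theta>) \<bullet> u)\<^sup>2 = (y \<bullet> u)\<^sup>2" for y t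
        using inner_\<theta>[OF u(1)] by (simp add: inner_add_left inner_commute[of \<theta>])
    qed (auto intro!: continuous_intros)
    also have "\<dots> = L\<^sup>2" using K(9)[of u] u H_E by auto
    finally show False using K(7) by simp
  qed
  from fourth_moment_anticoncentration[OF onb_H Q_props(1,2) e(1) d this]
  have X4: "(LINT y|M. (y \<bullet> u) ^ 4) \<le> 32 * tail_const (1 - mass_const) * e ^ 4 * V" by simp
  have "(LINT y|M. (y \<bullet> u)\<^sup>2) \<le> (LINT y|M. e\<^sup>2 / 2 + (1 / (2 * e\<^sup>2)) * (y \<bullet> u) ^ 4)"
  proof (rule integral_mono)
    fix y
    show "(y \<bullet> u)\<^sup>2 \<le> e\<^sup>2 / 2 + (1 / (2 * e\<^sup>2)) * (y \<bullet> u) ^ 4"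
      using square_le_fourth[OF e(1), of "y \<bullet> u"] by (simp add: add_divide_distrib)
  qed (intro integrable_Q continuous_intros)+
  also have "\<dots> = e\<^sup>2 / 2 * V + (1 / (2 * e\<^sup>2)) * (LINT y|M. (y \<bullet> u) ^ 4)"
    using integral_body_const[OF onb_H Q_props(1), of "e\<^sup>2 / 2"]
    by (subst Bochner_Integration.integral_add) (intro integrable_mult_right integrable_Q continuous_intros | simp)+
  also have "\<dots> \<le> e\<^sup>2 / 2 * V + (1 / (2 * e\<^sup>2)) * (32 * tail_const (1 - mass_const) * e ^ 4 * V)"
    using X4 by (intro add_left_mono mult_left_mono) auto
  also have "\<dots> = e\<^sup>2 / 2 * (1 + 32 * tail_const (1 - mass_const)) * V"
    using e(1) by (simp add: field_simps power2_eq_square power4_eq_xxxx)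
  also have "e\<^sup>2 / 2 = 2 / mass_const * L\<^sup>2"
    using e(2) d by (simp add: field_simps)
  finally show ?thesis by (simp only: upper_var_const_def mult_ac)
qed

text \<open>The slab |x \<bullet> \<theta>| < 1/(4 V) meets each chord in length at most 1/(2 V), so
  it contains at most half of \<open>K\<close>; Chebyshev with variance L^2 bounds the rest by 16
  L^2 V^2.\<close>

lemma volume_Q_lower: "1 \<le> 32 * L\<^sup>2 * V\<^sup>2"
proof -
  interpret finite_measure "body E K" by (rule finite_measure_body[OF onb_E K(2)])
  have V: "V > 0" by (rule Q_props)
  have [measurable]: "K \<in> sets borel" "Q \<in> sets borel" using K(5) Q_props(4) by auto
  define e where "e = 1 / (4 * V)"
  have e: "e > 0" using V by (simp add: e_def)
  let ?T = "{x. \<bar>x \<bullet> \<theta>\<bar> < e}"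
  have [measurable]: "?T \<in> sets borel" by measurable
  have "emeasure (body E K) ?T = (\<integral>\<^sup>+x. indicator ?T x \<partial>body E K)" by simp
  also have "\<dots> = (\<integral>\<^sup>+y. \<integral>\<^sup>+t. indicator ?T (y + t *\<^sub>R \<theta>) * indicator K (y + t *\<^sub>R \<theta>) \<partial>lborel \<partial>vol H)"
    by (rule fubini) simp
  also have "\<dots> \<le> (\<integral>\<^sup>+y. ennreal (2 * e) * indicator Q y \<partial>vol H)"
  proof (rule nn_integral_mono_AE, use AE_vol[OF onb_H] in eventually_elim)
    fix y assume y: "y \<in> H"
    have "(\<integral>\<^sup>+t. indicator ?T (y + t *\<^sub>R \<theta>) * indicator K (y + t *\<^sub>R \<theta>) \<partial>lborel)
        \<le> (\<integral>\<^sup>+t. indicator {-e..e} t * indicator Q y \<partial>lborel)"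
    proof (rule nn_integral_mono)
      fix t
      have "y \<in> Q" if "y + t *\<^sub>R \<theta> \<in> K" using chord_Q[OF y] that by (auto simp: chord_def)
      moreover have "(y + t *\<^sub>R \<theta>) \<bullet> \<theta> = t" by (simp add: inner_add_left inner_\<theta>[OF y] \<theta>_\<theta>)
      ultimately show "indicator ?T (y + t *\<^sub>R \<theta>) * indicator K (y + t *\<^sub>R \<theta>) \<le> (indicator {-e..e} t * indicator Q y :: ennreal)"
        by (auto simp: indicator_def)
    qed
    also have "\<dots> = ennreal (2 * e) * indicator Q y"
      using e by (simp add: nn_integral_multc)
    finally show "(\<integral>\<^sup>+t. indicator ?T (y + t *\<^sub>R \<theta>) * indicator K (y + t *\<^sub>R \<theta>) \<partial>lborel) \<le> ennreal (2 * e) * indicator Q y" .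
  qed
  also have "\<dots> = ennreal (2 * e) * emeasure (vol H) Q"
    by (simp add: nn_integral_cmult)
  also have "emeasure (vol H) Q = ennreal V"
    using emeasure_vol_bounded_finite[OF onb_H compact_imp_bounded[OF Q_props(1)]]
    by (intro emeasure_eq_ennreal_measure) auto
  also have "ennreal (2 * e) * ennreal V = ennreal (1/2)"
    using V by (simp add: e_def flip: ennreal_mult)
  finally have m1: "measure (body E K) ?T \<le> 1/2"
    by (simp only: emeasure_eq_measure ennreal_le_iff)
  have "1 = measure (body E K) UNIV" using K by (simp add: measure_body)
  also have "\<dots> \<le> (LINT x|body E K. (x \<bullet> \<theta>)\<^sup>2) / e\<^sup>2 + measure (body E K) ?T"
    using chebyshev_complement[of "\<lambda>x. x \<bullet> \<theta>" e] e
    by (simp add: integrable_body_continuous[OF onb_E K(2)] continuous_intros)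
  also have "(LINT x|body E K. (x \<bullet> \<theta>)\<^sup>2) = L\<^sup>2" using K(9)[OF \<theta>_E] norm_\<theta> by simp
  also have "L\<^sup>2 / e\<^sup>2 = 16 * L\<^sup>2 * V\<^sup>2" by (simp add: e_def power_divide power_mult_distrib)
  finally show ?thesis using m1 by simp
qed

text \<open>The inscribed ball gives f 0 \<ge> 2 \<rho>. By concavity f \<ge> \<rho> on the
  half-size copy of \<open>Q\<close>, which has volume V / 2^d, and the integral of \<open>f\<close>
  is 1.\<close>

lemma volume_Q_upper: "L / sqrt (4 + moment_const) * V \<le> 2 ^ dim H"
proof -
  define \<rho> where "\<rho> = L / sqrt (4 + moment_const)"
  have \<rho>: "\<rho> > 0" using K(7) moment_const_ge by (simp add: \<rho>_def)
  have V: "V > 0" by (rule Q_props)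
  have 0: "0 \<in> H" using sub_H by (simp add: subspace_0)
  have in_K: "t *\<^sub>R \<theta> \<in> K" if "\<bar>t\<bar> \<le> \<rho>" for t
    using that \<theta>_E sub_E norm_\<theta>
    by (intro isotropic_contains_ball[OF onb_E iso]) (auto simp: \<rho>_def subspace_scale)
  have 0: "0 \<in> H" "0 \<in> Q" using sub_H in_K[of 0] \<rho> linear_0[OF linear_P]
    by (auto simp: subspace_0 Q_def intro!: rev_image_eqI[of 0])
  have "ennreal (2 * \<rho>) = emeasure lborel {-\<rho>..\<rho>}" using \<rho> by simp
  also have "\<dots> \<le> emeasure lborel (chord 0)"
  proof (rule emeasure_mono)
    show "{-\<rho>..\<rho>} \<subseteq> chord 0" using in_K by (auto simp: chord_def)
  qed simp
  also have "\<dots> = ennreal (f 0)" by (rule emeasure_chord_eq[OF 0(1)])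
  finally have f0: "2 * \<rho> \<le> f 0" using f_nonneg by (simp add: ennreal_le_iff)
  let ?h = "\<lambda>x::'a. (1/2) *\<^sub>R x"
  have lin: "linear ?h" by (rule linearI) (simp_all add: algebra_simps)
  have bij: "bij_betw ?h H H"
    by (rule bij_betw_byWitness[where f' = "\<lambda>x. 2 *\<^sub>R x"]) (auto simp: subspace_scale[OF sub_H])
  have half_Q: "?h ` Q \<subseteq> Q"
    using convex_midpoint[OF Q_props(2) _ 0(2)] by auto
  have f_half: "\<rho> \<le> f y" if y: "y \<in> ?h ` Q" for y
  proof -
    obtain x where x: "x \<in> Q" "y = ?h (x + 0)" using y by auto
    have "(f x + f 0) / 2 \<le> f y" 
      unfolding x(2) by (rule midconcave_f[unfolded midconcave_on_def, rule_format, OF x(1) 0(2)])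
    then show ?thesis using f0 f_nonneg[of x] by simp
  qed
  have cb: "convex_body H (?h ` Q)"
    using convex_body_affine_image[OF onb_H convex_body_Q lin bij 0(1)] by simp
  have hb [measurable]: "?h ` Q \<in> sets borel" by (rule convex_body_borel[OF cb])
  have "(1/2) ^ dim H * V \<le> measure (vol H) (?h ` Q)"
    using volume_affine_image_ge[OF onb_H convex_body_Q lin bij 0(1), of "1/2"] by simp
  then have "(1/2) ^ dim H * (\<rho> * V) \<le> \<rho> * measure (vol H) (?h ` Q)"
    using \<rho> by (simp add: mult_left_mono mult.left_commute)
  also have "\<rho> * measure (vol H) (?h ` Q) \<le> 1"
  proof -
    interpret finite_measure "M" by (rule finite_Q)
    have "\<rho> * measure (vol H) (?h ` Q) = (LINT y|M. \<rho> * indicator (?h ` Q) y)"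
      using half_Q Q_props(4) by (simp add: measure_body Int_absorb1)
    also have "\<dots> \<le> (LINT y|M. f y)"
    proof (rule integral_mono)
      show "\<rho> * indicator (?h ` Q) y \<le> f y" for y using f_half f_nonneg by (simp add: indicator_def)
      show "integrable M f" using integrable_f_power[of 1] by simp
    qed (simp add: emeasure_eq_measure)
    finally show ?thesis by (simp add: integral_f)
  qed
  finally have "2 ^ dim H * ((1/2) ^ dim H * (\<rho> * V)) \<le> 2 ^ dim H * 1"
    by (intro mult_left_mono) auto
  moreover have "2 ^ dim H * ((1/2) ^ dim H * (\<rho> * V)) = \<rho> * V"
    by (simp add: power_divide)
  ultimately show ?thesis by (simp only: \<rho>_def mult_1_right)
qed

subsection \<open>Isotropic position of the projection\<close>

definition mean :: "'a \<Rightarrow> real" where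
  "mean u = (LINT y|M. y \<bullet> u) / V"

definition Cov :: "'a \<Rightarrow> 'a \<Rightarrow> real" where
  "Cov u v = (LINT y|M. (y \<bullet> u - mean u) * (y \<bullet> v - mean v)) / V"

lemma mean_linear: "mean (u + v) = mean u + mean v" "mean (r *\<^sub>R u) = r * mean u"
proof -
  have "(LINT y|M. y \<bullet> (u + v)) = (LINT y|M. y \<bullet> u) + (LINT y|M. y \<bullet> v)"
    by (simp add: inner_add_right integrable_Q continuous_intros)
  then show "mean (u + v) = mean u + mean v" by (simp add: mean_def add_divide_distrib)
  show "mean (r *\<^sub>R u) = r * mean u" by (simp add: mean_def)
qed

lemma Cov_add: "Cov (u + v) z = Cov u z + Cov v z"
proof -
  have "(LINT y|M. (y \<bullet> (u + v) - mean (u + v)) * (y \<bullet> z - mean z))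
      = (LINT y|M. (y \<bullet> u - mean u) * (y \<bullet> z - mean z) + (y \<bullet> v - mean v) * (y \<bullet> z - mean z))"
    by (simp add: inner_add_right mean_linear algebra_simps)
  also have "\<dots> = (LINT y|M. (y \<bullet> u - mean u) * (y \<bullet> z - mean z)) + (LINT y|M. (y \<bullet> v - mean v) * (y \<bullet> z - mean z))"
    by (intro Bochner_Integration.integral_add integrable_Q continuous_intros)
  finally show ?thesis by (simp add: Cov_def add_divide_distrib)
qed

lemma Cov_scale: "Cov (r *\<^sub>R u) z = r * Cov u z"
proof -
  have "(LINT y|M. (y \<bullet> (r *\<^sub>R u) - mean (r *\<^sub>R u)) * (y \<bullet> z - mean z))
      = (LINT y|M. r * ((y \<bullet> u - mean u) * (y \<bullet> z - mean z)))"
    by (simp add: mean_linear algebra_simps)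
  then show ?thesis by (simp add: Cov_def)
qed

lemma Cov_sym: "Cov u v = Cov v u"
  by (simp add: Cov_def mult.commute)

lemma Cov_unit_bounds:
  assumes u: "u \<in> H" "norm u = 1"
  shows "L\<^sup>2 / (2 * lower_var_const) \<le> Cov u u" "Cov u u \<le> upper_var_const * L\<^sup>2"
proof -
  have V: "V > 0" by (rule Q_props)
  have Cov: "(LINT y|M. (y \<bullet> u - mean u)\<^sup>2) = Cov u u * V"
    using V by (simp add: Cov_def power2_eq_square)
  show "L\<^sup>2 / (2 * lower_var_const) \<le> Cov u u"
  proof (rule ccontr)
    assume "\<not> ?thesis"
    then have less: "Cov u u \<le> L\<^sup>2 / (2 * lower_var_const)" by simp
    \<comment> \<open>At half the critical variance, \<open>variance_lower\<close> would give L^2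
      \<le> L^2 / 2; this is the origin of the factor 2 in the bound.\<close>
    define \<sigma> where "\<sigma> = sqrt (L\<^sup>2 / (2 * lower_var_const))"
    have \<sigma>: "\<sigma> > 0" "\<sigma>\<^sup>2 = L\<^sup>2 / (2 * lower_var_const)"
      using lower_var_const_pos K(7) by (simp_all add: \<sigma>_def)
    have "L\<^sup>2 \<le> lower_var_const * \<sigma>\<^sup>2"
      using less V by (intro variance_lower[OF u \<sigma>(1), of "mean u"]) (simp only: Cov \<sigma>(2) mult_right_mono less_imp_le)
    also have "\<dots> = L\<^sup>2 / 2" using lower_var_const_pos by (simp add: \<sigma>(2))
    finally show False using K(7) by simp
  qed
  have "(LINT y|M. (y \<bullet> u - mean u)\<^sup>2)
      = (LINT y|M. (y \<bullet> u)\<^sup>2 - (2 * mean u) * (y \<bullet> u) + (mean u)\<^sup>2)"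
    by (simp add: power2_diff algebra_simps)
  also have "\<dots> = (LINT y|M. (y \<bullet> u)\<^sup>2) - (2 * mean u) * (LINT y|M. y \<bullet> u) + (LINT y|M. (mean u)\<^sup>2)"
    by (simp add: integrable_Q continuous_intros)
  also have "\<dots> = (LINT y|M. (y \<bullet> u)\<^sup>2) - (mean u)\<^sup>2 * V"
    using V integral_body_const[OF onb_H Q_props(1), of "(mean u)\<^sup>2"] by (simp add: mean_def power2_eq_square field_simps)
  also have "\<dots> \<le> upper_var_const * L\<^sup>2 * V"
  proof -
    have "0 \<le> (mean u)\<^sup>2 * V" using V by simp
    then show ?thesis using variance_upper[OF u] by linarith
  qed
  finally show "Cov u u \<le> upper_var_const * L\<^sup>2" unfolding Cov using V by simp
qed

lemma Cov_bounds:
  assumes u: "u \<in> H"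
  shows "L\<^sup>2 / (2 * lower_var_const) * (norm u)\<^sup>2 \<le> Cov u u" "Cov u u \<le> upper_var_const * L\<^sup>2 * (norm u)\<^sup>2"
proof -
  have *: "Cov u u = (norm u)\<^sup>2 * Cov (sgn u) (sgn u)" if "u \<noteq> 0"
  proof -
    have "Cov (norm u *\<^sub>R sgn u) (norm u *\<^sub>R sgn u) = (norm u)\<^sup>2 * Cov (sgn u) (sgn u)"
      by (simp add: Cov_scale Cov_sym[of "sgn u" "norm u *\<^sub>R sgn u"] power2_eq_square)
    then show ?thesis using that by (simp add: sgn_div_norm)
  qed
  have 0: "Cov 0 0 = 0" using Cov_scale[of 0 0 0] by simp
  have H: "sgn u \<in> H" using u sub_H by (simp add: sgn_div_norm subspace_scale)
  show "L\<^sup>2 / (2 * lower_var_const) * (norm u)\<^sup>2 \<le> Cov u u"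
  proof (cases "u = 0")
    case False
    then have "L\<^sup>2 / (2 * lower_var_const) \<le> Cov (sgn u) (sgn u)"
      by (intro Cov_unit_bounds(1) H) (simp add: norm_sgn)
    then have "(norm u)\<^sup>2 * (L\<^sup>2 / (2 * lower_var_const)) \<le> (norm u)\<^sup>2 * Cov (sgn u) (sgn u)"
      by (rule mult_left_mono) simp
    then show ?thesis unfolding *[OF False] by (simp only: mult.commute)
  qed (simp add: 0)
  show "Cov u u \<le> upper_var_const * L\<^sup>2 * (norm u)\<^sup>2"
  proof (cases "u = 0")
    case False
    then have "Cov (sgn u) (sgn u) \<le> upper_var_const * L\<^sup>2"
      by (intro Cov_unit_bounds(2) H) (simp add: norm_sgn)
    then have "(norm u)\<^sup>2 * Cov (sgn u) (sgn u) \<le> (norm u)\<^sup>2 * (upper_var_const * L\<^sup>2)"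
      by (rule mult_left_mono) simp
    then show ?thesis unfolding *[OF False] by (simp only: mult.commute)
  qed (simp add: 0)
qed

text \<open>A whitening map makes the covariance the identity; dividing by d normalises the volume.
  The two-sided bounds for the covariance bound the distortion of the map in both directions, and
  hence d in terms of \<open>V\<close>.\<close>

lemma isotropic_image_of_Q:
  obtains S d where "affine_iso H S" "isotropic_with H (S ` Q) (1 / d)" "d > 0"
    "V * (1 / (sqrt upper_var_const * L)) ^ dim H \<le> d ^ dim H"
    "d ^ dim H \<le> V * (sqrt (2 * lower_var_const) / L) ^ dim H"
proof -
  have V: "V > 0" by (rule Q_props)
  have onB: "orthonormal B" and span_B: "span B = H" using onb_H by (auto simp: is_onb_iff)
  have finB: "finite B" using onB by (rule orthonormal_finite)
  have indepB: "independent B"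
    using onB pairwise_orthogonal_independent[of B] by (fastforce simp: orthonormal_def)
  have pos: "Cov x x > 0" if "x \<in> H" "x \<noteq> 0" for x
  proof -
    have "0 < L\<^sup>2 / (2 * lower_var_const) * (norm x)\<^sup>2"
      using that K(7) lower_var_const_pos by simp
    also have "\<dots> \<le> Cov x x" by (rule Cov_bounds[OF that(1)])
    finally show ?thesis .
  qed
  from gram_schmidt_form[of Cov B, OF Cov_add Cov_scale Cov_sym _ finB indepB, unfolded span_B, OF pos]
  obtain e where "\<forall>b\<in>B. \<forall>b'\<in>B. Cov (e b) (e b') = (if b = b' then 1 else 0)" and span_e: "span (e ` B) = H"
    by auto
  then have e: "\<And>b b'. b \<in> B \<Longrightarrow> b' \<in> B \<Longrightarrow> Cov (e b) (e b') = (if b = b' then 1 else 0)" by blast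
  have eH: "e b \<in> H" if "b \<in> B" for b using span_e that span_superset[of "e ` B"] by auto
  \<comment> \<open>\<open>At\<close>, the adjoint of \<open>A\<close>, carries \<open>B\<close> to
    the \<open>Cov\<close>-orthonormal family, so the uniform distribution on \<open>Q\<close> is
    mapped by \<open>A\<close> to one with identity covariance.\<close>
  define A where "A x = (\<Sum>b\<in>B. (e b \<bullet> x) *\<^sub>R b)" for x
  define At where "At u = (\<Sum>b\<in>B. (u \<bullet> b) *\<^sub>R e b)" for u
  have linA: "linear A"
    unfolding A_def by (rule linearI) (simp_all add: inner_add_right scaleR_add_left sum.distrib scaleR_sum_right)
  have AH: "A x \<in> H" for x
    unfolding A_def using sub_H onb_H by (intro subspace_sum subspace_scale) (auto simp: is_onb_subset)
  have AtH: "At u \<in> H" for u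
    unfolding At_def using sub_H eH by (intro subspace_sum subspace_scale) auto
  have adj: "A x \<bullet> u = x \<bullet> At u" for x u
    unfolding A_def At_def by (simp add: inner_sum_left inner_sum_right inner_commute mult.commute)
  have Cov_sum: "Cov (\<Sum>c\<in>C. g c) z = (\<Sum>c\<in>C. Cov (g c) z)" if "finite C" for C z and g :: "'a \<Rightarrow> 'a"
    using that by (induction C rule: finite_induct) (use Cov_scale[of 0] in \<open>auto simp: Cov_add\<close>)
  have Cov_At: "Cov (At u) (At u) = (norm u)\<^sup>2" if u: "u \<in> H" for u
  proof -
    have "Cov (At u) (e c) = u \<bullet> c" if c: "c \<in> B" for c
    proof -
      have "Cov (At u) (e c) = (\<Sum>b\<in>B. (u \<bullet> b) * Cov (e b) (e c))"
        unfolding At_def by (simp add: Cov_sum finB Cov_scale)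
      also have "\<dots> = (\<Sum>b\<in>B. if b = c then u \<bullet> b else 0)" using e c by (intro sum.cong) auto
      finally show ?thesis using c finB by simp
    qed
    then have ec: "Cov (e c) (At u) = u \<bullet> c" if "c \<in> B" for c using that Cov_sym by metis
    have "Cov (At u) (At u) = (\<Sum>b\<in>B. (u \<bullet> b) * Cov (e b) (At u))"
      by (subst At_def) (simp add: Cov_sum finB Cov_scale)
    also have "\<dots> = (\<Sum>b\<in>B. (u \<bullet> b)\<^sup>2)" using ec by (intro sum.cong) (auto simp: power2_eq_square)
    finally show ?thesis using orthonormal_norm2[OF onB] u span_B by simp
  qed
  have At_surj: "\<exists>u\<in>H. At u = x" if x: "x \<in> H" for x
  proof -
    have "At b = e b" if b: "b \<in> B" for b
    proof -
      have "At b = (\<Sum>c\<in>B. if c = b then e c else 0)"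
        unfolding At_def using orthonormal_inner[OF onB b] by (intro sum.cong) auto
      then show ?thesis using b finB by simp
    qed
    then have "e ` B \<subseteq> At ` H" using onb_H is_onb_subset by (metis image_iff image_subsetI)
    moreover have "subspace (At ` H)"
    proof (rule linear_subspace_image)
      show "linear At" unfolding At_def
        by (rule linearI) (simp_all add: inner_add_left scaleR_add_left sum.distrib scaleR_sum_right)
      show "subspace H" by (rule sub_H)
    qed
    ultimately have "span (e ` B) \<subseteq> At ` H" by (rule span_minimal)
    then show ?thesis using x span_e by auto
  qed
  \<comment> \<open>As \<open>Cov (At u) (At u)\<close> is |u|^2, \<open>Cov_bounds\<close> at
    \<open>At u\<close> puts |At u| between a1 |u| and a2 |u|.\<close>
  define a1 where "a1 = 1 / (sqrt upper_var_const * L)"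
  define a2 where "a2 = sqrt (2 * lower_var_const) / L"
  have a: "a1 > 0" "a2 > 0"
    using K(7) lower_var_const_pos upper_var_const_pos by (auto simp: a1_def a2_def)
  have At_up: "norm (At u) \<le> a2 * norm u" if u: "u \<in> H" for u
  proof -
    have "(norm (At u))\<^sup>2 \<le> (a2 * norm u)\<^sup>2"
      using Cov_bounds(1)[OF AtH[of u]] Cov_At[OF u] K(7) lower_var_const_pos
      by (simp add: a2_def power_mult_distrib power_divide field_simps)
    then show ?thesis by (rule power2_le_imp_le) (use a in simp)
  qed
  have At_low: "a1 * norm u \<le> norm (At u)" if u: "u \<in> H" for u
  proof -
    have "(a1 * norm u)\<^sup>2 \<le> (norm (At u))\<^sup>2"
      using Cov_bounds(2)[OF AtH[of u]] Cov_At[OF u] K(7) upper_var_const_pos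
      by (simp add: a1_def power_mult_distrib power_divide field_simps)
    then show ?thesis by (rule power2_le_imp_le) simp
  qed
  have A_up: "norm (A x) \<le> a2 * norm x" for x
    by (rule norm_le_of_adjoint[OF adj _ At_up[OF AH]]) (use a in simp)
  \<comment> \<open>A lower bound passes to the adjoint through surjectivity: with x = At u one has
    |x|^2 = A x \<bullet> u \<le> |A x| |u| and a1 |u| \<le> |x|.\<close>
  have A_low: "a1 * norm x \<le> norm (A x)" if x: "x \<in> H" for x
  proof (cases "x = 0")
    case False
    obtain u where u: "u \<in> H" "At u = x" using At_surj[OF x] by auto
    have "norm x * norm x = A x \<bullet> u"
      using adj[of x u] u by (simp add: power2_norm_eq_inner[symmetric] power2_eq_square)
    also have "\<dots> \<le> norm (A x) * norm u" by (rule norm_cauchy_schwarz)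
    finally have "a1 * (norm x * norm x) \<le> norm (A x) * (a1 * norm u)"
      using a by (simp add: mult_left_mono mult.left_commute)
    also have "\<dots> \<le> norm (A x) * norm x" using At_low[OF u(1)] u(2) by (intro mult_left_mono) auto
    finally have "(a1 * norm x) * norm x \<le> norm (A x) * norm x" by (simp add: mult_ac)
    then show ?thesis using False by simp
  qed simp
  have bijA: "bij_betw A H H"
  proof -
    have inj: "inj_on A H"
    proof (rule inj_onI)
      fix x y assume xy: "x \<in> H" "y \<in> H" "A x = A y"
      then have "a1 * norm (x - y) \<le> norm (A (x - y))" using sub_H by (intro A_low) (auto intro: subspace_diff)
      then have "a1 * norm (x - y) \<le> 0" using xy by (simp add: linear_diff[OF linA])
      then show "x = y" using a by (simp add: mult_le_0_iff)
    qed
    have inj_span: "inj_on A (span B)" using inj unfolding span_B .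
    have 1: "independent (A ` B)"
      by (rule linear_independent_injective_image[OF linA indepB inj_span])
    have "B \<subseteq> H" using is_onb_subset[OF onb_H] by blast
    then have 2: "card (A ` B) = card B"
      using inj by (intro card_image) (rule inj_on_subset)
    have 3: "A ` B \<subseteq> H" using AH by blast
    have "H \<subseteq> span (A ` B)"
      by (rule independent_card_span[OF finB _ 1 3]) (simp_all only: span_B 2 order_refl)
    also have "\<dots> = A ` H" using linear_span_image[OF linA, of B] span_B by simp
    finally have "A ` H = H" using AH by auto
    then show ?thesis using inj by (simp add: bij_betw_def)
  qed
  have cbA: "convex_body H (A ` Q)"
    using convex_body_affine_image[OF onb_H convex_body_Q linA bijA subspace_0[OF sub_H]] by simp
  define W where "W = measure (vol H) (A ` Q)"
  have W: "W > 0" unfolding W_def by (rule convex_body_measure_pos[OF onb_H cbA])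
  have W_low: "V * a1 ^ dim H \<le> W"
    using volume_affine_image_ge[OF onb_H convex_body_Q linA bijA subspace_0[OF sub_H] a(1) A_low]
    by (simp add: W_def mult.commute)
  have W_up: "W \<le> V * a2 ^ dim H"
    using volume_affine_image_le[OF onb_H convex_body_Q linA bijA subspace_0[OF sub_H] a(2) A_up]
    by (simp add: W_def mult.commute)
  \<comment> \<open>Division by d makes the volume 1 and turns the identity covariance into 1/d^2
    times the identity, so the isotropy constant is 1/d.\<close>
  define d where "d = root (dim H) W"
  have d: "d > 0" "d ^ dim H = W" using W dim_H by (simp_all add: d_def)
  \<comment> \<open>The barycenter of \<open>Q\<close>, which the translation moves to 0.\<close>
  define p where "p = (\<Sum>b\<in>B. mean b *\<^sub>R b)"
  have pH: "p \<in> H" unfolding p_def using sub_H onb_H by (intro subspace_sum subspace_scale) (auto simp: is_onb_subset)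
  have p: "p \<bullet> u = mean u" if u: "u \<in> H" for u
  proof -
    have mean_sum: "mean (\<Sum>c\<in>C. g c) = (\<Sum>c\<in>C. mean (g c))" if "finite C" for C and g :: "'a \<Rightarrow> 'a"
      using that by (induction C rule: finite_induct) (use mean_linear(2)[of 0] in \<open>auto simp: mean_linear\<close>)
    have "mean u = mean (\<Sum>b\<in>B. (u \<bullet> b) *\<^sub>R b)" using is_onb_expand[OF onb_H u] by simp
    also have "\<dots> = (\<Sum>b\<in>B. (u \<bullet> b) * mean b)" by (simp add: mean_sum finB mean_linear)
    finally show ?thesis by (simp add: p_def inner_sum_left inner_commute[of u] mult.commute)
  qed
  define sA where "sA x = (1 / d) *\<^sub>R A x" for x
  define v where "v = - sA p"
  have lin_s: "linear sA" unfolding sA_def by (rule linear_compose_scale_right[OF linA])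
  let ?h = "\<lambda>x::'a. (1 / d) *\<^sub>R x"
  have lin_h: "linear ?h" by (rule linearI) (simp_all add: algebra_simps)
  have bij_h: "bij_betw ?h H H"
    by (rule bij_betw_byWitness[where f' = "\<lambda>x. d *\<^sub>R x"]) (use d in \<open>auto simp: subspace_scale[OF sub_H]\<close>)
  have bij_s: "bij_betw sA H H"
    using bij_betw_trans[OF bijA bij_h] by (simp add: sA_def[abs_def] o_def)
  have vH: "v \<in> H" unfolding v_def sA_def by (intro subspace_neg[OF sub_H] subspace_scale[OF sub_H] AH)
  let ?S = "\<lambda>x. sA x + v"
  have aff: "affine_iso H ?S" unfolding affine_iso_def using lin_s bij_s vH by blast
  have cbS: "convex_body H (?S ` Q)" by (rule convex_body_affine_image[OF onb_H convex_body_Q lin_s bij_s vH])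
  have vol1: "measure (vol H) (?S ` Q) = 1"
  proof -
    have "measure (vol H) ((\<lambda>x. ?h x + v) ` A ` Q) = (1 / d) ^ dim H * W"
      unfolding W_def using d(1)
      by (intro antisym volume_affine_image_le[OF onb_H cbA lin_h bij_h vH]
          volume_affine_image_ge[OF onb_H cbA lin_h bij_h vH]) auto
    moreover have "(\<lambda>x. ?h x + v) ` A ` Q = ?S ` Q" by (simp add: image_image sA_def)
    ultimately show ?thesis using W d by (simp add: power_divide)
  qed
  have int_S: "(LINT x|M. g' x) = V * (LINT x|body H (?S ` Q). (g x :: real))"
    if "g \<in> borel_measurable borel" "g' \<in> borel_measurable borel" "\<And>x. x \<in> Q \<Longrightarrow> g (sA x + v) = g' x" for g g'
    using mean_affine_image[OF onb_H convex_body_Q lin_s bij_s vH that] V vol1 by simp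
  let ?Y = "\<lambda>u x. x \<bullet> At u - mean (At u)"
  have S_inner: "?S x \<bullet> u = (1 / d) * ?Y u x" for x u
    using p[OF AtH[of u]] by (simp add: sA_def v_def inner_add_left inner_diff_left adj algebra_simps)
  have "isotropic_with H (?S ` Q) (1 / d)"
  proof (rule isotropic_withI[OF onb_H cbS vol1])
    show "1 / d > 0" using d by simp
    fix u assume u: "u \<in> H"
    have "(LINT x|M. (1 / d) * ?Y u x) = V * (LINT x|body H (?S ` Q). x \<bullet> u)"
      by (rule int_S) (simp_all add: S_inner)
    moreover have "(LINT x|M. ?Y u x) = 0"
      using integral_body_const[OF onb_H Q_props(1), of "mean (At u)"] V
      by (subst Bochner_Integration.integral_diff) (auto simp: mean_def intro!: integrable_Q continuous_intros)
    ultimately show "(LINT x|body H (?S ` Q). x \<bullet> u) = 0" using V by simp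
    assume u1: "norm u = 1"
    have "(LINT x|M. (1 / d)\<^sup>2 * (?Y u x * ?Y u x)) = V * (LINT x|body H (?S ` Q). (x \<bullet> u)\<^sup>2)"
      by (rule int_S) (simp_all only: S_inner power_mult_distrib power2_eq_square[of "_ - mean _"], simp_all)
    moreover have "(LINT x|M. ?Y u x * ?Y u x) = V"
      using Cov_At[OF u] u1 V by (simp add: Cov_def)
    ultimately show "(LINT x|body H (?S ` Q). (x \<bullet> u)\<^sup>2) = (1 / d)\<^sup>2" using V by simp
  qed
  then show thesis
    using that[OF aff _ d(1)] W_low W_up d(2) by (simp add: a1_def a2_def)
qed

text \<open>Makes the bounds for \<open>L\<close>, which are polynomial in the dimension,
  exponential in \<open>dim H\<close>, so that they disappear in the \<open>dim H\<close>-th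
  root.\<close>

lemma dim_E: "real (dim E) \<le> 2 ^ dim H"
proof -
  have "dim E = Suc (dim H)"
    using is_onb_card[OF onb_E] is_onb_card[OF onb_H] \<theta>_notin onb_H by (simp add: is_onb_def)
  then have "dim E \<le> 2 ^ dim H" using less_exp[of "dim H"] by (simp add: Suc_le_eq)
  then show ?thesis by (metis of_nat_le_iff of_nat_numeral of_nat_power)
qed

text \<open>The constant of \<open>Q\<close> is 1/d, and d^k equals V / L^k up to k-th powers of
  constants. As \<open>V\<close> itself lies between k-th powers of constants, k-th roots compare
  1/d with L.\<close>

lemma isotropy_const_Q_bounds:
  defines "\<kappa> \<equiv> sqrt (4 + moment_const)"
  shows "1 / (24 * \<kappa> * sqrt (2 * lower_var_const)) * L \<le> isotropy_const H Q"
    and "isotropy_const H Q \<le> 6 * \<kappa> * sqrt upper_var_const * L"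
proof -
  define k where "k = dim H"
  have k: "1 \<le> k" using dim_H by (simp add: k_def)
  have L: "L > 0" and V: "V > 0" using K(7) Q_props by auto
  have \<kappa>: "\<kappa> \<ge> 1" "\<kappa>\<^sup>2 = 4 + moment_const"
    using moment_const_ge by (simp_all add: \<kappa>_def)
  obtain S d where S: "affine_iso H S" "isotropic_with H (S ` Q) (1 / d)" "d > 0"
    "V * (1 / (sqrt upper_var_const * L)) ^ k \<le> d ^ k"
    "d ^ k \<le> V * (sqrt (2 * lower_var_const) / L) ^ k"
    using isotropic_image_of_Q unfolding k_def by metis
  have const: "isotropy_const H Q = 1 / d"
    by (rule isotropy_const_eq[OF onb_H dim_H Q_props(3) S(1,2)])
  have n: "real (dim E) \<le> 2 ^ k" using dim_E by (simp add: k_def)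
  have dimE: "dim E \<ge> 1"
    using is_onb_card[OF onb_E] onb_H \<theta>_notin by (simp add: is_onb_def)
  have 24: "(2::real) ^ k \<le> (2 ^ k)\<^sup>2" by (simp add: self_le_power)
  \<comment> \<open>32 is rounded up to the square 36 before the root is taken.\<close>
  have L_low: "1 \<le> 6 * 2 ^ k * L"
  proof -
    have "1 \<le> 32 * dim E * L\<^sup>2" by (rule isotropic_const_lower[OF onb_E iso dimE])
    also have "\<dots> \<le> 36 * (2 ^ k)\<^sup>2 * L\<^sup>2"
    proof (rule mult_right_mono)
      have "32 * real (dim E) \<le> 36 * (2 ^ k)\<^sup>2"
        using n 24 zero_le_power2[of "2 ^ k :: real"] by linarith
      then show "real (32 * dim E) \<le> 36 * (2 ^ k)\<^sup>2" by simp
    qed simp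
    finally have "1\<^sup>2 \<le> (6 * 2 ^ k * L)\<^sup>2" by (simp add: power_mult_distrib)
    then show ?thesis by (rule power2_le_imp_le) (use L in simp)
  qed
  have L_up: "2 * L \<le> \<kappa> * 2 ^ k"
  proof -
    have "4 * L\<^sup>2 \<le> \<kappa>\<^sup>2 * dim E"
      using isotropic_const_upper[OF onb_E iso dimE] by (simp add: \<kappa>(2))
    also have "\<dots> \<le> \<kappa>\<^sup>2 * (2 ^ k)\<^sup>2"
      by (rule mult_left_mono[OF order_trans[OF n 24]]) simp
    finally have "(2 * L)\<^sup>2 \<le> (\<kappa> * 2 ^ k)\<^sup>2" by (simp add: power_mult_distrib)
    then show ?thesis by (rule power2_le_imp_le) (use \<kappa> in simp)
  qed
  \<comment> \<open>L V \<le> \<kappa> 2^k and 1 \<le> 6 * 2^k L combine to V \<le> 6 \<kappa> 4^k;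
    as k \<ge> 1 and 6 \<kappa> \<ge> 1, the prefactor may be moved under the power.\<close>
  have V_up: "V \<le> (24 * \<kappa>) ^ k"
  proof -
    have "L * V \<le> \<kappa> * 2 ^ k"
      using volume_Q_upper \<kappa>(1) by (simp add: k_def \<kappa>_def field_simps)
    then have "6 * 2 ^ k * (L * V) \<le> 6 * 2 ^ k * (\<kappa> * 2 ^ k)" by (intro mult_left_mono) auto
    moreover have "1 * V \<le> (6 * 2 ^ k * L) * V" using L_low V by (intro mult_right_mono) auto
    moreover have "6 * 2 ^ k * (L * V) = (6 * 2 ^ k * L) * V"
        "6 * 2 ^ k * (\<kappa> * 2 ^ k) = (6 * \<kappa>) * (2 ^ k * 2 ^ k)"
      by (simp_all only: mult.assoc mult.commute mult.left_commute)
    ultimately have "V \<le> (6 * \<kappa>) * (2 ^ k * 2 ^ k)" by linarith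
    also have "\<dots> \<le> (6 * \<kappa>) ^ k * (2 ^ k * 2 ^ k)"
      by (rule mult_right_mono[OF self_le_power]) (use \<kappa>(1) k in simp_all)
    also have "\<dots> = (6 * \<kappa> * (2 * 2)) ^ k" by (simp only: power_mult_distrib)
    also have "6 * \<kappa> * (2 * 2) = 24 * \<kappa>" by simp
    finally show ?thesis .
  qed
  \<comment> \<open>Here 1 \<le> 6 L V and 2 L \<le> \<kappa> 2^k combine to 1 \<le> 3 \<kappa> 2^k
    V, and 3 \<kappa> is moved under the power.\<close>
  have V_low: "1 \<le> V * (6 * \<kappa>) ^ k"
  proof -
    have "1\<^sup>2 \<le> (6 * L * V)\<^sup>2"
      using volume_Q_lower zero_le_power2[of "L * V"] by (simp add: power_mult_distrib)
    then have "1 \<le> 6 * L * V" by (rule power2_le_imp_le) (use L V in simp)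
    also have "\<dots> = 3 * V * (2 * L)" by simp
    also have "\<dots> \<le> 3 * V * (\<kappa> * 2 ^ k)" using L_up V by (intro mult_left_mono) auto
    also have "\<dots> = V * ((3 * \<kappa>) * 2 ^ k)" by simp
    also have "\<dots> \<le> V * ((3 * \<kappa>) ^ k * 2 ^ k)"
      by (rule mult_left_mono[OF mult_right_mono[OF self_le_power]]) (use \<kappa>(1) k V in simp_all)
    also have "\<dots> = V * (3 * \<kappa> * 2) ^ k" by (simp only: power_mult_distrib)
    also have "3 * \<kappa> * 2 = 6 * \<kappa>" by simp
    finally show ?thesis .
  qed
  define \<alpha> where "\<alpha> = sqrt (2 * lower_var_const)"
  define \<beta> where "\<beta> = sqrt upper_var_const"
  have ab: "\<alpha> > 0" "\<beta> > 0"
    using lower_var_const_pos upper_var_const_pos by (simp_all add: \<alpha>_def \<beta>_def)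
  have \<kappa>0: "\<kappa> > 0" using \<kappa>(1) by linarith
  have "d ^ k \<le> V * (\<alpha> / L) ^ k" using S(5) unfolding \<alpha>_def .
  also have "\<dots> \<le> (24 * \<kappa>) ^ k * (\<alpha> / L) ^ k"
    by (rule mult_right_mono[OF V_up]) (use ab L in simp)
  also have "\<dots> = (24 * \<kappa> * (\<alpha> / L)) ^ k" by (simp only: power_mult_distrib)
  finally have "d \<le> 24 * \<kappa> * (\<alpha> / L)"
    by (rule power_le_imp_le_base_pos) (use L \<kappa>0 ab k in simp_all)
  then have "d * L \<le> 24 * \<kappa> * \<alpha>" using L by (simp add: pos_le_divide_eq)
  then have "1 / (24 * \<kappa> * \<alpha>) * L \<le> 1 / d"
    using S(3) \<kappa>0 ab by (simp add: field_simps)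
  then show "1 / (24 * \<kappa> * sqrt (2 * lower_var_const)) * L \<le> isotropy_const H Q"
    unfolding const \<alpha>_def .
  have "1 * (1 / (\<beta> * L)) ^ k \<le> (V * (6 * \<kappa>) ^ k) * (1 / (\<beta> * L)) ^ k"
    by (rule mult_right_mono[OF V_low]) (use L ab in simp)
  also have "\<dots> = (V * (1 / (\<beta> * L)) ^ k) * (6 * \<kappa>) ^ k" by (simp only: mult_ac)
  also have "\<dots> \<le> d ^ k * (6 * \<kappa>) ^ k"
    by (rule mult_right_mono[OF S(4)[folded \<beta>_def]]) (use \<kappa>0 in simp)
  also have "\<dots> = (d * (6 * \<kappa>)) ^ k" by (simp only: power_mult_distrib)
  finally have "(1 / (\<beta> * L)) ^ k \<le> (d * (6 * \<kappa>)) ^ k" by (simp only: mult_1_left)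
  then have "1 / (\<beta> * L) \<le> d * (6 * \<kappa>)"
    by (rule power_le_imp_le_base_pos) (use S(3) \<kappa>0 k in simp_all)
  then have "1 / d \<le> 6 * \<kappa> * \<beta> * L"
    using S(3) L ab by (simp add: field_simps)
  then show "isotropy_const H Q \<le> 6 * \<kappa> * sqrt upper_var_const * L"
    unfolding const \<beta>_def .
qed

end

subsection \<open>Orthonormal bases of the coordinate spaces and their hyperplanes\<close>

lemma is_onb_Rn: "\<exists>C. is_onb (Rn n) C \<and> card C = n"
proof -
  define e where "e i = Fin_Seq (\<lambda>j. if j = i then 1 else 0)" for i :: nat
  have e: "coord (e i) j = (if j = i then 1 else 0)" for i j
    unfolding e_def by (subst coord_Fin_Seq) auto
  have eRn: "e i \<in> Rn n" if "i < n" for i n using that by (auto simp: Rn_def e)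
  have inner: "e i \<bullet> x = coord x i" for i x
    by (subst inner_Rn[OF eRn[of i "Suc i"]]) (simp_all add: e)
  have inj: "inj e" by (rule injI) (metis e zero_neq_one)
  let ?C = "e ` {..<n}"
  have "span ?C = Rn n"
  proof (rule antisym)
    show "span ?C \<subseteq> Rn n" by (intro span_minimal subspace_Rn) (auto intro: eRn)
    show "Rn n \<subseteq> span ?C"
    proof
      fix x assume x: "x \<in> Rn n"
      have sum: "coord (\<Sum>i\<in>A. g i) j = (\<Sum>i\<in>A. coord (g i) j)" if "finite A" for A :: "nat set" and g j
        using that by (induction A rule: finite_induct) auto
      have "x = (\<Sum>i<n. coord x i *\<^sub>R e i)"
        using x by (intro fin_seq_eqI) (auto simp: sum e Rn_def if_distrib cong: if_cong)
      also have "\<dots> \<in> span ?C" by (intro span_sum span_scale span_base) auto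
      finally show "x \<in> span ?C" .
    qed
  qed
  moreover have "pairwise orthogonal ?C"
    by (auto simp: pairwise_def orthogonal_def inner e)
  moreover have "norm (e i) = 1" for i by (simp add: norm_eq_1 inner e)
  ultimately have "is_onb (Rn n) ?C" by (auto simp: is_onb_def)
  moreover have "card ?C = n" using inj by (simp add: card_image inj_on_subset)
  ultimately show ?thesis by blast
qed

text \<open>The component orthogonal to \<open>H\<close> of any vector of \<open>E\<close> outside
  \<open>H\<close>, normalised, is the missing basis vector; counting dimensions shows that it
  completes the basis.\<close>

lemma hyperplane_onb:
  fixes H E :: "'a::real_inner set"
  assumes C: "is_onb E C" and H: "subspace H" "H \<subseteq> E" and dim: "dim H + 1 = dim E"
  obtains B \<theta> where "is_onb H B" "is_onb E (insert \<theta> B)" "\<theta> \<notin> B"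
proof -
  have finC: "finite C" and spanC: "span C = E" using C by (auto simp: is_onb_def)
  obtain D where D: "D \<subseteq> H" "independent D" "H \<subseteq> span D" by (rule maximal_independent_subset)
  have "finite D" using independent_span_bound[OF finC D(2)] D(1) H(2) spanC by auto
  moreover have "span D = H" using D(1,3) H(1) by (intro antisym span_minimal) auto
  ultimately have B: "is_onb H (onb H)" by (rule is_onb_onb)
  define B where "B = onb H"
  have onB: "is_onb H B" using B by (simp add: B_def)
  have "\<not> E \<subseteq> H" using H(2) dim by auto
  then obtain x where x: "x \<in> E" "x \<notin> H" by auto
  define y where "y = x - (\<Sum>b\<in>B. (x \<bullet> b) *\<^sub>R b)"
  have projH: "(\<Sum>b\<in>B. (x \<bullet> b) *\<^sub>R b) \<in> H"
    using H(1) is_onb_subset[OF onB] by (intro subspace_sum subspace_scale) auto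
  have y0: "y \<noteq> 0" using x projH by (auto simp: y_def)
  have yE: "y \<in> E" unfolding y_def using x projH H(2) is_onb_subspace[OF C] by (intro subspace_diff) auto
  have yB: "y \<bullet> b = 0" if "b \<in> B" for b
    using orthonormal_sum_inner[of B b "\<lambda>b. x \<bullet> b"] onB that by (simp add: y_def is_onb_iff inner_diff_left)
  define \<theta> where "\<theta> = sgn y"
  have \<theta>: "\<theta> \<in> E" "norm \<theta> = 1" "\<And>b. b \<in> B \<Longrightarrow> \<theta> \<bullet> b = 0"
    using yE y0 yB is_onb_subspace[OF C] by (auto simp: \<theta>_def sgn_div_norm subspace_scale)
  have nB: "\<theta> \<notin> B"
  proof
    assume "\<theta> \<in> B"
    then have "\<theta> \<bullet> \<theta> = 0" by (rule \<theta>(3))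
    then show False using \<theta>(2) by simp
  qed
  have on: "orthonormal (insert \<theta> B)"
    using onB \<theta> nB by (auto simp: is_onb_iff orthonormal_def pairwise_insert orthogonal_def inner_commute)
  have sub: "insert \<theta> B \<subseteq> E" using \<theta>(1) is_onb_subset[OF onB] H(2) by auto
  have indep: "independent (insert \<theta> B)"
    using on pairwise_orthogonal_independent[of "insert \<theta> B"] unfolding orthonormal_def by fastforce
  have card: "card (insert \<theta> B) = card C"
    using nB onB is_onb_card[OF onB] is_onb_card[OF C] dim by (simp add: is_onb_def)
  have "E \<subseteq> span (insert \<theta> B)"
    by (rule independent_card_span[OF finC _ indep sub]) (simp_all only: spanC card order_refl)
  moreover have "span (insert \<theta> B) \<subseteq> E" using sub is_onb_subspace[OF C] by (rule span_minimal)
  ultimately have "span (insert \<theta> B) = E" by (rule antisym[rotated])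
  then have "is_onb E (insert \<theta> B)" unfolding is_onb_iff using on by (rule conjI[rotated])
  then show thesis by (rule that[OF onB _ nB])
qed

theorem corollary5p1:
  shows "\<exists>c1 c2 :: real. c1 > 0 \<and> c2 > 0 \<and>
    (\<forall>(n :: nat) (K :: fin_seq set) (H :: fin_seq set).
       n \<ge> 2 \<longrightarrow> isotropic (Rn n) K \<longrightarrow>
       subspace H \<longrightarrow> H \<subseteq> Rn n \<longrightarrow> dim H = n - 1 \<longrightarrow>
         c1 * isotropy_const (Rn n) K \<le> isotropy_const H (orth_proj H ` K) \<and>
         isotropy_const H (orth_proj H ` K) \<le> c2 * isotropy_const (Rn n) K)"
proof -
  let ?c1 = "1 / (24 * sqrt (4 + moment_const) * sqrt (2 * lower_var_const))"
  let ?c2 = "6 * sqrt (4 + moment_const) * sqrt upper_var_const"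
  have pos: "?c1 > 0" "?c2 > 0"
    using moment_const_ge lower_var_const_pos upper_var_const_pos by simp_all
  have main: "?c1 * isotropy_const (Rn n) K \<le> isotropy_const H (orth_proj H ` K) \<and>
      isotropy_const H (orth_proj H ` K) \<le> ?c2 * isotropy_const (Rn n) K"
    if n: "n \<ge> 2" and iso: "isotropic (Rn n) K" and H: "subspace H" "H \<subseteq> Rn n" "dim H = n - 1"
    for n and K H :: "fin_seq set"
  proof -
    obtain C where C: "is_onb (Rn n) C" "card C = n" using is_onb_Rn by auto
    have dim: "dim (Rn n) = n" using is_onb_card[OF C(1)] C(2) by simp
    obtain B \<theta> where B: "is_onb H B" "is_onb (Rn n) (insert \<theta> B)" "\<theta> \<notin> B"
      by (rule hyperplane_onb[OF C(1) H(1,2)]) (use H(3) n dim in auto)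
    obtain L where L: "isotropic_with (Rn n) K L" using iso by (auto simp: isotropic_def)
    interpret hyperplane_projection "Rn n" H B \<theta> K L
      by unfold_locales (use B L H(3) n in auto)
    have "isotropy_const (Rn n) K = L"
      by (rule isotropy_const_isotropic[OF C(1) _ L]) (use dim n in simp)
    then show ?thesis
      using isotropy_const_Q_bounds by (simp only: Q_eq)
  qed
  show ?thesis
    by (rule exI[of _ ?c1], rule exI[of _ ?c2], intro conjI pos allI impI) (use main in blast)+
qed

end
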